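(* Let $\Gamma$ be a co-compact Fuchsian group with signature $(g;n_1,\ldots,n_k)$, let $n\geq 1$ be an integer, and let $\mathfrak{n}:=\mathrm{lcm}(n_1,\ldots,n_k)$. If $\mathfrak{n}\nmid n$, then there is no surface-kernel epimorphism from $\Gamma$ to $\mathbb{Z}_n$. Otherwise, the number of surface-kernel epimorphisms from $\Gamma$ to $\mathbb{Z}_n$ is $$|\mathrm{Epi}_{\mathrm{S}}(\Gamma,\mathbb{Z}_n)| = \frac{n^{2g}}{\mathfrak{n}}\prod_{i=1}^{k}\varphi(n_i)\prod_{p\mid \frac{n}{\mathfrak{n}}}\left(1-\frac{1}{p^{2g}}\right)\prod_{p\mid \mathfrak{n}}\left(1-\frac{(-1)^{e_p-1}}{(p-1)^{e_p-1}}\right),$$ where the products over $p$ are over primes, and $e_p=\#\{i: 1\leq i\leq k,\ p\nmid \mathfrak{n}/n_i\}$.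
   Context: A co-compact Fuchsian group with signature $(g;n_1,\ldots,n_k)$ (integers $g,k\geq 0$, $n_i\geq 2$, with $\Gamma$ a discrete co-compact subgroup of $\mathrm{PSL}(2,\mathbb{R})$) is the group with presentation with generators $a_1,b_1,\ldots,a_g,b_g,x_1,\ldots,x_k$ and relations $x_1^{n_1}=\cdots=x_k^{n_k}=x_1\cdots x_k[a_1,b_1]\cdots[a_g,b_g]=1$, where $[a,b]=a^{-1}b^{-1}ab$; the $n_i$ are its periods. A surface-kernel epimorphism is an epimorphism from $\Gamma$ onto a finite group whose kernel is a Fuchsian surface group (a Fuchsian group with no periods, i.e. torsion-free); equivalently (Harvey), an epimorphism $\phi$ such that $\phi(x_i)$ has order exactly $n_i$ for each $i$. $\mathrm{Epi}_{\mathrm{S}}(\Gamma,\mathbb{Z}_n)$ is the set of surface-kernel epimorphisms from $\Gamma$ to the cyclic group $\mathbb{Z}_n$. $\varphi$ is Euler's totient function. Empty products equal $1$, and $p^{0}=1$ (so for $g=0$ the factor $1-1/p^{2g}$ is $0$). *)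

theory Defs
  imports
    "HOL-Analysis.Analysis"
    "HOL-Algebra.Coset"
    "HOL-Algebra.Elementary_Groups"
    "HOL-Number_Theory.Totient"
begin

section \<open>The topological group PSL(2,R)\<close>

definition SL2R :: "(real^2^2) monoid" where
  "SL2R = \<lparr>carrier = {A. det A = 1}, mult = (**), one = mat 1\<rparr>"

definition PSL2R :: "(real^2^2) set monoid" where
  "PSL2R = SL2R Mod {mat 1, - mat 1}"

lemma group_SL2R: "group SL2R"
proof (rule groupI)
  fix A assume "A \<in> carrier SL2R"
  hence A: "det A = 1" by (simp add: SL2R_def)
  hence inv: "invertible A" by (simp add: invertible_det_nz)
  then obtain B where B: "A ** B = mat 1" "B ** A = mat 1"
    unfolding invertible_def by blast
  have "det (B ** A) = 1" by (simp add: B)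
  hence "det B = 1" using A by (simp add: det_mul)
  thus "\<exists>B\<in>carrier SL2R. B \<otimes>\<^bsub>SL2R\<^esub> A = \<one>\<^bsub>SL2R\<^esub>"
    using B by (auto simp: SL2R_def)
qed (auto simp: SL2R_def det_mul matrix_mul_assoc)

lemma det_uminus_mat2: "det (- A :: real^2^2) = det A"
  by (simp add: det_2)

lemma normal_center_SL2R: "normal {mat 1, - mat 1} SL2R"
proof -
  interpret group SL2R by (rule group_SL2R)
  have neg: "- A ** B = - (A ** B)" "A ** - B = - (A ** B)" for A B :: "real^2^2"
    by (simp_all add: matrix_matrix_mult_def vec_eq_iff sum_negf)
  have in_carrier: "{mat 1, - mat 1} \<subseteq> carrier SL2R"
    by (auto simp: SL2R_def det_uminus_mat2)
  have sub: "subgroup {mat 1, - mat 1} SL2R"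
  proof (rule subgroupI)
    fix A assume "A \<in> {mat 1, - mat 1 :: real^2^2}"
    hence "A \<otimes>\<^bsub>SL2R\<^esub> A = \<one>\<^bsub>SL2R\<^esub>" "A \<in> carrier SL2R" "A \<in> {mat 1, - mat 1}"
      using in_carrier by (auto simp: SL2R_def neg)
    thus "inv\<^bsub>SL2R\<^esub> A \<in> {mat 1, - mat 1}"
      by (metis inv_equality)
  qed (use in_carrier in \<open>auto simp: SL2R_def neg\<close>)
  show ?thesis
    by (rule normalI[OF sub], intro ballI) (simp add: r_coset_def l_coset_def SL2R_def neg)
qed

lemma group_PSL2R: "group PSL2R"
  unfolding PSL2R_def by (rule normal.factorgroup_is_group[OF normal_center_SL2R])

definition quotient_topology :: "'a topology \<Rightarrow> ('a \<Rightarrow> 'b) \<Rightarrow> 'b topology" where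
  "quotient_topology X q =
     topology (\<lambda>U. U \<subseteq> q ` topspace X \<and> openin X {x \<in> topspace X. q x \<in> U})"

lemma openin_quotient_topology:
  "openin (quotient_topology X q) U \<longleftrightarrow>
     U \<subseteq> q ` topspace X \<and> openin X {x \<in> topspace X. q x \<in> U}"
proof -
  have "istopology (\<lambda>U. U \<subseteq> q ` topspace X \<and> openin X {x \<in> topspace X. q x \<in> U})"
    unfolding istopology_def
  proof (intro conjI allI impI)
    fix S T
    assume S: "S \<subseteq> q ` topspace X \<and> openin X {x \<in> topspace X. q x \<in> S}"
      and T: "T \<subseteq> q ` topspace X \<and> openin X {x \<in> topspace X. q x \<in> T}"
    have "{x \<in> topspace X. q x \<in> S \<inter> T} =
        {x \<in> topspace X. q x \<in> S} \<inter> {x \<in> topspace X. q x \<in> T}" by auto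
    thus "openin X {x \<in> topspace X. q x \<in> S \<inter> T}" using S T by auto
    show "S \<inter> T \<subseteq> q ` topspace X" using S by auto
  next
    fix \<K> assume K: "\<forall>U\<in>\<K>. U \<subseteq> q ` topspace X \<and> openin X {x \<in> topspace X. q x \<in> U}"
    have "{x \<in> topspace X. q x \<in> \<Union>\<K>} = (\<Union>U\<in>\<K>. {x \<in> topspace X. q x \<in> U})" by auto
    thus "openin X {x \<in> topspace X. q x \<in> \<Union>\<K>}" using K by auto
    show "\<Union>\<K> \<subseteq> q ` topspace X" using K by auto
  qed
  thus ?thesis by (simp add: quotient_topology_def topology_inverse')
qed

definition PSL2R_topology :: "(real^2^2) set topology" where
  "PSL2R_topology =
     quotient_topology (top_of_set (carrier SL2R)) (\<lambda>A. {mat 1, - mat 1} #>\<^bsub>SL2R\<^esub> A)"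

section \<open>Co-compact Fuchsian groups and surface groups\<close>

definition cocompact_fuchsian_group :: "(real^2^2) set set \<Rightarrow> bool" where
  "cocompact_fuchsian_group \<Gamma> \<longleftrightarrow>
     subgroup \<Gamma> PSL2R \<and>
     subtopology PSL2R_topology \<Gamma> = discrete_topology \<Gamma> \<and>
     compact_space (quotient_topology PSL2R_topology (\<lambda>x. \<Gamma> #>\<^bsub>PSL2R\<^esub> x))"

definition fuchsian_surface_group :: "(real^2^2) set set \<Rightarrow> bool" where
  "fuchsian_surface_group K \<longleftrightarrow>
     cocompact_fuchsian_group K \<and>
     (\<forall>x\<in>K. \<forall>m::nat. 0 < m \<and> x [^]\<^bsub>PSL2R\<^esub> m = \<one>\<^bsub>PSL2R\<^esub> \<longrightarrow> x = \<one>\<^bsub>PSL2R\<^esub>)"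

section \<open>Groups given by generators and relations\<close>

text \<open>In a word, the letter \<open>(s, True)\<close> stands for the generator \<open>s\<close> and
  \<open>(s, False)\<close> for its formal inverse.\<close>

type_synonym 's word = "('s \<times> bool) list"

definition words :: "'s set \<Rightarrow> 's word set" where
  "words S = lists (S \<times> UNIV)"

inductive pres_eq :: "'s set \<Rightarrow> 's word set \<Rightarrow> 's word \<Rightarrow> 's word \<Rightarrow> bool"
  for S :: "'s set" and R :: "'s word set" where
  refl: "u \<in> words S \<Longrightarrow> pres_eq S R u u"
| sym: "pres_eq S R u v \<Longrightarrow> pres_eq S R v u"
| trans: "pres_eq S R u v \<Longrightarrow> pres_eq S R v w \<Longrightarrow> pres_eq S R u w"
| append: "pres_eq S R u v \<Longrightarrow> pres_eq S R u' v' \<Longrightarrow> pres_eq S R (u @ u') (v @ v')"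
| cancel: "s \<in> S \<Longrightarrow> pres_eq S R [(s, e), (s, \<not> e)] []"
| relator: "r \<in> R \<Longrightarrow> r \<in> words S \<Longrightarrow> pres_eq S R r []"

definition pres_rel :: "'s set \<Rightarrow> 's word set \<Rightarrow> ('s word \<times> 's word) set" where
  "pres_rel S R = {(u, v). pres_eq S R u v}"

definition presented_group :: "'s set \<Rightarrow> 's word set \<Rightarrow> 's word set monoid" where
  "presented_group S R =
     \<lparr>carrier = words S // pres_rel S R,
      mult = (\<lambda>U V. \<Union>u\<in>U. \<Union>v\<in>V. pres_rel S R `` {u @ v}),
      one = pres_rel S R `` {[]}\<rparr>"

lemma pres_eq_words: "pres_eq S R u v \<Longrightarrow> u \<in> words S \<and> v \<in> words S"
  by (induction rule: pres_eq.induct) (auto simp: words_def)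

lemma equiv_pres_rel: "equiv (words S) (pres_rel S R)"
proof (rule equivI)
  show "pres_rel S R \<subseteq> words S \<times> words S"
    using pres_eq_words by (auto simp: pres_rel_def)
  show "refl_on (words S) (pres_rel S R)"
    by (auto simp: refl_on_def pres_rel_def intro: pres_eq.refl)
  show "Relation.sym (pres_rel S R)"
    by (auto simp: sym_def pres_rel_def intro: pres_eq.sym)
  show "Relation.trans (pres_rel S R)"
    by (auto simp: trans_def pres_rel_def intro: pres_eq.trans)
qed

lemma presented_group_mult_class:
  assumes "u \<in> words S" "v \<in> words S"
  shows "(pres_rel S R `` {u}) \<otimes>\<^bsub>presented_group S R\<^esub> (pres_rel S R `` {v}) =
         pres_rel S R `` {u @ v}"
proof -
  have eq: "pres_rel S R `` {u' @ v'} = pres_rel S R `` {u @ v}"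
    if "u' \<in> pres_rel S R `` {u}" "v' \<in> pres_rel S R `` {v}" for u' v'
  proof -
    have "pres_eq S R (u' @ v') (u @ v)"
      using that by (auto simp: pres_rel_def intro: pres_eq.append pres_eq.sym)
    thus ?thesis
      by (intro equiv_class_eq[OF equiv_pres_rel]) (simp add: pres_rel_def)
  qed
  have "u \<in> pres_rel S R `` {u}" "v \<in> pres_rel S R `` {v}"
    using assms by (auto simp: pres_rel_def intro: pres_eq.refl)
  hence "(\<Union>u'\<in>pres_rel S R `` {u}. \<Union>v'\<in>pres_rel S R `` {v}. pres_rel S R `` {u' @ v'}) =
      pres_rel S R `` {u @ v}"
    using eq by blast
  thus ?thesis by (simp add: presented_group_def)
qed

lemma pres_eq_inverse:
  "u \<in> words S \<Longrightarrow> pres_eq S R (rev (map (\<lambda>(s, e). (s, \<not> e)) u) @ u) []"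
proof (induction u)
  case Nil
  show ?case by (auto simp: words_def intro: pres_eq.refl)
next
  case (Cons x u)
  obtain s e where x: "x = (s, e)" by (cases x)
  let ?v = "rev (map (\<lambda>(s, e). (s, \<not> e)) u)"
  have s: "s \<in> S" and u: "u \<in> words S"
    using Cons.prems by (auto simp: x words_def)
  have v: "?v \<in> words S" using u by (auto simp: words_def in_lists_conv_set)
  have "pres_eq S R (?v @ ([(s, \<not> e), (s, \<not> \<not> e)] @ u)) (?v @ ([] @ u))"
    by (intro pres_eq.append pres_eq.cancel pres_eq.refl s u v)
  hence "pres_eq S R (?v @ [(s, \<not> e), (s, e)] @ u) (?v @ u)" by simp
  thus ?case using Cons.IH[OF u] pres_eq.trans by (fastforce simp: x)
qed

lemma group_presented_group: "group (presented_group S R)"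
proof (rule groupI)
  have car: "\<And>U. U \<in> carrier (presented_group S R) \<longleftrightarrow>
      (\<exists>u\<in>words S. U = pres_rel S R `` {u})"
    by (auto simp: presented_group_def quotient_def)
  have one: "\<one>\<^bsub>presented_group S R\<^esub> = pres_rel S R `` {[]}"
    by (simp add: presented_group_def)
  have app: "\<And>u v. u \<in> words S \<Longrightarrow> v \<in> words S \<Longrightarrow> u @ v \<in> words S"
    by (auto simp: words_def)
  have nil: "[] \<in> words S" by (simp add: words_def)
  show "\<one>\<^bsub>presented_group S R\<^esub> \<in> carrier (presented_group S R)"
    unfolding car one using nil by blast
  fix U assume "U \<in> carrier (presented_group S R)"
  then obtain u where u: "u \<in> words S" "U = pres_rel S R `` {u}" unfolding car by blast
  show "\<one>\<^bsub>presented_group S R\<^esub> \<otimes>\<^bsub>presented_group S R\<^esub> U = U"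
    unfolding one u(2) presented_group_mult_class[OF nil u(1)] by simp
  have inv: "rev (map (\<lambda>(s, e). (s, \<not> e)) u) \<in> words S"
    using u by (auto simp: words_def in_lists_conv_set)
  have cl: "pres_rel S R `` {rev (map (\<lambda>(s, e). (s, \<not> e)) u) @ u} = pres_rel S R `` {[]}"
    using pres_eq_inverse[OF u(1)]
    by (intro equiv_class_eq[OF equiv_pres_rel]) (simp add: pres_rel_def)
  show "\<exists>V\<in>carrier (presented_group S R).
      V \<otimes>\<^bsub>presented_group S R\<^esub> U = \<one>\<^bsub>presented_group S R\<^esub>"
  proof (rule bexI)
    show "(pres_rel S R `` {rev (map (\<lambda>(s, e). (s, \<not> e)) u)}) \<otimes>\<^bsub>presented_group S R\<^esub> U =
        \<one>\<^bsub>presented_group S R\<^esub>"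
      unfolding u(2) presented_group_mult_class[OF inv u(1)] one by (rule cl)
    show "pres_rel S R `` {rev (map (\<lambda>(s, e). (s, \<not> e)) u)} \<in> carrier (presented_group S R)"
      unfolding car using inv by blast
  qed
  fix V assume "V \<in> carrier (presented_group S R)"
  then obtain v where v: "v \<in> words S" "V = pres_rel S R `` {v}" unfolding car by blast
  show "U \<otimes>\<^bsub>presented_group S R\<^esub> V \<in> carrier (presented_group S R)"
    unfolding car u(2) v(2) presented_group_mult_class[OF u(1) v(1)]
    using app[OF u(1) v(1)] by blast
  fix W assume "W \<in> carrier (presented_group S R)"
  then obtain w where w: "w \<in> words S" "W = pres_rel S R `` {w}" unfolding car by blast
  show "(U \<otimes>\<^bsub>presented_group S R\<^esub> V) \<otimes>\<^bsub>presented_group S R\<^esub> W =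
      U \<otimes>\<^bsub>presented_group S R\<^esub> (V \<otimes>\<^bsub>presented_group S R\<^esub> W)"
    unfolding u(2) v(2) w(2) using u(1) v(1) w(1) app by (simp add: presented_group_mult_class)
qed

section \<open>Signatures\<close>

datatype fuchsian_gen = GenA nat | GenB nat | GenX nat

definition fuchsian_gens :: "nat \<Rightarrow> nat list \<Rightarrow> fuchsian_gen set" where
  "fuchsian_gens g ns = GenA ` {..<g} \<union> GenB ` {..<g} \<union> GenX ` {..<length ns}"

definition long_relator :: "nat \<Rightarrow> nat list \<Rightarrow> fuchsian_gen word" where
  "long_relator g ns =
     map (\<lambda>i. (GenX i, True)) [0..<length ns] @
     concat (map (\<lambda>i. [(GenA i, False), (GenB i, False), (GenA i, True), (GenB i, True)]) [0..<g])"

definition fuchsian_relators :: "nat \<Rightarrow> nat list \<Rightarrow> fuchsian_gen word set" where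
  "fuchsian_relators g ns =
     insert (long_relator g ns) {replicate (ns ! i) (GenX i, True) | i. i < length ns}"

definition has_signature :: "(real^2^2) set set \<Rightarrow> nat \<Rightarrow> nat list \<Rightarrow> bool" where
  "has_signature \<Gamma> g ns \<longleftrightarrow>
     (\<forall>m\<in>set ns. 2 \<le> m) \<and>
     PSL2R\<lparr>carrier := \<Gamma>\<rparr> \<cong> presented_group (fuchsian_gens g ns) (fuchsian_relators g ns)"

section \<open>Surface-kernel epimorphisms\<close>

text \<open>Homomorphisms of HOL-Algebra are total functions on the ambient type; restricting to
  extensional ones makes two of them equal iff they agree on the group, so that they can be counted.\<close>

definition Epi_S :: "(real^2^2) set set \<Rightarrow> ('b, 'c) monoid_scheme \<Rightarrow> ((real^2^2) set \<Rightarrow> 'b) set" where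
  "Epi_S \<Gamma> H =
     {\<phi> \<in> extensional \<Gamma>. \<phi> \<in> epi (PSL2R\<lparr>carrier := \<Gamma>\<rparr>) H \<and>
        fuchsian_surface_group (kernel (PSL2R\<lparr>carrier := \<Gamma>\<rparr>) H \<phi>)}"

definition period_lcm :: "nat list \<Rightarrow> nat" where
  "period_lcm ns = Lcm (set ns)"

definition e_exponent :: "nat list \<Rightarrow> nat \<Rightarrow> nat" where
  "e_exponent ns p = card {i. i < length ns \<and> \<not> p dvd period_lcm ns div (ns ! i)}"

end

theory Submission
  imports Defs "HOL-Library.Poly_Mapping"
begin

text \<open>A homomorphism to \<open>\<int>\<^sub>n\<close> is a choice of residues for the generators for which \<open>n\<^sub>i x\<^sub>i = 0\<close> and
  \<open>\<Sum> x\<^sub>i = 0\<close>. By Harvey's criterion the kernel is a surface group iff each \<open>x\<^sub>i\<close> has exact order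
  \<open>n\<^sub>i\<close>. Only the abstract presentation of the group is known, so the criterion is proved from it.
  That \<open>x\<^sub>i\<close> has order \<open>n\<^sub>i\<close> in the group follows from representations in PSL(2,C) with prescribed
  traces. That a torsion element of the kernel is trivial follows from the Cayley complex: in an
  infinite group its 2-cells bound no cycle with finite support, so it yields a free resolution of
  \<open>\<int>\<close> of length two over any finite cyclic subgroup of the kernel, and such a subgroup must be
  trivial. Cocompactness enters twice: it makes the group infinite, and it passes to the kernel.

  The residues of the \<open>x\<^sub>i\<close> and of the \<open>a\<^sub>j, b\<^sub>j\<close> are counted separately, since surjectivity only
  concerns the latter modulo \<open>n / lcm(n\<^sub>1, \<dots>, n\<^sub>k)\<close>. Both counts reduce to local densities at primes
  by the Chinese remainder theorem; the density of \<open>\<Sum> d\<^sub>i u\<^sub>i = 0\<close> for units \<open>u\<^sub>i\<close> modulo \<open>p\<close> satisfies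
  a recursion in the number of terms, because one unit is determined by the others.\<close>

section \<open>Presented groups\<close>

text \<open>The obstacle is that no geometry is at hand: neither a fundamental domain nor an action
  on the hyperbolic plane. Torsion has to be controlled by the presentation and by infinitude alone.
  Infinitude already matters for the orders: in signature (0; m, n) the relation x_1 x_2 = 1 gives
  x_1 the order gcd(m, n). For g = 0 and at most two periods the group is finite, hence excluded;
  otherwise a commutator or three matrices with prescribed traces realise x_i with order n_i.
  Harvey's condition says that the epimorphism is injective on the conjugates of <x_i>, the
  stabilisers of the power cells. So the kernel meets them trivially and acts freely on the complex:
  this is how a condition on orders becomes a topological one. In the count, adjoining one unit
  variable multiplies the deviation of the solution density from 1/p by -1/(p-1). The deviation for
  no variables is (p-1)/p, and this initial factor p-1 lowers the exponent from e_p to e_p -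
  1.\<close>

primrec word_eval :: "('a, 'b) monoid_scheme \<Rightarrow> ('s \<Rightarrow> 'a) \<Rightarrow> 's word \<Rightarrow> 'a" where
  "word_eval G f [] = \<one>\<^bsub>G\<^esub>"
| "word_eval G f (l # w) =
     (if snd l then f (fst l) else inv\<^bsub>G\<^esub> (f (fst l))) \<otimes>\<^bsub>G\<^esub> word_eval G f w"

abbreviation pres_class :: "'s set \<Rightarrow> 's word set \<Rightarrow> 's word \<Rightarrow> 's word set" where
  "pres_class S R w \<equiv> pres_rel S R `` {w}"

abbreviation pres_gen :: "'s set \<Rightarrow> 's word set \<Rightarrow> 's \<Rightarrow> 's word set" where
  "pres_gen S R s \<equiv> pres_class S R [(s, True)]"

lemma words_Nil [simp]: "[] \<in> words S"
  and words_Cons [simp]: "l # w \<in> words S \<longleftrightarrow> fst l \<in> S \<and> w \<in> words S"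
  and words_append [simp]: "u @ v \<in> words S \<longleftrightarrow> u \<in> words S \<and> v \<in> words S"
  by (auto simp: words_def mem_Times_iff)

context group
begin

lemma word_eval_closed [simp]:
  "f \<in> S \<rightarrow> carrier G \<Longrightarrow> w \<in> words S \<Longrightarrow> word_eval G f w \<in> carrier G"
  by (induction w) auto

lemma word_eval_append:
  "f \<in> S \<rightarrow> carrier G \<Longrightarrow> u \<in> words S \<Longrightarrow> v \<in> words S \<Longrightarrow>
     word_eval G f (u @ v) = word_eval G f u \<otimes> word_eval G f v"
proof (induction u)
  case (Cons l u)
  then have "f (fst l) \<in> carrier G" by auto
  with Cons show ?case by (auto simp: m_assoc)
qed simp

lemma word_eval_replicate:
  "f s \<in> carrier G \<Longrightarrow> word_eval G f (replicate m (s, True)) = f s [^] m"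
proof (induction m)
  case (Suc m)
  then show ?case using nat_pow_Suc2[of "f s" m] by simp
qed simp

text \<open>Well-definedness half of von Dyck's theorem. It serves both to build homomorphisms out
  of the presentation and to detect nontrivial powers of x_i through a representation.\<close>

lemma word_eval_respects:
  assumes f: "f \<in> S \<rightarrow> carrier G"
    and R: "\<And>r. r \<in> R \<Longrightarrow> r \<in> words S \<Longrightarrow> word_eval G f r = \<one>"
    and eq: "pres_eq S R u v"
  shows "word_eval G f u = word_eval G f v"
  using eq
proof (induction rule: pres_eq.induct)
  case (append u v u' v')
  then show ?case
    using pres_eq_words[OF append(1)] pres_eq_words[OF append(2)] by (simp add: word_eval_append[OF f])
next
  case (cancel s e)
  then have "f s \<in> carrier G" using f by auto
  then show ?case by (cases e) auto
qed (use R in auto)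

lemma word_eval_subgroup:
  assumes "subgroup H G" and "\<And>l. l \<in> set w \<Longrightarrow> f (fst l) \<in> H"
  shows "word_eval G f w \<in> H"
  using assms(2)
proof (induction w)
  case (Cons l w)
  then have "f (fst l) \<in> H" "word_eval G f w \<in> H" by auto
  then show ?case
    by (simp add: subgroup.m_closed[OF assms(1)] subgroup.m_inv_closed[OF assms(1)])
qed (simp add: subgroup.one_closed[OF assms(1)])

end

lemma pres_class_eq_iff:
  "u \<in> words S \<Longrightarrow> v \<in> words S \<Longrightarrow> pres_class S R u = pres_class S R v \<longleftrightarrow> pres_eq S R u v"
  using eq_equiv_class_iff[OF equiv_pres_rel[of S R], of u v] by (simp add: pres_rel_def)

lemma pres_class_carrier [simp]: "w \<in> words S \<Longrightarrow> pres_class S R w \<in> carrier (presented_group S R)"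
  by (auto simp: presented_group_def quotient_def)

lemma presented_group_carrierE:
  assumes "U \<in> carrier (presented_group S R)"
  obtains w where "w \<in> words S" "U = pres_class S R w"
  using assms by (auto simp: presented_group_def quotient_def)

lemma presented_group_one: "\<one>\<^bsub>presented_group S R\<^esub> = pres_class S R []"
  by (simp add: presented_group_def)

lemma presented_group_inv_gen:
  assumes "s \<in> S"
  shows "inv\<^bsub>presented_group S R\<^esub> (pres_gen S R s) = pres_class S R [(s, False)]"
proof (rule group.inv_equality[OF group_presented_group])
  have "pres_eq S R [(s, False), (s, \<not> False)] []" by (rule pres_eq.cancel[OF assms])
  then show "pres_class S R [(s, False)] \<otimes>\<^bsub>presented_group S R\<^esub> pres_gen S R s
      = \<one>\<^bsub>presented_group S R\<^esub>"
    using assms by (simp add: presented_group_mult_class presented_group_one pres_class_eq_iff)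
qed (use assms in auto)

lemma word_eval_pres_gen:
  "w \<in> words S \<Longrightarrow> word_eval (presented_group S R) (pres_gen S R) w = pres_class S R w"
proof (induction w)
  case (Cons l w)
  then have "(if snd l then pres_gen S R (fst l) else inv\<^bsub>presented_group S R\<^esub> (pres_gen S R (fst l)))
      = pres_class S R [l]"
    by (cases l) (auto simp: presented_group_inv_gen)
  with Cons show ?case
    using presented_group_mult_class[of "[l]" S w R] by simp
qed (simp add: presented_group_one)

lemma word_eval_hom:
  assumes "group G" "group H" "h \<in> hom G H" "f \<in> S \<rightarrow> carrier G" "w \<in> words S"
  shows "h (word_eval G f w) = word_eval H (\<lambda>s. h (f s)) w"
proof -
  interpret group_hom G H h using assms(1-3) by (simp add: group_hom_def group_hom_axioms_def)
  show ?thesis using assms(5)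
  proof (induction w)
    case (Cons l w)
    then have "f (fst l) \<in> carrier G" using assms(4) by auto
    with Cons show ?case using assms(4) by auto
  qed simp
qed

lemma hom_pres_class:
  assumes "group H" "h \<in> hom (presented_group S R) H" "w \<in> words S"
  shows "h (pres_class S R w) = word_eval H (\<lambda>s. h (pres_gen S R s)) w"
  using word_eval_hom[OF group_presented_group assms(1,2) _ assms(3), of "pres_gen S R"]
    word_eval_pres_gen[OF assms(3)] by simp

lemma long_relator_words: "long_relator g ns \<in> words (fuchsian_gens g ns)"
  by (auto simp: long_relator_def words_def fuchsian_gens_def)

lemma power_relator_words:
  "i < length ns \<Longrightarrow> replicate m (GenX i, True) \<in> words (fuchsian_gens g ns)"
  by (auto simp: words_def fuchsian_gens_def)

lemma fuchsian_gens_simps [simp]: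
  "GenA j \<in> fuchsian_gens g ns \<longleftrightarrow> j < g" "GenB j \<in> fuchsian_gens g ns \<longleftrightarrow> j < g"
  "GenX i \<in> fuchsian_gens g ns \<longleftrightarrow> i < length ns"
  by (auto simp: fuchsian_gens_def)

section \<open>Tate cohomology of a finite cyclic group\<close>

abbreviation supp :: "('a \<Rightarrow>\<^sub>0 int) \<Rightarrow> 'a set" where
  "supp \<equiv> Poly_Mapping.keys"

abbreviation coef :: "('a \<Rightarrow>\<^sub>0 int) \<Rightarrow> 'a \<Rightarrow> int" where
  "coef \<equiv> Poly_Mapping.lookup"

definition frag_act :: "('a \<Rightarrow> 'b) \<Rightarrow> ('a \<Rightarrow>\<^sub>0 int) \<Rightarrow> ('b \<Rightarrow>\<^sub>0 int)" where
  "frag_act f = frag_extend (\<lambda>x. frag_of (f x))"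

lemma frag_act_simps [simp]:
  "frag_act f 0 = 0" "frag_act f (frag_of x) = frag_of (f x)"
  "frag_act f (c + d) = frag_act f c + frag_act f d"
  "frag_act f (c - d) = frag_act f c - frag_act f d"
  by (simp_all add: frag_act_def frag_extend_add frag_extend_diff)

lemma frag_act_sum: "finite I \<Longrightarrow> frag_act f (\<Sum>i\<in>I. c i) = (\<Sum>i\<in>I. frag_act f (c i))"
  by (simp add: frag_act_def frag_extend_sum)

lemma frag_act_comp: "frag_act f (frag_act g c) = frag_act (\<lambda>x. f (g x)) c"
  using frag_extend_compose[of "\<lambda>x. frag_of (f x)" g c] by (simp add: frag_act_def comp_def)

lemma frag_act_eq_id: "(\<And>x. x \<in> supp c \<Longrightarrow> f x = x) \<Longrightarrow> frag_act f c = c"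
  unfolding frag_act_def by (rule HOL.trans[OF frag_extend_eq frag_expansion[symmetric]]) simp

lemma keys_frag_act: "supp (frag_act f c) \<subseteq> f ` supp c"
  unfolding frag_act_def by (rule order_trans[OF keys_frag_extend]) auto

definition frag_restrict :: "'a set \<Rightarrow> ('a \<Rightarrow>\<^sub>0 int) \<Rightarrow> ('a \<Rightarrow>\<^sub>0 int)" where
  "frag_restrict T = frag_extend (\<lambda>x. if x \<in> T then frag_of x else 0)"

lemma frag_restrict_simps [simp]:
  "frag_restrict T 0 = 0" "frag_restrict T (frag_of x) = (if x \<in> T then frag_of x else 0)"
  "frag_restrict T (c - d) = frag_restrict T c - frag_restrict T d"
  by (simp_all add: frag_restrict_def frag_extend_diff)

lemma frag_restrict_sum:
  "finite I \<Longrightarrow> frag_restrict T (\<Sum>i\<in>I. c i) = (\<Sum>i\<in>I. frag_restrict T (c i))"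
  by (simp add: frag_restrict_def frag_extend_sum)

lemma keys_frag_restrict: "supp (frag_restrict T c) \<subseteq> supp c"
  unfolding frag_restrict_def by (rule order_trans[OF keys_frag_extend]) (auto split: if_splits)

lemma keys_sum_subset:
  "(\<And>i. i \<in> I \<Longrightarrow> supp (c i) \<subseteq> X) \<Longrightarrow> supp (\<Sum>i\<in>I. c i) \<subseteq> X"
  by (rule order_trans[OF Poly_Mapping.keys_sum]) auto

definition norm_act :: "nat \<Rightarrow> ('a \<Rightarrow> 'a) \<Rightarrow> ('a \<Rightarrow>\<^sub>0 int) \<Rightarrow> ('a \<Rightarrow>\<^sub>0 int)" where
  "norm_act m a c = (\<Sum>j<m. frag_act (a ^^ j) c)"

text \<open>A free module over the group ring of a cyclic group of order m, given by a basis X and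
  the permutation a by which a generator acts. The chains supported in X are the module, so the
  group ring itself never appears. The laws of a hold on X only, hence the support conditions
  below.\<close>

locale free_cyclic_action =
  fixes X :: "'a set" and a :: "'a \<Rightarrow> 'a" and m :: nat
  assumes m_pos: "0 < m"
    and closed: "x \<in> X \<Longrightarrow> a x \<in> X"
    and period: "x \<in> X \<Longrightarrow> (a ^^ m) x = x"
    and free: "x \<in> X \<Longrightarrow> 0 < j \<Longrightarrow> j < m \<Longrightarrow> (a ^^ j) x \<noteq> x"
begin

lemma funpow_closed: "x \<in> X \<Longrightarrow> (a ^^ j) x \<in> X"
  by (induction j) (auto intro: closed)

lemma funpow_comp: "(a ^^ i) ((a ^^ j) x) = (a ^^ (i + j)) x"
  by (simp add: funpow_add)

lemma funpow_mult_period: "x \<in> X \<Longrightarrow> (a ^^ (m * i)) x = x"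
  by (induction i) (auto simp: funpow_add period)

lemma funpow_mod:
  assumes "x \<in> X"
  shows "(a ^^ (j mod m)) x = (a ^^ j) x"
proof -
  have "(a ^^ (j mod m)) x = (a ^^ (j mod m)) ((a ^^ (m * (j div m))) x)"
    by (simp only: funpow_mult_period[OF assms])
  also have "\<dots> = (a ^^ j) x" by (simp only: funpow_comp mod_mult_div_eq)
  finally show ?thesis .
qed

lemma transversal: "\<exists>T. \<forall>x\<in>X. \<exists>!j. j < m \<and> (a ^^ j) x \<in> T"
proof -
  define orb where "orb x = {(a ^^ j) x | j. True}" for x
  define T where "T = {SOME y. y \<in> orb x | x. x \<in> X}"
  have orb_eq: "orb ((a ^^ j) x) = orb x" if x: "x \<in> X" for x j
  proof
    show "orb ((a ^^ j) x) \<subseteq> orb x"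
      unfolding orb_def funpow_comp by blast
    have "(a ^^ i) x \<in> orb ((a ^^ j) x)" for i
    proof -
      \<comment> \<open>Orbits are formed with nonnegative powers; \<open>m * j - j\<close> plays
        the role of the exponent \<open>-j\<close>, because the power \<open>m * j\<close> acts
        trivially.\<close>
      have "j \<le> m * j" using m_pos by (cases m) auto
      then have "i + (m * j - j) + j = i + m * j" by (simp only: add.assoc le_add_diff_inverse2)
      then have "(a ^^ (i + (m * j - j))) ((a ^^ j) x) = (a ^^ (i + m * j)) x"
        unfolding funpow_comp by (rule arg_cong[where f = "\<lambda>l. (a ^^ l) x"])
      also have "\<dots> = (a ^^ i) x" using x by (simp add: funpow_add funpow_mult_period)
      finally have "(a ^^ i) x = (a ^^ (i + (m * j - j))) ((a ^^ j) x)" ..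
      then show ?thesis unfolding orb_def by blast
    qed
    then show "orb x \<subseteq> orb ((a ^^ j) x)" unfolding orb_def by blast
  qed
  have self: "x \<in> orb x" for x
  proof -
    have "x = (a ^^ 0) x" by simp
    then show ?thesis unfolding orb_def by blast
  qed
  have orbE: "\<exists>j. y = (a ^^ j) x" if "y \<in> orb x" for x y
    using that unfolding orb_def by blast
  have some: "(SOME y. y \<in> orb x) \<in> orb x" for x using self by (rule someI)
  have "\<exists>!j. j < m \<and> (a ^^ j) x \<in> T" if x: "x \<in> X" for x
  proof -
    from orbE[OF some] obtain j where j: "(a ^^ j) x = (SOME y. y \<in> orb x)" by metis
    have "(a ^^ (j mod m)) x \<in> T" unfolding funpow_mod[OF x] j using x by (auto simp: T_def)
    moreover have uniq: "i = i'" if i: "i < m" "(a ^^ i) x \<in> T" and i': "i' < m" "(a ^^ i') x \<in> T" for i i'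
    proof -
      have rep: "(a ^^ i) x = (SOME y. y \<in> orb x)" if "(a ^^ i) x \<in> T" for i
      proof -
        from that obtain y where y: "y \<in> X" "(a ^^ i) x = (SOME z. z \<in> orb y)"
          unfolding T_def by auto
        from orbE[OF some] y obtain l where "(a ^^ i) x = (a ^^ l) y" by metis
        then have "orb x = orb y" using orb_eq[OF x, of i] orb_eq[OF y(1), of l] by simp
        then show ?thesis using y by simp
      qed
      have eq: "(a ^^ i) x = (a ^^ i') x" by (simp only: rep[OF i(2)] rep[OF i'(2)])
      have False if "p < q" "q < m" "(a ^^ p) x = (a ^^ q) x" for p q
      proof -
        have "(a ^^ (q - p)) ((a ^^ p) x) = (a ^^ p) x"
          unfolding funpow_comp using that by simp
        then show False using free[OF funpow_closed[OF x, of p], of "q - p"] that(1,2) by simp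
      qed
      from this[of i i'] this[of i' i] show ?thesis
        using eq i(1) i'(1) by (cases i i' rule: linorder_cases) simp_all
    qed
    ultimately show ?thesis
      using m_pos by (intro ex1I[of _ "j mod m"]) (simp, rule uniq, simp_all)
  qed
  then show ?thesis by (intro exI ballI)
qed

lemma frag_act_period: "supp c \<subseteq> X \<Longrightarrow> frag_act (a ^^ m) c = c"
  by (rule frag_act_eq_id) (auto intro: period)

lemma keys_frag_act_subset:
  "supp c \<subseteq> X \<Longrightarrow> supp (frag_act (a ^^ j) c) \<subseteq> X"
  by (rule order_trans[OF keys_frag_act]) (auto intro: funpow_closed)

text \<open>T is a transversal and \<open>m - j\<close> stands for \<open>-j\<close>: each basis
  element enters T at exactly one time j, and projecting at that time and moving back recovers it.
  Thus the identity is the norm of a projection, which is what makes the Tate cohomology of a free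
  module vanish.\<close>

lemma averaging:
  "\<exists>T. \<forall>c. supp c \<subseteq> X \<longrightarrow>
    (\<Sum>j<m. frag_act (a ^^ (m - j)) (frag_restrict T (frag_act (a ^^ j) c))) = c"
proof -
  obtain T where T: "\<forall>x\<in>X. \<exists>!j. j < m \<and> (a ^^ j) x \<in> T" using transversal ..
  have "(\<Sum>j<m. frag_act (a ^^ (m - j)) (frag_restrict T (frag_act (a ^^ j) c))) = c"
    if "supp c \<subseteq> X" for c
    using that
  proof (induction c rule: frag_induction)
    case (one x)
    from bspec[OF T one] obtain j where j: "j < m" "(a ^^ j) x \<in> T"
      and uniq: "\<forall>i. i < m \<and> (a ^^ i) x \<in> T \<longrightarrow> i = j"
      unfolding Ex1_def by (elim exE conjE) (rule that)
    have "(\<Sum>i<m. frag_act (a ^^ (m - i)) (frag_restrict T (frag_act (a ^^ i) (frag_of x)))) =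
      (\<Sum>i<m. if i = j then frag_act (a ^^ (m - j)) (frag_of ((a ^^ j) x)) else 0)"
    proof (rule sum.cong)
      fix i assume "i \<in> {..<m}"
      then have "i \<noteq> j \<Longrightarrow> (a ^^ i) x \<notin> T" using uniq by blast
      then show "frag_act (a ^^ (m - i)) (frag_restrict T (frag_act (a ^^ i) (frag_of x))) =
          (if i = j then frag_act (a ^^ (m - j)) (frag_of ((a ^^ j) x)) else 0)"
        using j(2) by (cases "i = j") simp_all
    qed simp
    also have "\<dots> = frag_of ((a ^^ (m - j)) ((a ^^ j) x))" using j by simp
    also have "(a ^^ (m - j)) ((a ^^ j) x) = x"
      using period[OF one] j by (simp add: funpow_comp)
    finally show ?case .
  next
    case (diff c d)
    then show ?case by (simp add: sum_subtractf)
  qed simp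
  then show ?thesis by blast
qed

text \<open>Vanishing in degree 0: for an invariant c the averaging identity exhibits c as the norm
  of its restriction to T.\<close>

lemma invariant_imp_norm:
  assumes c: "supp c \<subseteq> X" and inv: "frag_act a c = c"
  obtains d where "supp d \<subseteq> X" "c = norm_act m a d"
proof -
  obtain T where T: "\<forall>c. supp c \<subseteq> X \<longrightarrow>
      (\<Sum>j<m. frag_act (a ^^ (m - j)) (frag_restrict T (frag_act (a ^^ j) c))) = c"
    using averaging ..
  have keysE: "supp (frag_restrict T c) \<subseteq> X" by (rule order_trans[OF keys_frag_restrict c])
  have inv': "frag_act (a ^^ j) c = c" for j
  proof (induction j)
    case (Suc j)
    then show ?case using frag_act_comp[of a "a ^^ j" c] inv by simp
  qed (simp add: frag_act_eq_id)
  have "c = (\<Sum>j<m. frag_act (a ^^ (m - j)) (frag_restrict T c))" using T[rule_format, OF c] by (simp add: inv')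
  also have "\<dots> = (\<Sum>j<m. frag_act (a ^^ Suc j) (frag_restrict T c))"
    by (subst sum.nat_diff_reindex[symmetric]) (simp add: Suc_diff_Suc del: funpow.simps)
  also have "\<dots> = (\<Sum>j<m. frag_act (a ^^ j) (frag_restrict T c))"
    using sum.lessThan_Suc_shift[of "\<lambda>j. frag_act (a ^^ j) (frag_restrict T c)" m]
      frag_act_period[OF keysE] by (simp add: frag_act_eq_id)
  finally show ?thesis using that keysE by (simp add: norm_act_def)
qed

text \<open>Vanishing in degree -1: in the averaging identity each summand differs from its
  untranslated part \<open>y j\<close> by a telescoping coboundary, and the \<open>y j\<close> add
  up to the restriction of the norm of c, which is 0.\<close>

lemma norm_zero_imp_coboundary:
  assumes c: "supp c \<subseteq> X" and zero: "norm_act m a c = 0"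
  obtains d where "supp d \<subseteq> X" "c = frag_act a d - d"
proof -
  obtain T where T: "\<forall>c. supp c \<subseteq> X \<longrightarrow>
      (\<Sum>j<m. frag_act (a ^^ (m - j)) (frag_restrict T (frag_act (a ^^ j) c))) = c"
    using averaging ..
  define y where "y j = frag_restrict T (frag_act (a ^^ j) c)" for j
  define d where "d = (\<Sum>j<m. \<Sum>i<m - j. frag_act (a ^^ i) (y j))"
  have ky: "supp (y j) \<subseteq> X" for j
    unfolding y_def by (rule order_trans[OF keys_frag_restrict keys_frag_act_subset[OF c]])
  have tele: "frag_act a (\<Sum>i<k. frag_act (a ^^ i) z) - (\<Sum>i<k. frag_act (a ^^ i) z)
      = frag_act (a ^^ k) z - z" for k :: nat and z
  proof (induction k)
    case (Suc k)
    then show ?case using frag_act_comp[of a "a ^^ k" z] by (simp add: algebra_simps)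
  qed (simp add: frag_act_eq_id)
  have "frag_act a d - d = (\<Sum>j<m. frag_act (a ^^ (m - j)) (y j) - y j)"
    unfolding d_def
    by (subst frag_act_sum, simp, subst sum_subtractf[symmetric], simp only: tele)
  also have "\<dots> = c - (\<Sum>j<m. y j)" using T[rule_format, OF c] by (simp add: y_def sum_subtractf)
  also have "(\<Sum>j<m. y j) = 0" using zero by (simp add: y_def norm_act_def flip: frag_restrict_sum)
  finally have "c = frag_act a d - d" by simp
  moreover have "supp d \<subseteq> X"
    unfolding d_def by (intro keys_sum_subset keys_frag_act_subset ky)
  ultimately show ?thesis using that by blast
qed

lemma norm_act_diff: "norm_act m a (c - d) = norm_act m a c - norm_act m a d"
  by (simp add: norm_act_def sum_subtractf)

lemma norm_act_difference_zero:
  assumes "supp c \<subseteq> X"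
  shows "norm_act m a (frag_act a c - c) = 0" and "frag_act a (norm_act m a c) = norm_act m a c"
proof -
  have eq: "(\<Sum>j<m. frag_act (a ^^ Suc j) c) = (\<Sum>j<m. frag_act (a ^^ j) c)"
    using sum.lessThan_Suc_shift[of "\<lambda>j. frag_act (a ^^ j) c" m]
      frag_act_period[OF assms] by (simp add: frag_act_eq_id)
  have "frag_act (a ^^ j) (frag_act a c) = frag_act (a ^^ Suc j) c" for j
    by (simp add: frag_act_comp funpow_swap1 comp_def)
  with eq show "norm_act m a (frag_act a c - c) = 0" by (simp add: norm_act_def sum_subtractf)
  have "frag_act a (frag_act (a ^^ j) c) = frag_act (a ^^ Suc j) c" for j
    by (simp add: frag_act_comp comp_def)
  with eq show "frag_act a (norm_act m a c) = norm_act m a c"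
    by (simp add: norm_act_def frag_act_sum)
qed

end

lemma frag_extend_equivariant:
  assumes "supp c \<subseteq> X" and "\<And>x. x \<in> X \<Longrightarrow> b (a x) = frag_act a' (b x)"
  shows "frag_extend b (frag_act a c) = frag_act a' (frag_extend b c)"
  using assms(1)
  by (induction c rule: frag_induction) (auto simp: frag_extend_diff assms(2))

lemma frag_extend_norm_act:
  assumes "supp c \<subseteq> X" and eq: "\<And>x. x \<in> X \<Longrightarrow> b (a x) = frag_act a' (b x)"
    and closed: "\<And>x. x \<in> X \<Longrightarrow> a x \<in> X"
  shows "frag_extend b (norm_act m a c) = norm_act m a' (frag_extend b c)"
proof -
  have "(a ^^ j) x \<in> X \<and> b ((a ^^ j) x) = frag_act (a' ^^ j) (b x)" if "x \<in> X" for x j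
  proof (induction j)
    case (Suc j)
    then show ?case using eq closed frag_act_comp[of a' "a' ^^ j" "b x"] by simp
  qed (use that in \<open>simp add: frag_act_eq_id\<close>)
  then show ?thesis
    unfolding norm_act_def using assms(1)
    by (simp add: frag_extend_sum comp_def frag_extend_equivariant[of c X])
qed

text \<open>Push-forward to a point, whose single coefficient is the sum of all coefficients;
  additivity and invariance under \<open>frag_act\<close> then come from general facts.\<close>

definition augmentation :: "('a \<Rightarrow>\<^sub>0 int) \<Rightarrow> int" where
  "augmentation c = coef (frag_act (\<lambda>_. ()) c) ()"

lemma augmentation_simps [simp]:
  "augmentation (frag_of x) = 1" "augmentation (c - d) = augmentation c - augmentation d"
  "augmentation 0 = 0" "augmentation (frag_act f c) = augmentation c"
  by (simp_all add: augmentation_def lookup_minus frag_act_comp)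

lemma augmentation_norm_act: "augmentation (norm_act m a c) = int m * augmentation c"
proof -
  have "augmentation (\<Sum>j<m. frag_act (a ^^ j) c) = int m * augmentation c"
    by (induction m) (auto simp: augmentation_def lookup_add frag_act_comp algebra_simps)
  then show ?thesis by (simp add: norm_act_def)
qed

text \<open>The Tate cohomology of the cyclic group vanishes on each free module of the resolution
  \<open>0 \<rightarrow> \<int>F \<rightarrow> \<int>E \<rightarrow> \<int>V \<rightarrow> \<int> \<rightarrow> 0\<close>, hence on \<open>\<int>\<close>, where it is \<open>\<int>/m\<close> in even degrees.\<close>

lemma free_cyclic_action_trivial:
  assumes V: "free_cyclic_action V av m" and E: "free_cyclic_action E ae m"
    and F: "free_cyclic_action F af m"
    and b1: "\<And>e. e \<in> E \<Longrightarrow> supp (b1 e) \<subseteq> V"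
      "\<And>e. e \<in> E \<Longrightarrow> b1 (ae e) = frag_act av (b1 e)"
      "\<And>e. e \<in> E \<Longrightarrow> augmentation (b1 e) = 0"
    and b2: "\<And>f. f \<in> F \<Longrightarrow> supp (b2 f) \<subseteq> E"
      "\<And>f. f \<in> F \<Longrightarrow> b2 (af f) = frag_act ae (b2 f)"
      "\<And>f. f \<in> F \<Longrightarrow> frag_extend b1 (b2 f) = 0"
    and conn: "v \<in> V" "supp u \<subseteq> E" "frag_extend b1 u = frag_of (av v) - frag_of v"
    and exact: "\<And>c. supp c \<subseteq> E \<Longrightarrow> frag_extend b1 c = 0 \<Longrightarrow>
      \<exists>d. supp d \<subseteq> F \<and> c = frag_extend b2 d"
    and inj: "\<And>c. supp c \<subseteq> F \<Longrightarrow> frag_extend b2 c = 0 \<Longrightarrow> c = 0"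
  shows "m = 1"
proof -
  interpret V: free_cyclic_action V av m by fact
  interpret E: free_cyclic_action E ae m by fact
  interpret F: free_cyclic_action F af m by fact
  have keys1: "supp (frag_extend b1 c) \<subseteq> V" if "supp c \<subseteq> E" for c
    using keys_frag_extend[of b1 c] b1(1) that by fastforce
  have keys2: "supp (frag_extend b2 c) \<subseteq> E" if "supp c \<subseteq> F" for c
    using keys_frag_extend[of b2 c] b2(1) that by fastforce
  have bb: "frag_extend b1 (frag_extend b2 c) = 0" if "supp c \<subseteq> F" for c
    using that by (induction c rule: frag_induction) (auto simp: frag_extend_diff b2(3))
  have aug: "augmentation (frag_extend b1 c) = 0" if "supp c \<subseteq> E" for c
    using that by (induction c rule: frag_induction) (auto simp: frag_extend_diff b1(3))
  note eq1 = frag_extend_equivariant[where X = E and b = b1, OF _ b1(2)]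
  note eq2 = frag_extend_equivariant[where X = F and b = b2, OF _ b2(2)]
  note norm1 = frag_extend_norm_act[where X = E and b = b1, OF _ b1(2) E.closed]
  note norm2 = frag_extend_norm_act[where X = F and b = b2, OF _ b2(2) F.closed]
  have keysv: "supp (frag_of v) \<subseteq> V" using conn(1) by simp
  \<comment> \<open>Chase through the resolution. The chain u joins v to its translate, so its norm
    runs once around the orbit, closes up and bounds some w.\<close>
  have "frag_extend b1 (norm_act m ae u) = norm_act m av (frag_act av (frag_of v) - frag_of v)"
    by (simp add: norm1[OF conn(2)] conn(3))
  also have "\<dots> = 0" by (rule V.norm_act_difference_zero(1)[OF keysv])
  finally obtain w where w: "supp w \<subseteq> F" "norm_act m ae u = frag_extend b2 w"
    using exact[of "norm_act m ae u"] keys_sum_subset[of _ "\<lambda>j. frag_act (ae ^^ j) u" E]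
      E.keys_frag_act_subset[OF conn(2)] by (auto simp: norm_act_def)
  \<comment> \<open>The boundary of w is a norm and hence invariant; injectivity passes the
    invariance on to w, which is therefore itself the norm of some y.\<close>
  have "frag_extend b2 (frag_act af w - w) = 0"
    using E.norm_act_difference_zero(2)[OF conn(2)]
    by (simp add: frag_extend_diff eq2[OF w(1)] flip: w(2))
  moreover have "supp (frag_act af w - w) \<subseteq> F"
    by (rule order_trans[OF keys_diff Un_least[OF F.keys_frag_act_subset[OF w(1), of 1, simplified] w(1)]])
  ultimately have "frag_act af w - w = 0" by (intro inj)
  then have "frag_act af w = w" by simp
  then obtain y where y: "supp y \<subseteq> F" "w = norm_act m af y"
    using F.invariant_imp_norm[OF w(1)] by blast
  \<comment> \<open>Subtracting the boundary of y leaves the endpoints of u alone and kills its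
    norm, so the corrected chain is a coboundary, say of s.\<close>
  have "norm_act m ae (u - frag_extend b2 y) = 0"
    by (simp add: E.norm_act_diff w(2) y(2) norm2[OF y(1)])
  moreover have "supp (u - frag_extend b2 y) \<subseteq> E"
    using keys_diff[of u "frag_extend b2 y"] conn(2) keys2[OF y(1)] by blast
  ultimately obtain s where s: "supp s \<subseteq> E" "u - frag_extend b2 y = frag_act ae s - s"
    using E.norm_zero_imp_coboundary by blast
  have "frag_of (av v) - frag_of v = frag_extend b1 (u - frag_extend b2 y)"
    by (simp add: frag_extend_diff bb[OF y(1)] conn(3))
  also have "\<dots> = frag_act av (frag_extend b1 s) - frag_extend b1 s"
    by (simp add: s(2) frag_extend_diff eq1[OF s(1)])
  \<comment> \<open>Now v minus the boundary of s is an invariant 0-chain of augmentation 1, whereas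
    invariants are norms and have augmentation divisible by m.\<close>
  finally have "frag_of (av v) - frag_act av (frag_extend b1 s) = frag_of v - frag_extend b1 s"
    by (simp add: diff_eq_eq group_cancel.add1 group_cancel.sub1)
  then have "frag_act av (frag_of v - frag_extend b1 s) = frag_of v - frag_extend b1 s" by simp
  moreover have "supp (frag_of v - frag_extend b1 s) \<subseteq> V"
    using keys_diff[of "frag_of v" "frag_extend b1 s"] keysv keys1[OF s(1)] by blast
  ultimately obtain z where "frag_of v - frag_extend b1 s = norm_act m av z"
    using V.invariant_imp_norm by blast
  then have "augmentation (frag_of v - frag_extend b1 s) = int m * augmentation z"
    by (simp add: augmentation_norm_act)
  then have "int m * augmentation z = 1" by (simp add: aug[OF s(1)])
  then show ?thesis by (simp add: zmult_eq_1_iff)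
qed

section \<open>Cayley complexes\<close>

text \<open>The 1-chain traced by a word from the vertex \<gamma>; its coefficients are translated
  Fox derivatives. The edge \<open>(\<gamma>, s)\<close> starts at \<gamma> and ends at \<gamma>
  times the generator s, so an inverse letter runs backwards along the edge based at its own end
  point.\<close>

primrec word_path :: "('a, 'b) monoid_scheme \<Rightarrow> ('s \<Rightarrow> 'a) \<Rightarrow> 'a \<Rightarrow> 's word \<Rightarrow> ('a \<times> 's \<Rightarrow>\<^sub>0 int)" where
  "word_path G f \<gamma> [] = 0"
| "word_path G f \<gamma> (l # w) =
     (if snd l then frag_of (\<gamma>, fst l) + word_path G f (\<gamma> \<otimes>\<^bsub>G\<^esub> f (fst l)) w
      else word_path G f (\<gamma> \<otimes>\<^bsub>G\<^esub> inv\<^bsub>G\<^esub> (f (fst l))) w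
        - frag_of (\<gamma> \<otimes>\<^bsub>G\<^esub> inv\<^bsub>G\<^esub> (f (fst l)), fst l))"

definition edge_bdry :: "('a, 'b) monoid_scheme \<Rightarrow> ('s \<Rightarrow> 'a) \<Rightarrow> 'a \<times> 's \<Rightarrow> ('a \<Rightarrow>\<^sub>0 int)" where
  "edge_bdry G f = (\<lambda>(\<gamma>, s). frag_of (\<gamma> \<otimes>\<^bsub>G\<^esub> f s) - frag_of \<gamma>)"

context group
begin

lemma inv_cancel_left [simp]:
  "x \<in> carrier G \<Longrightarrow> y \<in> carrier G \<Longrightarrow> inv x \<otimes> (x \<otimes> y) = y"
  "x \<in> carrier G \<Longrightarrow> y \<in> carrier G \<Longrightarrow> x \<otimes> (inv x \<otimes> y) = y"
  by (simp_all flip: m_assoc)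

lemma keys_word_path:
  assumes f: "f \<in> S \<rightarrow> carrier G"
  shows "\<gamma> \<in> carrier G \<Longrightarrow> w \<in> words S \<Longrightarrow>
    supp (word_path G f \<gamma> w) \<subseteq> carrier G \<times> fst ` set w"
proof (induction w arbitrary: \<gamma>)
  case (Cons l w)
  then have l: "f (fst l) \<in> carrier G" using f by auto
  have sub: "supp c \<subseteq> carrier G \<times> fst ` set w \<Longrightarrow> e \<in> carrier G \<times> {fst l} \<Longrightarrow>
      supp (frag_of e + c) \<subseteq> carrier G \<times> fst ` set (l # w) \<and>
      supp (c - frag_of e) \<subseteq> carrier G \<times> fst ` set (l # w)" for c e
    using Poly_Mapping.keys_add[of "frag_of e" c] keys_diff[of c "frag_of e"] by auto
  show ?case
    using sub[OF Cons.IH[of "\<gamma> \<otimes> f (fst l)"], of "(\<gamma>, fst l)"]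
      sub[OF Cons.IH[of "\<gamma> \<otimes> inv (f (fst l))"], of "(\<gamma> \<otimes> inv (f (fst l)), fst l)"] Cons.prems l
    by simp
qed simp

lemma word_path_append:
  assumes f: "f \<in> S \<rightarrow> carrier G"
  shows "\<gamma> \<in> carrier G \<Longrightarrow> u \<in> words S \<Longrightarrow>
    word_path G f \<gamma> (u @ v) = word_path G f \<gamma> u + word_path G f (\<gamma> \<otimes> word_eval G f u) v"
proof (induction u arbitrary: \<gamma>)
  case (Cons l u)
  then have "f (fst l) \<in> carrier G" "word_eval G f u \<in> carrier G" using f by auto
  with Cons show ?case by (simp add: m_assoc)
qed simp

lemma edge_bdry_word_path:
  assumes f: "f \<in> S \<rightarrow> carrier G"
  shows "\<gamma> \<in> carrier G \<Longrightarrow> w \<in> words S \<Longrightarrow>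
    frag_extend (edge_bdry G f) (word_path G f \<gamma> w) = frag_of (\<gamma> \<otimes> word_eval G f w) - frag_of \<gamma>"
proof (induction w arbitrary: \<gamma>)
  case (Cons l w)
  then have "f (fst l) \<in> carrier G" "word_eval G f w \<in> carrier G" using f by auto
  with Cons show ?case
    by (simp add: m_assoc edge_bdry_def frag_extend_add frag_extend_diff)
qed simp

lemma word_path_translate:
  assumes f: "f \<in> S \<rightarrow> carrier G" and t: "t \<in> carrier G"
  shows "\<gamma> \<in> carrier G \<Longrightarrow> w \<in> words S \<Longrightarrow>
    frag_act (map_prod ((\<otimes>) t) id) (word_path G f \<gamma> w) = word_path G f (t \<otimes> \<gamma>) w"
proof (induction w arbitrary: \<gamma>)
  case (Cons l w)
  then have "f (fst l) \<in> carrier G" using f by auto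
  with Cons t show ?case by (simp add: m_assoc)
qed simp

lemma word_path_replicate:
  "\<gamma> \<in> carrier G \<Longrightarrow> f s \<in> carrier G \<Longrightarrow>
    word_path G f \<gamma> (replicate n (s, True)) = (\<Sum>m<n. frag_of (\<gamma> \<otimes> f s [^] m, s))"
proof (induction n arbitrary: \<gamma>)
  case (Suc n)
  then have "word_path G f \<gamma> (replicate (Suc n) (s, True)) =
      frag_of (\<gamma>, s) + (\<Sum>m<n. frag_of (\<gamma> \<otimes> f s \<otimes> f s [^] m, s))" by simp
  also have "\<dots> = frag_of (\<gamma> \<otimes> f s [^] (0::nat), s) + (\<Sum>m<n. frag_of (\<gamma> \<otimes> f s [^] Suc m, s))"
    using Suc.prems nat_pow_Suc2[of "f s"] by (simp add: m_assoc del: nat_pow_Suc)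
  also have "\<dots> = (\<Sum>m<Suc n. frag_of (\<gamma> \<otimes> f s [^] m, s))"
    by (rule sum.lessThan_Suc_shift[symmetric])
  finally show ?case .
qed simp

text \<open>This expresses the simple connectedness of the Cayley complex.\<close>

lemma word_path_diff_bounds:
  assumes f: "f \<in> S \<rightarrow> carrier G"
    and R: "\<And>r. r \<in> R \<Longrightarrow> r \<in> words S \<Longrightarrow> word_eval G f r = \<one>"
    and B: "0 \<in> B" "\<And>c d. c \<in> B \<Longrightarrow> d \<in> B \<Longrightarrow> c - d \<in> B"
    and BR: "\<And>r \<gamma>. r \<in> R \<Longrightarrow> r \<in> words S \<Longrightarrow> \<gamma> \<in> carrier G \<Longrightarrow> word_path G f \<gamma> r \<in> B"
    and eq: "pres_eq S R u v" and \<gamma>: "\<gamma> \<in> carrier G"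
  shows "word_path G f \<gamma> u - word_path G f \<gamma> v \<in> B"
proof -
  have Badd: "c + d \<in> B" if "c \<in> B" "d \<in> B" for c d
    using B(2)[OF that(1) B(2)[OF B(1) that(2)]] by simp
  from eq \<gamma> show ?thesis
  proof (induction arbitrary: \<gamma> rule: pres_eq.induct)
    case (refl u)
    then show ?case using B by simp
  next
    case (sym u v)
    then show ?case using B(2)[OF B(1) sym.IH[OF sym.prems]] by simp
  next
    case (trans u v w)
    then show ?case using Badd[OF trans.IH(1)[OF trans.prems] trans.IH(2)[OF trans.prems]] by simp
  next
    case (append u v u' v')
    have w: "u \<in> words S" "v \<in> words S" "u' \<in> words S" "v' \<in> words S"
      using append.hyps pres_eq_words by blast+
    \<comment> \<open>Hence both tails start at the same vertex, where the second induction
      hypothesis applies.\<close>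
    have "word_eval G f u = word_eval G f v" by (rule word_eval_respects[OF f R append.hyps(1)])
    then have "word_path G f \<gamma> (u @ u') - word_path G f \<gamma> (v @ v') =
        (word_path G f \<gamma> u - word_path G f \<gamma> v) +
        (word_path G f (\<gamma> \<otimes> word_eval G f u) u' - word_path G f (\<gamma> \<otimes> word_eval G f u) v')"
      using w append.prems by (simp add: word_path_append[OF f])
    then show ?case
      using Badd append.IH(1)[OF append.prems] append.IH(2)[of "\<gamma> \<otimes> word_eval G f u"] append.prems
        word_eval_closed[OF f w(1)] by simp
  next
    case (cancel s e)
    then have "f s \<in> carrier G" using f by auto
    then show ?case using cancel B(1) by (cases e) (simp_all add: m_assoc)
  next
    case (relator r)
    then show ?case using BR by simp
  qed
qed

text \<open>Fix a word leading to each vertex and let T be its path. For an edge e, the chain e -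
  T(boundary of e) is the difference of the paths of two words with equal value, so it lies in B. By
  linearity z - T(boundary of z) lies in B, and the boundary of z is 0. B stands for any group of
  chains that contains the boundaries of the relators.\<close>

lemma cycle_bounds:
  assumes f: "f \<in> S \<rightarrow> carrier G"
    and R: "\<And>r. r \<in> R \<Longrightarrow> r \<in> words S \<Longrightarrow> word_eval G f r = \<one>"
    and surj: "\<And>\<gamma>. \<gamma> \<in> carrier G \<Longrightarrow> \<exists>w\<in>words S. \<gamma> = word_eval G f w"
    and inj: "\<And>u v. u \<in> words S \<Longrightarrow> v \<in> words S \<Longrightarrow> word_eval G f u = word_eval G f v \<Longrightarrow>
      pres_eq S R u v"
    and B: "0 \<in> B" "\<And>c d. c \<in> B \<Longrightarrow> d \<in> B \<Longrightarrow> c - d \<in> B"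
    and BR: "\<And>r \<gamma>. r \<in> R \<Longrightarrow> r \<in> words S \<Longrightarrow> \<gamma> \<in> carrier G \<Longrightarrow> word_path G f \<gamma> r \<in> B"
    and z: "supp z \<subseteq> carrier G \<times> S" "frag_extend (edge_bdry G f) z = 0"
  shows "z \<in> B"
proof -
  from surj obtain W where W: "\<And>\<gamma>. \<gamma> \<in> carrier G \<Longrightarrow> W \<gamma> \<in> words S \<and> \<gamma> = word_eval G f (W \<gamma>)"
    by metis
  define T where "T \<gamma> = word_path G f \<one> (W \<gamma>)" for \<gamma>
  have "z - frag_extend T (frag_extend (edge_bdry G f) z) \<in> B"
    using z(1)
  proof (induction z rule: frag_induction)
    case (one e)
    then obtain \<gamma> s where e: "e = (\<gamma>, s)" "\<gamma> \<in> carrier G" "s \<in> S" by auto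
    have fs: "f s \<in> carrier G" using f e by auto
    have w: "W \<gamma> @ [(s, True)] \<in> words S" "W (\<gamma> \<otimes> f s) \<in> words S" using W e fs by auto
    have "word_eval G f (W \<gamma> @ [(s, True)]) = \<gamma> \<otimes> f s"
      using word_eval_append[OF f, of "W \<gamma>" "[(s, True)]"] W[OF e(2)] e fs by simp
    also have "\<dots> = word_eval G f (W (\<gamma> \<otimes> f s))" using W[of "\<gamma> \<otimes> f s"] e fs by simp
    finally have "pres_eq S R (W \<gamma> @ [(s, True)]) (W (\<gamma> \<otimes> f s))" by (rule inj[OF w])
    from word_path_diff_bounds[OF f R B BR this one_closed]
    have "word_path G f \<one> (W \<gamma> @ [(s, True)]) - T (\<gamma> \<otimes> f s) \<in> B" by (simp add: T_def)
    also have "word_path G f \<one> (W \<gamma> @ [(s, True)]) = T \<gamma> + frag_of (\<gamma>, s)"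
      using W[OF e(2)] e word_path_append[OF f one_closed, of "W \<gamma>" "[(s, True)]"] by (simp add: T_def)
    finally show ?case by (simp add: e edge_bdry_def frag_extend_diff algebra_simps)
  next
    case (diff a b)
    from B(2)[OF this] show ?case by (simp add: frag_extend_diff algebra_simps)
  qed (simp add: B)
  then show ?thesis by (simp add: z(2))
qed

end


text \<open>Carries the presentation over to an arbitrary group, away from equivalence classes of
  words. The exact orders of the x_i are assumed here and established in
  \<open>cocompact_fuchsian_presentation\<close>.\<close>

locale fuchsian_presentation = group G for G :: "('a, 'b) monoid_scheme" (structure) +
  fixes f :: "fuchsian_gen \<Rightarrow> 'a" and g :: nat and ns :: "nat list"
  assumes f_closed: "f \<in> fuchsian_gens g ns \<rightarrow> carrier G"
    and relators: "r \<in> fuchsian_relators g ns \<Longrightarrow> word_eval G f r = \<one>"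
    and generated: "\<gamma> \<in> carrier G \<Longrightarrow> \<exists>w\<in>words (fuchsian_gens g ns). \<gamma> = word_eval G f w"
    and presented: "u \<in> words (fuchsian_gens g ns) \<Longrightarrow> v \<in> words (fuchsian_gens g ns) \<Longrightarrow>
      word_eval G f u = word_eval G f v \<Longrightarrow> pres_eq (fuchsian_gens g ns) (fuchsian_relators g ns) u v"
    and order_x: "i < length ns \<Longrightarrow> f (GenX i) [^] m = \<one> \<longleftrightarrow> ns ! i dvd m"
    and periods_pos: "i < length ns \<Longrightarrow> 0 < ns ! i"
begin

abbreviation "gens \<equiv> fuchsian_gens g ns"
abbreviation "a j \<equiv> f (GenA j)"
abbreviation "b j \<equiv> f (GenB j)"
abbreviation "x i \<equiv> f (GenX i)"

lemma a_closed [simp]: "j < g \<Longrightarrow> a j \<in> carrier G"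
  and b_closed [simp]: "j < g \<Longrightarrow> b j \<in> carrier G"
  and x_closed [simp]: "i < length ns \<Longrightarrow> x i \<in> carrier G"
  using f_closed by (auto simp: fuchsian_gens_def)

text \<open>The left coset of <x_i>; natural exponents suffice because x_i has finite order.\<close>

definition x_coset :: "nat \<Rightarrow> 'a \<Rightarrow> 'a set" where
  "x_coset i \<gamma> = range (\<lambda>m::nat. \<gamma> \<otimes> x i [^] m)"

lemma x_coset_subset: "i < length ns \<Longrightarrow> \<gamma> \<in> carrier G \<Longrightarrow> x_coset i \<gamma> \<subseteq> carrier G"
  by (auto simp: x_coset_def)

lemma self_in_x_coset: "i < length ns \<Longrightarrow> \<gamma> \<in> carrier G \<Longrightarrow> \<gamma> \<in> x_coset i \<gamma>"
  unfolding x_coset_def by (rule range_eqI[of _ _ 0]) simp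

lemma x_coset_mult_x:
  assumes i: "i < length ns" and \<gamma>: "\<gamma> \<in> carrier G"
  shows "x_coset i (\<gamma> \<otimes> x i) = x_coset i \<gamma>"
proof
  have "\<gamma> \<otimes> x i \<otimes> x i [^] m = \<gamma> \<otimes> x i [^] Suc m" for m :: nat
    using assms nat_pow_Suc2[of "x i" m] by (simp add: m_assoc del: nat_pow_Suc)
  moreover from this have "\<gamma> \<otimes> x i [^] m = \<gamma> \<otimes> x i \<otimes> x i [^] (m + (ns ! i - 1))" for m :: nat
  proof -
    have "m + ns ! i = Suc (m + (ns ! i - 1))" using periods_pos[OF i] by simp
    moreover have "x i [^] (m + ns ! i) = x i [^] m"
      using i order_x[OF i, of "ns ! i"] by (simp flip: nat_pow_mult)
    ultimately show ?thesis
      using \<open>\<And>m. \<gamma> \<otimes> x i \<otimes> x i [^] m = \<gamma> \<otimes> x i [^] Suc m\<close> by metis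
  qed
  ultimately show "x_coset i (\<gamma> \<otimes> x i) \<subseteq> x_coset i \<gamma>" "x_coset i \<gamma> \<subseteq> x_coset i (\<gamma> \<otimes> x i)"
    unfolding x_coset_def by blast+
qed

lemma x_coset_eqI:
  assumes "i < length ns" "\<gamma> \<in> carrier G" "\<delta> \<in> x_coset i \<gamma>"
  shows "x_coset i \<delta> = x_coset i \<gamma>"
proof -
  have "x_coset i (\<gamma> \<otimes> x i [^] m) = x_coset i \<gamma>" for m :: nat
  proof (induction m)
    case (Suc m)
    then show ?case using x_coset_mult_x[OF assms(1), of "\<gamma> \<otimes> x i [^] m"] assms by (simp add: m_assoc)
  qed (use assms in simp)
  then show ?thesis using assms(3) by (auto simp: x_coset_def)
qed

text \<open>Here the exact order of x_i enters: a power cell has precisely \<open>ns ! i\<close>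
  distinct vertices, so each edge of its boundary has coefficient 1.\<close>

lemma x_coset_bij:
  assumes i: "i < length ns" and \<gamma>: "\<gamma> \<in> carrier G"
  shows "bij_betw (\<lambda>m::nat. \<gamma> \<otimes> x i [^] m) {..<ns ! i} (x_coset i \<gamma>)"
proof (rule bij_betwI')
  fix p q :: nat assume pq: "p \<in> {..<ns ! i}" "q \<in> {..<ns ! i}"
  have "p = q" if "p \<le> q" "q < ns ! i" "x i [^] p = x i [^] q" for p q :: nat
  proof -
    have "x i [^] p \<otimes> x i [^] (q - p) = x i [^] (p + (q - p))"
      using i by (simp only: nat_pow_mult x_closed)
    also have "\<dots> = x i [^] p \<otimes> \<one>" using that i by simp
    finally have "x i [^] p \<otimes> x i [^] (q - p) = x i [^] p \<otimes> \<one>" .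
    then have "x i [^] (q - p) = \<one>" using i by simp
    then have "ns ! i dvd q - p" using order_x[OF i] by blast
    then show ?thesis using that by (meson diff_is_0_eq dvd_imp_le le_antisym less_imp_diff_less linorder_not_less neq0_conv)
  qed
  from this[of p q] this[of q p] show "\<gamma> \<otimes> x i [^] p = \<gamma> \<otimes> x i [^] q \<longleftrightarrow> p = q"
    using pq i \<gamma> by (cases "p \<le> q") auto
next
  fix m :: nat
  show "\<gamma> \<otimes> x i [^] m \<in> x_coset i \<gamma>" by (simp add: x_coset_def)
next
  fix \<delta> assume "\<delta> \<in> x_coset i \<gamma>"
  then obtain m :: nat where m: "\<delta> = \<gamma> \<otimes> x i [^] m" by (auto simp: x_coset_def)
  have "x i [^] m = x i [^] (ns ! i * (m div ns ! i) + m mod ns ! i)" by simp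
  also have "\<dots> = x i [^] (ns ! i * (m div ns ! i)) \<otimes> x i [^] (m mod ns ! i)"
    using i by (simp only: nat_pow_mult x_closed)
  also have "x i [^] (ns ! i * (m div ns ! i)) = \<one>" using order_x[OF i] by simp
  finally have "\<delta> = \<gamma> \<otimes> x i [^] (m mod ns ! i)" using i m by simp
  then show "\<exists>m\<in>{..<ns ! i}. \<delta> = \<gamma> \<otimes> x i [^] m"
    using periods_pos[OF i] by (intro bexI[of _ "m mod ns ! i"]) auto
qed

lemma x_coset_translate:
  assumes "i < length ns" "\<gamma> \<in> carrier G" "t \<in> carrier G"
  shows "(\<otimes>) t ` x_coset i \<gamma> = x_coset i (t \<otimes> \<gamma>)"
  using assms by (simp add: x_coset_def image_image m_assoc)

text \<open>\<open>Inl \<gamma>\<close> stands for the 2-cell of the long relator based at \<open>\<gamma>\<close>, and \<open>Inr (i, C)\<close> for the 2-cell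
  of the \<open>i\<close>-th power relator whose vertices are the coset \<open>C\<close>. The \<open>n\<^sub>i\<close> possible base points give
  one and the same cell, so a group element fixes it iff it lies in a conjugate of
  \<open>\<langle>x\<^sub>i\<rangle>\<close>.\<close>

definition face_bdry :: "'a + nat \<times> 'a set \<Rightarrow> ('a \<times> fuchsian_gen \<Rightarrow>\<^sub>0 int)" where
  "face_bdry = case_sum (\<lambda>\<gamma>. word_path G f \<gamma> (long_relator g ns))
     (\<lambda>(i, C). \<Sum>\<gamma>\<in>C. frag_of (\<gamma>, GenX i))"

definition faces :: "('a + nat \<times> 'a set) set" where
  "faces = Inl ` carrier G \<union> {Inr (i, x_coset i \<gamma>) | i \<gamma>. i < length ns \<and> \<gamma> \<in> carrier G}"

lemma finite_x_coset: "i < length ns \<Longrightarrow> \<gamma> \<in> carrier G \<Longrightarrow> finite (x_coset i \<gamma>)"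
  using x_coset_bij bij_betw_finite by blast

lemma face_bdry_Inl: "face_bdry (Inl \<gamma>) = word_path G f \<gamma> (long_relator g ns)"
  by (simp add: face_bdry_def)

lemma face_bdry_x_coset:
  assumes "i < length ns" "\<gamma> \<in> carrier G"
  shows "face_bdry (Inr (i, x_coset i \<gamma>)) = word_path G f \<gamma> (replicate (ns ! i) (GenX i, True))"
  using assms sum.reindex_bij_betw[OF x_coset_bij[OF assms], of "\<lambda>\<delta>. frag_of (\<delta>, GenX i)"]
  by (simp add: face_bdry_def word_path_replicate)

lemma power_relator: "i < length ns \<Longrightarrow> word_eval G f (replicate (ns ! i) (GenX i, True)) = \<one>"
  by (rule relators) (auto simp: fuchsian_relators_def)

lemma long_relator: "word_eval G f (long_relator g ns) = \<one>"
  by (rule relators) (simp add: fuchsian_relators_def)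

lemma keys_face_bdry:
  assumes "c \<in> faces"
  shows "supp (face_bdry c) \<subseteq> carrier G \<times> gens"
proof -
  have sub: "fst ` set w \<subseteq> gens" if "w \<in> words gens" for w
    using that by (auto simp: words_def)
  have "supp (word_path G f \<gamma> w) \<subseteq> carrier G \<times> gens"
    if "\<gamma> \<in> carrier G" "w \<in> words gens" for \<gamma> w
    using keys_word_path[OF f_closed that] sub[OF that(2)] by blast
  note this[OF _ long_relator_words] this[OF _ power_relator_words]
  with assms show ?thesis
    unfolding faces_def by (auto simp only: face_bdry_Inl face_bdry_x_coset) blast+
qed

lemma edge_face_bdry: "c \<in> faces \<Longrightarrow> frag_extend (edge_bdry G f) (face_bdry c) = 0"
  by (auto simp: faces_def face_bdry_Inl face_bdry_x_coset long_relator power_relator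
      edge_bdry_word_path[OF f_closed] long_relator_words power_relator_words)

lemma face_bdry_exact:
  assumes "supp z \<subseteq> carrier G \<times> gens"
    and "frag_extend (edge_bdry G f) z = 0"
  shows "\<exists>c. supp c \<subseteq> faces \<and> z = frag_extend face_bdry c"
proof -
  define B where "B = {frag_extend face_bdry c | c. supp c \<subseteq> faces}"
  have BI: "frag_extend face_bdry c \<in> B" if "supp c \<subseteq> faces" for c
    using that by (auto simp: B_def)
  have face: "face_bdry c \<in> B" if "c \<in> faces" for c
    using BI[of "frag_of c"] that by simp
  have "z \<in> B"
  proof (rule cycle_bounds[OF f_closed relators generated presented _ _ _ assms])
    show "0 \<in> B" using BI[of 0] by simp
  next
    fix c d assume "c \<in> B" "d \<in> B"
    then obtain c' d' where "supp c' \<subseteq> faces" "c = frag_extend face_bdry c'"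
      "supp d' \<subseteq> faces" "d = frag_extend face_bdry d'"
      by (auto simp: B_def)
    then show "c - d \<in> B" using BI[OF order_trans[OF keys_diff Un_least]]
      by (metis frag_extend_diff)
  next
    fix r \<gamma> assume "r \<in> fuchsian_relators g ns" "\<gamma> \<in> carrier G"
    moreover have "word_path G f \<gamma> (replicate (ns ! i) (GenX i, True)) \<in> B" if i: "i < length ns" for i
      using face[of "Inr (i, x_coset i \<gamma>)"] i \<open>\<gamma> \<in> carrier G\<close>
      by (auto simp: faces_def face_bdry_x_coset)
    ultimately show "word_path G f \<gamma> r \<in> B"
      using face[of "Inl \<gamma>"] by (auto simp: fuchsian_relators_def faces_def face_bdry_Inl)
  qed
  then show ?thesis by (auto simp: B_def)
qed

end

section \<open>Incidence of edges and 2-cells; free actions on the complex\<close>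

context fuchsian_presentation
begin

lemma mult_right_eq_iff:
  "\<alpha> \<in> carrier G \<Longrightarrow> \<beta> \<in> carrier G \<Longrightarrow> \<gamma> \<in> carrier G \<Longrightarrow> \<alpha> = \<beta> \<otimes> \<gamma> \<longleftrightarrow> \<beta> = \<alpha> \<otimes> inv \<gamma>"
  by (metis inv_closed inv_solve_right')

lemma lookup_word_path_outside:
  assumes "\<gamma> \<in> carrier G" "w \<in> words gens" "s \<notin> fst ` set w"
  shows "coef (word_path G f \<gamma> w) (\<delta>, s) = 0"
  using keys_word_path[OF f_closed assms(1,2)] assms(3) by (auto simp flip: not_in_keys_iff_lookup_eq_zero)

lemma lookup_word_path_split:
  assumes "\<beta> \<in> carrier G" "long_relator g ns = u @ v @ w" "s \<notin> fst ` set u" "s \<notin> fst ` set w"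
  shows "coef (word_path G f \<beta> (long_relator g ns)) (\<delta>, s) =
    coef (word_path G f (\<beta> \<otimes> word_eval G f u) v) (\<delta>, s)"
proof -
  have w: "u \<in> words gens" "v \<in> words gens" "w \<in> words gens"
    using long_relator_words[of g ns] assms(2) by auto
  have "word_eval G f u \<in> carrier G" "word_eval G f v \<in> carrier G"
    using w word_eval_closed[OF f_closed] by auto
  then show ?thesis
    using assms w by (simp add: word_path_append[OF f_closed] lookup_add lookup_word_path_outside)
qed

text \<open>Meant for an edge e that meets at most two cells, with incidence numbers k and l. All
  edges of the complex are of this kind, as on a surface.\<close>

lemma lookup_frag_extend:
  assumes "supp c \<subseteq> X"
    and "\<And>\<phi>. \<phi> \<in> X \<Longrightarrow> coef (bd \<phi>) e =
      k * coef (frag_of \<phi>) \<phi>1 + l * coef (frag_of \<phi>) \<phi>2"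
  shows "coef (frag_extend bd c) e =
      k * coef c \<phi>1 + l * coef c \<phi>2"
  using assms(1)
proof (induction c rule: frag_induction)
  case (one \<phi>)
  then show ?case using assms(2) by simp
qed (simp_all add: frag_extend_diff lookup_minus algebra_simps)

definition x_prefix :: "nat \<Rightarrow> fuchsian_gen word" where
  "x_prefix i = map (\<lambda>i. (GenX i, True)) [0..<i]"

definition handle :: "nat \<Rightarrow> fuchsian_gen word" where
  "handle j = [(GenA j, False), (GenB j, False), (GenA j, True), (GenB j, True)]"

definition handle_prefix :: "nat \<Rightarrow> fuchsian_gen word" where
  "handle_prefix j = x_prefix (length ns) @ concat (map handle [0..<j])"

lemma set_x_prefix: "fst ` set (x_prefix i) = GenX ` {..<i}"
  by (auto simp: x_prefix_def image_image)

lemma set_handle_prefix: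
  "fst ` set (handle_prefix j) = GenX ` {..<length ns} \<union> GenA ` {..<j} \<union> GenB ` {..<j}"
  by (auto simp: handle_prefix_def handle_def x_prefix_def image_iff image_Un)

lemma long_relator_split_handle:
  assumes "j < g"
  shows "long_relator g ns = handle_prefix j @ handle j @ concat (map handle [Suc j..<g])"
proof -
  have "[0..<g] = [0..<j] @ j # [Suc j..<g]"
    using assms upt_add_eq_append[of 0 j "g - j"] upt_conv_Cons[of j g] by simp
  then show ?thesis
    by (simp add: long_relator_def handle_prefix_def x_prefix_def handle_def[abs_def])
qed

lemma long_relator_split_x:
  assumes "i < length ns"
  shows "long_relator g ns = x_prefix i @ [(GenX i, True)] @
    map (\<lambda>i. (GenX i, True)) [Suc i..<length ns] @ concat (map handle [0..<g])"
proof -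
  have "[0..<length ns] = [0..<i] @ i # [Suc i..<length ns]"
    using assms upt_add_eq_append[of 0 i "length ns - i"] upt_conv_Cons[of i "length ns"] by simp
  then show ?thesis
    by (simp add: long_relator_def x_prefix_def handle_def[abs_def])
qed

lemma lookup_face_bdry_Inr:
  assumes "i < length ns" "\<gamma> \<in> carrier G"
  shows "coef (face_bdry (Inr (i, x_coset i \<gamma>))) (\<delta>, s) =
    (if s = GenX i \<and> \<delta> \<in> x_coset i \<gamma> then 1 else 0)"
proof -
  have "(\<Sum>\<gamma>'\<in>x_coset i \<gamma>. coef (frag_of (\<gamma>', GenX i)) (\<delta>, s)) =
      (\<Sum>\<gamma>'\<in>x_coset i \<gamma>. if \<gamma>' = \<delta> then (if s = GenX i then 1 else 0) else 0)"
    by (rule sum.cong) auto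
  then show ?thesis using finite_x_coset[OF assms] by (simp add: face_bdry_def lookup_sum)
qed

text \<open>The long relator contains a_j and b_j once with each sign, so an edge with such a label
  lies on the long cells at two base points, with coefficients -1 and 1. Solving for the second base
  point gives \<delta> times a conjugate by q.\<close>

lemma face_bdry_lookup_handle:
  assumes c: "supp c \<subseteq> faces" and j: "j < g" and \<delta>: "\<delta> \<in> carrier G"
  defines "q \<equiv> word_eval G f (handle_prefix j)"
  shows "coef (frag_extend face_bdry c) (\<delta> \<otimes> q \<otimes> inv (a j), GenA j) =
      - coef c (Inl \<delta>)
      + coef c (Inl (\<delta> \<otimes> (q \<otimes> inv (a j) \<otimes> b j \<otimes> a j \<otimes> inv q)))" (is "?lookupA")
    and "coef (frag_extend face_bdry c) (\<delta> \<otimes> q \<otimes> inv (a j) \<otimes> inv (b j), GenB j) =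
      - coef c (Inl \<delta>)
      + coef c
          (Inl (\<delta> \<otimes> (q \<otimes> inv (a j) \<otimes> inv (b j) \<otimes> inv (a j) \<otimes> b j \<otimes> a j \<otimes> inv q)))" (is "?lookupB")
proof -
  let ?eA = "(\<delta> \<otimes> q \<otimes> inv (a j), GenA j)" and ?eB = "(\<delta> \<otimes> q \<otimes> inv (a j) \<otimes> inv (b j), GenB j)"
  let ?\<delta>A = "\<delta> \<otimes> (q \<otimes> inv (a j) \<otimes> b j \<otimes> a j \<otimes> inv q)"
  let ?\<delta>B = "\<delta> \<otimes> (q \<otimes> inv (a j) \<otimes> inv (b j) \<otimes> inv (a j) \<otimes> b j \<otimes> a j \<otimes> inv q)"
  have "handle_prefix j \<in> words gens"
    using long_relator_words[of g ns] long_relator_split_handle[OF j] by simp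
  then have q: "q \<in> carrier G" using word_eval_closed[OF f_closed] by (simp add: q_def)
  have *: "coef (face_bdry \<phi>) ?eA =
        - 1 * coef (frag_of \<phi>) (Inl \<delta>) + 1 * coef (frag_of \<phi>) (Inl ?\<delta>A) \<and>
      coef (face_bdry \<phi>) ?eB =
        - 1 * coef (frag_of \<phi>) (Inl \<delta>) + 1 * coef (frag_of \<phi>) (Inl ?\<delta>B)"
    if \<phi>: "\<phi> \<in> faces" for \<phi>
  proof (cases \<phi>)
    case (Inl \<beta>)
    then have \<beta>: "\<beta> \<in> carrier G" using \<phi> by (auto simp: faces_def)
    have "coef (face_bdry \<phi>) (e, s) =
        coef (word_path G f (\<beta> \<otimes> q) (handle j)) (e, s)" if "s = GenA j \<or> s = GenB j" for e s
      unfolding Inl face_bdry_Inl q_def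
      by (rule lookup_word_path_split[OF \<beta> long_relator_split_handle[OF j]])
        (use that in \<open>auto simp: set_handle_prefix\<close>, use that in \<open>auto simp: handle_def\<close>)
    moreover have "\<delta> \<otimes> q \<otimes> inv (a j) = \<beta> \<otimes> q \<otimes> inv (a j) \<longleftrightarrow> \<delta> = \<beta>"
      "\<delta> \<otimes> q \<otimes> inv (a j) \<otimes> inv (b j) = \<beta> \<otimes> q \<otimes> inv (a j) \<otimes> inv (b j) \<longleftrightarrow> \<delta> = \<beta>"
      using \<beta> \<delta> q j by simp_all
    moreover have "\<delta> \<otimes> q \<otimes> inv (a j) = \<beta> \<otimes> q \<otimes> inv (a j) \<otimes> inv (b j) \<longleftrightarrow> ?\<delta>A = \<beta>"
      using mult_right_eq_iff[of "\<delta> \<otimes> q \<otimes> inv (a j)" \<beta> "q \<otimes> inv (a j) \<otimes> inv (b j)"] \<beta> \<delta> q j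
      by (auto simp add: m_assoc inv_mult_group)
    moreover have "\<delta> \<otimes> q \<otimes> inv (a j) \<otimes> inv (b j) = \<beta> \<otimes> q \<otimes> inv (a j) \<otimes> inv (b j) \<otimes> a j \<longleftrightarrow> ?\<delta>B = \<beta>"
      using mult_right_eq_iff[of "\<delta> \<otimes> q \<otimes> inv (a j) \<otimes> inv (b j)" \<beta> "q \<otimes> inv (a j) \<otimes> inv (b j) \<otimes> a j"]
        \<beta> \<delta> q j
      by (auto simp add: m_assoc inv_mult_group)
    ultimately show ?thesis by (simp add: Inl handle_def lookup_add lookup_minus)
  next
    case (Inr p)
    then show ?thesis using \<phi> by (auto simp: faces_def lookup_face_bdry_Inr)
  qed
  show ?lookupA
    using lookup_frag_extend[OF c *[THEN conjunct1]] by simp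
  show ?lookupB
    using lookup_frag_extend[OF c *[THEN conjunct2]] by simp
qed

text \<open>The letter x_i occurs once in the long relator, and each edge labelled x_i lies on one
  power cell, so one cell of either kind meets there.\<close>

lemma face_bdry_lookup_X:
  assumes c: "supp c \<subseteq> faces" and i: "i < length ns" and \<delta>: "\<delta> \<in> carrier G"
  defines "q \<equiv> word_eval G f (x_prefix i)"
  shows "coef (frag_extend face_bdry c) (\<delta> \<otimes> q, GenX i) =
    coef c (Inl \<delta>) + coef c (Inr (i, x_coset i (\<delta> \<otimes> q)))"
proof -
  have u: "x_prefix i \<in> words gens"
    using long_relator_words[of g ns] long_relator_split_x[OF i] by simp
  then have q: "q \<in> carrier G" using word_eval_closed[OF f_closed] by (simp add: q_def)
  have "coef (face_bdry \<phi>) (\<delta> \<otimes> q, GenX i) =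
      1 * coef (frag_of \<phi>) (Inl \<delta>) +
      1 * coef (frag_of \<phi>) (Inr (i, x_coset i (\<delta> \<otimes> q)))"
    if \<phi>: "\<phi> \<in> faces" for \<phi>
  proof (cases \<phi>)
    case (Inl \<beta>)
    then have \<beta>: "\<beta> \<in> carrier G" using \<phi> by (auto simp: faces_def)
    have "coef (face_bdry \<phi>) (\<delta> \<otimes> q, GenX i) =
        coef (word_path G f (\<beta> \<otimes> q) [(GenX i, True)]) (\<delta> \<otimes> q, GenX i)"
      unfolding Inl face_bdry_Inl q_def
      by (rule lookup_word_path_split[OF \<beta> long_relator_split_x[OF i]])
        (auto simp: set_x_prefix, auto simp: handle_def)
    then show ?thesis using \<beta> \<delta> q by (simp add: Inl)
  next
    case (Inr p)
    then obtain i' \<gamma> where p: "p = (i', x_coset i' \<gamma>)" "i' < length ns" "\<gamma> \<in> carrier G"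
      using \<phi> by (auto simp: faces_def)
    have "x_coset i (\<delta> \<otimes> q) = x_coset i \<gamma> \<longleftrightarrow> \<delta> \<otimes> q \<in> x_coset i \<gamma>"
      using x_coset_eqI[OF i p(3)] self_in_x_coset[OF i, of "\<delta> \<otimes> q"] \<delta> q by auto
    then show ?thesis using p Inr by (auto simp: lookup_face_bdry_Inr)
  qed
  from lookup_frag_extend[OF c this] show ?thesis by simp
qed

text \<open>A finitely supported 2-cycle takes the same value on adjacent faces, so it is constant,
  and it vanishes because there are infinitely many faces.\<close>

lemma face_bdry_inj:
  assumes inf: "infinite (carrier G)" and c: "supp c \<subseteq> faces"
    and zero: "frag_extend face_bdry c = 0"
  shows "c = 0"
proof -
  define c0 where "c0 \<gamma> = coef c (Inl \<gamma>)" for \<gamma>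
  \<comment> \<open>The right translations that preserve the coefficients of the long cells. Once H
    contains all generators, these coefficients are constant.\<close>
  define H where "H = {h \<in> carrier G. \<forall>\<delta>\<in>carrier G. c0 (\<delta> \<otimes> h) = c0 \<delta>}"
  have H: "subgroup H G"
  proof (rule subgroupI)
    fix h assume h: "h \<in> H"
    have "c0 (\<delta> \<otimes> inv h) = c0 \<delta>" if "\<delta> \<in> carrier G" for \<delta>
    proof -
      have "c0 (\<delta> \<otimes> inv h) = c0 (\<delta> \<otimes> inv h \<otimes> h)" using h that by (simp add: H_def)
      then show ?thesis using h that by (simp add: H_def m_assoc)
    qed
    then show "inv h \<in> H" using h by (simp add: H_def)
  next
    fix h h' assume "h \<in> H" "h' \<in> H"
    then show "h \<otimes> h' \<in> H" by (simp add: H_def flip: m_assoc)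
  qed (auto simp: H_def intro!: exI[of _ \<one>])
  note Hm = subgroup.m_closed[OF H] and Hi = subgroup.m_inv_closed[OF H]
  have conj: "y \<in> H" if "q \<in> H" "q \<otimes> y \<otimes> inv q \<in> H" "y \<in> carrier G" for q y
  proof -
    have "q \<in> carrier G" using that by (simp add: H_def)
    then have "y = inv q \<otimes> (q \<otimes> y \<otimes> inv q) \<otimes> q" using that(3) by (simp add: m_assoc)
    then show ?thesis using Hm Hi that(1,2) by metis
  qed
  \<comment> \<open>Strong induction: the edge relation puts the conjugate of x_i by the prefix q
    into H, and q itself lies in H because it involves earlier generators only.\<close>
  have xH: "i < length ns \<Longrightarrow> x i \<in> H" for i
  proof (induction i rule: less_induct)
    case (less i)
    define q where "q = word_eval G f (x_prefix i)"
    have q: "q \<in> H"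
      unfolding q_def by (rule word_eval_subgroup[OF H]) (use less in \<open>auto simp: x_prefix_def\<close>)
    then have qc: "q \<in> carrier G" by (simp add: H_def)
    have "c0 (\<delta> \<otimes> (q \<otimes> x i \<otimes> inv q)) = c0 \<delta>" if \<delta>: "\<delta> \<in> carrier G" for \<delta>
    proof -
      \<comment> \<open>The long cells at \<delta> and \<open>\<delta>'\<close> border the same
        power cell, and the coefficient of either is the negative of its coefficient.\<close>
      define \<delta>' where "\<delta>' = \<delta> \<otimes> (q \<otimes> x i \<otimes> inv q)"
      have \<delta>': "\<delta>' \<in> carrier G" "\<delta>' \<otimes> q = \<delta> \<otimes> q \<otimes> x i"
        using \<delta> qc less.prems by (simp_all add: \<delta>'_def m_assoc)
      show ?thesis
        using face_bdry_lookup_X[OF c less.prems \<delta>] face_bdry_lookup_X[OF c less.prems \<delta>'(1)]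
          x_coset_mult_x[OF less.prems, of "\<delta> \<otimes> q"] \<delta> qc \<delta>'(2)
        by (simp add: zero c0_def \<delta>'_def flip: q_def)
    qed
    then have "q \<otimes> x i \<otimes> inv q \<in> H" using qc less.prems by (simp add: H_def)
    then show ?case using conj[OF q] less.prems by simp
  qed
  have abH: "j < g \<Longrightarrow> a j \<in> H \<and> b j \<in> H" for j
  proof (induction j rule: less_induct)
    case (less j)
    define q where "q = word_eval G f (handle_prefix j)"
    have q: "q \<in> H"
      unfolding q_def
      by (rule word_eval_subgroup[OF H])
        (use less xH in \<open>auto simp: handle_prefix_def x_prefix_def handle_def\<close>)
    then have qc: "q \<in> carrier G" by (simp add: H_def)
    note ab = a_closed[OF less.prems] b_closed[OF less.prems]
    define y where "y = inv (a j) \<otimes> b j \<otimes> a j"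
    define z where "z = inv (a j) \<otimes> inv (b j) \<otimes> inv (a j) \<otimes> b j \<otimes> a j"
    have "q \<otimes> inv (a j) \<otimes> b j \<otimes> a j \<otimes> inv q \<in> H"
      using face_bdry_lookup_handle(1)[OF c less.prems] qc ab by (simp add: H_def zero c0_def flip: q_def)
    then have "y \<in> H" using conj[OF q, of y] ab qc by (simp add: y_def m_assoc)
    have "q \<otimes> inv (a j) \<otimes> inv (b j) \<otimes> inv (a j) \<otimes> b j \<otimes> a j \<otimes> inv q \<in> H"
      using face_bdry_lookup_handle(2)[OF c less.prems] qc ab by (simp add: H_def zero c0_def flip: q_def)
    then have "z \<in> H" using conj[OF q, of z] ab qc by (simp add: z_def m_assoc)
    \<comment> \<open>In the product of y, z and the inverse of y everything cancels except the
      inverse of \<open>a j\<close>; so the two edge relations of a handle recover both of its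
      generators.\<close>
    have "a j = inv (y \<otimes> z \<otimes> inv y)" using ab by (simp add: y_def z_def m_assoc inv_mult_group)
    with \<open>y \<in> H\<close> \<open>z \<in> H\<close> have "a j \<in> H" using Hm Hi by metis
    have "b j = a j \<otimes> y \<otimes> inv (a j)" using ab by (simp add: y_def m_assoc)
    with \<open>y \<in> H\<close> \<open>a j \<in> H\<close> have "b j \<in> H" using Hm Hi by metis
    with \<open>a j \<in> H\<close> show ?case by simp
  qed
  have "\<gamma> \<in> H" if \<gamma>: "\<gamma> \<in> carrier G" for \<gamma>
  proof -
    obtain w where "w \<in> words gens" "\<gamma> = word_eval G f w" using generated[OF \<gamma>] by blast
    moreover have "f s \<in> H" if "s \<in> gens" for s
      using that xH abH by (auto simp: fuchsian_gens_def)
    ultimately show ?thesis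
      using word_eval_subgroup[OF H, of w] by (force simp: words_def)
  qed
  note inH = this
  have const: "c0 \<gamma> = c0 \<one>" if "\<gamma> \<in> carrier G" for \<gamma>
  proof -
    have "\<forall>\<delta>\<in>carrier G. c0 (\<delta> \<otimes> \<gamma>) = c0 \<delta>" using inH[OF that] by (simp add: H_def)
    from bspec[OF this one_closed] show ?thesis using that by simp
  qed
  have "c0 \<one> = 0"
  proof (rule ccontr)
    assume "c0 \<one> \<noteq> 0"
    have "Inl ` carrier G \<subseteq> supp c"
    proof clarify
      fix \<gamma> assume "\<gamma> \<in> carrier G"
      with \<open>c0 \<one> \<noteq> 0\<close> const[of \<gamma>] have "c0 \<gamma> \<noteq> 0" by metis
      then show "Inl \<gamma> \<in> supp c" by (simp add: c0_def in_keys_iff)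
    qed
    then have "finite (Inl ` carrier G :: ('a + nat \<times> 'a set) set)" using finite_keys finite_subset by blast
    then show False using inf by (auto dest: finite_imageD)
  qed
  then have c0: "coef c (Inl \<gamma>) = 0" if "\<gamma> \<in> carrier G" for \<gamma>
    using const[OF that] by (simp add: c0_def)
  have "coef c (Inr (i, x_coset i \<gamma>)) = 0" if i: "i < length ns" and \<gamma>: "\<gamma> \<in> carrier G" for i \<gamma>
  proof -
    define q where "q = word_eval G f (x_prefix i)"
    have "q \<in> carrier G"
      unfolding q_def by (rule word_eval_closed[OF f_closed])
        (use long_relator_words[of g ns] long_relator_split_x[OF i] in simp)
    \<comment> \<open>Each power cell shares an edge with a long cell, whose coefficient is already
      known to be 0.\<close>
    then show ?thesis
      using face_bdry_lookup_X[OF c i, of "\<gamma> \<otimes> inv q"] c0[of "\<gamma> \<otimes> inv q"] \<gamma>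
      by (simp add: zero m_assoc flip: q_def)
  qed
  with c0 have "coef c \<phi> = 0" if "\<phi> \<in> faces" for \<phi>
    using that by (auto simp: faces_def)
  then have "supp c \<inter> faces = {}" by (auto simp: in_keys_iff)
  with c have "supp c = {}" by blast
  then show ?thesis by simp
qed

text \<open>The second freeness condition says that no proper power of t fixes a coset of <x_i>,
  that is, a power cell. So <t> permutes vertices, edges and 2-cells freely and the cellular chains
  form a free resolution.\<close>

lemma no_torsion_avoiding_x_conjugates:
  fixes m :: nat
  assumes inf: "infinite (carrier G)" and t: "t \<in> carrier G" "0 < m" "t [^] m = \<one>"
    and free: "\<And>j. 0 < j \<Longrightarrow> j < m \<Longrightarrow> t [^] j \<noteq> \<one>"
      "\<And>j i \<gamma> l. 0 < j \<Longrightarrow> j < m \<Longrightarrow> i < length ns \<Longrightarrow> \<gamma> \<in> carrier G \<Longrightarrow>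
        t [^] j \<otimes> \<gamma> \<noteq> \<gamma> \<otimes> x i [^] (l::nat)"
  shows "m = 1"
proof -
  let ?av = "(\<otimes>) t" and ?ae = "map_prod ((\<otimes>) t) id" and ?af = "map_sum ((\<otimes>) t) (map_prod id ((`) ((\<otimes>) t)))"
  have pv: "(?av ^^ j) \<gamma> = t [^] j \<otimes> \<gamma>" if "\<gamma> \<in> carrier G" for j \<gamma>
  proof (induction j)
    case (Suc j)
    then show ?case using that t nat_pow_Suc2[of t j] by (simp add: m_assoc del: nat_pow_Suc)
  qed (use that in simp)
  have pe: "(?ae ^^ j) e = map_prod (?av ^^ j) id e" for j e
    by (induction j) (auto simp: map_prod_def split: prod.splits)
  have pf: "(?af ^^ j) (Inl \<gamma>) = Inl ((?av ^^ j) \<gamma>)" "(?af ^^ j) (Inr (i, C)) = Inr (i, (?av ^^ j) ` C)"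
    for j \<gamma> i C
    by (induction j) (simp_all add: image_image)
  have pcoset: "(?av ^^ j) ` x_coset i \<gamma> = x_coset i (t [^] j \<otimes> \<gamma>)"
    if "i < length ns" "\<gamma> \<in> carrier G" for i \<gamma> j
  proof -
    have "(?av ^^ j) ` x_coset i \<gamma> = (\<otimes>) (t [^] j) ` x_coset i \<gamma>"
      by (intro image_cong refl pv) (use x_coset_subset[OF that] in auto)
    then show ?thesis using x_coset_translate that t by simp
  qed
  have V: "free_cyclic_action (carrier G) ?av m"
    by unfold_locales (use t free(1) in \<open>auto simp: pv r_cancel_one'\<close>)
  have E: "free_cyclic_action (carrier G \<times> gens) ?ae m"
    by unfold_locales (use t free(1) in \<open>auto simp: pv pe r_cancel_one'\<close>)
  have F: "free_cyclic_action faces ?af m"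
  proof
    fix c assume c: "c \<in> faces"
    have "t \<otimes> \<gamma> \<in> carrier G" if "\<gamma> \<in> carrier G" for \<gamma> using t that by simp
    then show "?af c \<in> faces"
      using c t x_coset_translate unfolding faces_def by fastforce
  next
    fix c j assume c: "c \<in> faces" and j: "0 < j" "j < m"
    show "(?af ^^ j) c \<noteq> c"
    proof
      assume eq: "(?af ^^ j) c = c"
      from c consider \<gamma> where "c = Inl \<gamma>" "\<gamma> \<in> carrier G"
        | i \<gamma> where "c = Inr (i, x_coset i \<gamma>)" "i < length ns" "\<gamma> \<in> carrier G"
        by (auto simp: faces_def)
      then show False
      proof cases
        case 1
        then show False using eq free(1)[OF j] t by (simp add: pf pv)
      next
        case 2
        then have "x_coset i (t [^] j \<otimes> \<gamma>) = x_coset i \<gamma>" using eq by (simp add: pf pcoset)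
        then have "t [^] j \<otimes> \<gamma> \<in> x_coset i \<gamma>"
          using self_in_x_coset[OF 2(2), of "t [^] j \<otimes> \<gamma>"] 2 t by simp
        then show False using free(2)[OF j 2(2,3)] by (auto simp: x_coset_def)
      qed
    qed
  qed (use t in \<open>auto simp: faces_def pf pv pcoset x_coset_translate\<close>)
  obtain w where w: "w \<in> words gens" "t = word_eval G f w"
    using generated[OF t(1)] by blast
  show ?thesis
  proof (rule free_cyclic_action_trivial[OF V E F, where ?b1.0 = "edge_bdry G f" and ?b2.0 = face_bdry
        and v = \<one> and u = "word_path G f \<one> w"])
    fix e assume "e \<in> carrier G \<times> gens"
    then obtain \<gamma> s where e: "e = (\<gamma>, s)" "\<gamma> \<in> carrier G" "s \<in> gens" by auto
    then have fs: "f s \<in> carrier G" using f_closed by auto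
    show "supp (edge_bdry G f e) \<subseteq> carrier G"
      unfolding edge_bdry_def e prod.case by (rule order_trans[OF keys_diff]) (use e fs in auto)
    show "edge_bdry G f (?ae e) = frag_act ?av (edge_bdry G f e)"
      using e fs t by (simp add: edge_bdry_def m_assoc)
    show "augmentation (edge_bdry G f e) = 0" by (simp add: e edge_bdry_def)
  next
    fix c assume c: "c \<in> faces"
    show "supp (face_bdry c) \<subseteq> carrier G \<times> gens" by (rule keys_face_bdry[OF c])
    show "frag_extend (edge_bdry G f) (face_bdry c) = 0" by (rule edge_face_bdry[OF c])
    show "face_bdry (?af c) = frag_act ?ae (face_bdry c)"
      using c t
      by (auto simp: faces_def face_bdry_Inl x_coset_translate face_bdry_x_coset
          word_path_translate[OF f_closed] long_relator_words power_relator_words)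
  next
    show "supp (word_path G f \<one> w) \<subseteq> carrier G \<times> gens"
      using keys_word_path[OF f_closed one_closed w(1)] w(1) by (fastforce simp: words_def)
    show "frag_extend (edge_bdry G f) (word_path G f \<one> w) = frag_of (t \<otimes> \<one>) - frag_of \<one>"
      using t w by (simp add: edge_bdry_word_path[OF f_closed])
  qed (use face_bdry_exact face_bdry_inj[OF inf] in simp_all)
qed

end

section \<open>The orders of the elliptic generators\<close>

definition bij_group :: "('a \<Rightarrow> 'a) monoid" where
  "bij_group = \<lparr>carrier = {h. bij h}, mult = (\<circ>), one = id\<rparr>"

lemma bij_group_simps [simp]:
  "h \<in> carrier bij_group \<longleftrightarrow> bij h" "h \<otimes>\<^bsub>bij_group\<^esub> k = h \<circ> k" "\<one>\<^bsub>bij_group\<^esub> = id"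
  by (simp_all add: bij_group_def)

lemma group_bij_group: "group (bij_group :: ('a \<Rightarrow> 'a) monoid)"
proof (rule groupI)
  fix h :: "'a \<Rightarrow> 'a" assume "h \<in> carrier bij_group"
  then show "\<exists>k\<in>carrier bij_group. k \<otimes>\<^bsub>bij_group\<^esub> h = \<one>\<^bsub>bij_group\<^esub>"
    by (intro bexI[of _ "inv_into UNIV h"]) (simp_all add: bij_imp_bij_inv bij_is_inj)
qed (auto intro: bij_comp simp: comp_assoc)

lemma bij_group_pow: "h [^]\<^bsub>bij_group\<^esub> (k::nat) = h ^^ k"
  by (induction k) (simp_all add: funpow_Suc_right del: funpow.simps(2))

section \<open>Conjugation by complex matrices of determinant one\<close>

definition mat22 :: "complex \<Rightarrow> complex \<Rightarrow> complex \<Rightarrow> complex \<Rightarrow> complex^2^2" where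
  "mat22 a b c d = vector [vector [a, b], vector [c, d]]"

lemma mat22_mult:
  "mat22 a b c d ** mat22 a' b' c' d' =
     mat22 (a * a' + b * c') (a * b' + b * d') (c * a' + d * c') (c * b' + d * d')"
  by (simp add: mat22_def vec_eq_iff matrix_matrix_mult_def sum_2 forall_2)

lemma mat22_eq_iff: "mat22 a b c d = mat22 a' b' c' d' \<longleftrightarrow> a = a' \<and> b = b' \<and> c = c' \<and> d = d'"
  by (simp add: mat22_def vec_eq_iff forall_2)

lemma mat22_cases: obtains a b c d where "N = mat22 a b c d"
proof
  show "N = mat22 (N $ 1 $ 1) (N $ 1 $ 2) (N $ 2 $ 1) (N $ 2 $ 2)"
    by (simp add: mat22_def vec_eq_iff forall_2)
qed

text \<open>For determinant 1 the last factor is the inverse of the first. Since signs cancel, this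
  realises PSL(2,C) inside a permutation group.\<close>

definition conj_by :: "complex \<Rightarrow> complex \<Rightarrow> complex \<Rightarrow> complex \<Rightarrow> complex^2^2 \<Rightarrow> complex^2^2" where
  "conj_by a b c d N = mat22 a b c d ** N ** mat22 d (- b) (- c) a"

lemma conj_by_comp:
  "conj_by a b c d \<circ> conj_by a' b' c' d' =
     conj_by (a * a' + b * c') (a * b' + b * d') (c * a' + d * c') (c * b' + d * d')"
proof
  fix N
  have "(conj_by a b c d \<circ> conj_by a' b' c' d') N =
      (mat22 a b c d ** mat22 a' b' c' d') ** N ** (mat22 d' (- b') (- c') a' ** mat22 d (- b) (- c) a)"
    by (simp add: conj_by_def matrix_mul_assoc)
  then show "(conj_by a b c d \<circ> conj_by a' b' c' d') N =
      conj_by (a * a' + b * c') (a * b' + b * d') (c * a' + d * c') (c * b' + d * d') N"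
    by (simp add: conj_by_def mat22_mult algebra_simps)
qed

lemma conj_by_id: "conj_by 1 0 0 1 = id" "conj_by (- 1) 0 0 (- 1) = id"
proof -
  have "conj_by 1 0 0 1 N = N \<and> conj_by (- 1) 0 0 (- 1) N = N" for N
    by (cases N rule: mat22_cases) (simp add: conj_by_def mat22_mult)
  then show "conj_by 1 0 0 1 = id" "conj_by (- 1) 0 0 (- 1) = id" by auto
qed

lemma conj_by_inverse:
  assumes "a * d - b * c = 1"
  shows "conj_by a b c d \<circ> conj_by d (- b) (- c) a = id"
    and "conj_by d (- b) (- c) a \<circ> conj_by a b c d = id"
proof -
  have "a * d + b * - c = 1" "a * - b + b * a = 0" "c * d + d * - c = 0" "c * - b + d * a = 1"
    "d * a + - b * c = 1" "d * b + - b * d = 0" "- c * a + a * c = 0" "- c * b + a * d = 1"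
    using assms by (simp_all add: algebra_simps)
  then show "conj_by a b c d \<circ> conj_by d (- b) (- c) a = id"
    and "conj_by d (- b) (- c) a \<circ> conj_by a b c d = id"
    unfolding conj_by_comp by (simp_all only: conj_by_id)
qed

lemma bij_conj_by: "a * d - b * c = 1 \<Longrightarrow> bij (conj_by a b c d)"
  using conj_by_inverse[of a d b c] by (intro o_bij)

lemma inv_conj_by:
  assumes "a * d - b * c = 1"
  shows "inv\<^bsub>bij_group\<^esub> (conj_by a b c d) = conj_by d (- b) (- c) a"
proof (rule group.inv_equality[OF group_bij_group])
  have "d * a - (- b) * (- c) = 1" using assms by (simp add: algebra_simps)
  then show "conj_by d (- b) (- c) a \<in> carrier bij_group" by (simp add: bij_conj_by)
qed (use assms bij_conj_by conj_by_inverse in auto)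

text \<open>By Cayley-Hamilton a matrix M of determinant 1 and trace 2 cos \<theta> satisfies M^k =
  u_k M - v_k I with the Chebyshev values u_k = sin(k \<theta>)/sin \<theta> and v_k = u_(k-1).
  Writing v with k \<theta> - \<theta> makes it correct at k = 0 as well, where it is -1.\<close>

lemma conj_by_power:
  fixes \<theta> :: real
  assumes det: "a * d - b * c = 1" and trace: "a + d = of_real (2 * cos \<theta>)" and s: "sin \<theta> \<noteq> 0"
  defines "u \<equiv> \<lambda>k. complex_of_real (sin (real k * \<theta>) / sin \<theta>)"
    and "v \<equiv> \<lambda>k. complex_of_real (sin (real k * \<theta> - \<theta>) / sin \<theta>)"
  shows "conj_by a b c d ^^ k = conj_by (u k * a - v k) (u k * b) (u k * c) (u k * d - v k)"
proof (induction k)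
  case 0
  then show ?case using s by (simp add: u_def v_def conj_by_id)
next
  case (Suc k)
  have vS: "v (Suc k) = u k" by (simp add: u_def v_def algebra_simps)
  have "sin (real (Suc k) * \<theta>) = 2 * cos \<theta> * sin (real k * \<theta>) - sin (real k * \<theta> - \<theta>)"
    by (simp add: sin_diff sin_add algebra_simps)
  then have "sin (real (Suc k) * \<theta>) / sin \<theta> =
      2 * cos \<theta> * (sin (real k * \<theta>) / sin \<theta>) - sin (real k * \<theta> - \<theta>) / sin \<theta>"
    by (simp add: diff_divide_distrib)
  then have uS: "u (Suc k) = (a + d) * u k - v k"
    unfolding u_def v_def trace by (simp only: flip: of_real_mult of_real_diff)
  have bc: "b * c = a * d - 1" using det by (simp add: algebra_simps)
  have ubc: "u k * b * c = u k * a * d - u k" "u k * c * b = u k * a * d - u k"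
    using arg_cong[OF bc, of "\<lambda>x. u k * x"] by (simp_all add: algebra_simps)
  have e1: "(u k * a - v k) * a + u k * b * c = u (Suc k) * a - u k"
    unfolding uS ubc by (simp add: algebra_simps)
  have e2: "(u k * a - v k) * b + u k * b * d = u (Suc k) * b"
    unfolding uS by (simp add: algebra_simps)
  have e3: "u k * c * a + (u k * d - v k) * c = u (Suc k) * c"
    unfolding uS by (simp add: algebra_simps)
  have e4: "u k * c * b + (u k * d - v k) * d = u (Suc k) * d - u k"
    unfolding uS ubc by (simp add: algebra_simps)
  show ?case
    by (simp add: funpow_Suc_right Suc.IH conj_by_comp e1 e2 e3 e4 vS del: funpow.simps(2))
qed

text \<open>At \<theta> = pi/n the power formula gives u_n = 0 and v_n = 1, so the n-th power is -I,
  and conjugation by -I is trivial.\<close>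

lemma conj_by_elliptic:
  assumes det: "a * d - b * c = 1" and trace: "a + d = of_real (2 * cos (pi / real n))" and n: "2 \<le> n"
  shows "conj_by a b c d ^^ n = id"
proof -
  have s: "sin (pi / real n) \<noteq> 0"
  proof -
    have "pi / real n < pi" using n by (simp add: field_simps)
    then have "0 < sin (pi / real n)" using n by (intro sin_gt_zero) auto
    then show ?thesis by simp
  qed
  show ?thesis
    using s n conj_by_power[OF det trace s, of n] by (simp add: sin_diff conj_by_id)
qed

lemma conj_by_diag_power:
  "conj_by a 0 0 (inverse a) ^^ (k::nat) = conj_by (a ^ k) 0 0 (inverse a ^ k)"
  by (induction k) (simp_all add: conj_by_id conj_by_comp)

text \<open>The exact order is read off from the matrix unit \<open>mat22 0 1 0 0\<close>, an
  eigenvector of the conjugation with eigenvalue z^2, a primitive n-th root of unity.\<close>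

lemma conj_by_rotation:
  fixes n k :: nat
  assumes n: "2 \<le> n"
  defines "z \<equiv> cis (pi / real n)"
  shows "bij (conj_by z 0 0 (inverse z))"
    and "conj_by z 0 0 (inverse z) ^^ n = id"
    and "conj_by z 0 0 (inverse z) ^^ k = id \<Longrightarrow> n dvd k"
proof -
  have z: "z \<noteq> 0" by (simp add: z_def)
  then have det: "z * inverse z - 0 * 0 = 1" by simp
  then show "bij (conj_by z 0 0 (inverse z))" by (rule bij_conj_by)
  have "z + inverse z = of_real (2 * cos (pi / real n))"
    by (simp add: z_def cis_inverse complex_eq_iff)
  from conj_by_elliptic[OF det this n] show "conj_by z 0 0 (inverse z) ^^ n = id" .
  assume "conj_by z 0 0 (inverse z) ^^ k = id"
  then have "conj_by (z ^ k) 0 0 (inverse z ^ k) (mat22 0 1 0 0) = mat22 0 1 0 0"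
    by (simp add: conj_by_diag_power)
  then have "z ^ k * z ^ k = 1" by (simp add: conj_by_def mat22_mult mat22_eq_iff)
  moreover have "z ^ k * z ^ k = exp (2 * of_real pi * \<i> * of_nat k / of_nat n)"
    unfolding z_def by (simp add: Complex.DeMoivre cis_mult) (simp add: cis_conv_exp algebra_simps)
  ultimately show "n dvd k" using complex_root_unity_eq_1[of n k] n by simp
qed

text \<open>A representation of the (l, m, n) triangle group. Exactness of the order is asked of X
  alone, because one elliptic generator is treated at a time.\<close>

definition triangle_rotations ::
    "nat \<Rightarrow> nat \<Rightarrow> nat \<Rightarrow> ('a \<Rightarrow> 'a) \<Rightarrow> ('a \<Rightarrow> 'a) \<Rightarrow> ('a \<Rightarrow> 'a) \<Rightarrow> bool" where
  "triangle_rotations l m n X Y Z \<longleftrightarrow> bij X \<and> bij Y \<and> bij Z \<and> X \<circ> Y \<circ> Z = id \<and>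
     X ^^ l = id \<and> Y ^^ m = id \<and> Z ^^ n = id \<and> (\<forall>k. X ^^ k = id \<longrightarrow> l dvd k)"

text \<open>Two determinant-one matrices together with their product can be given any three traces.\<close>

lemma exists_triangle_rotations:
  fixes l m n :: nat
  assumes "2 \<le> l" "2 \<le> m" "2 \<le> n"
  shows "\<exists>X Y Z :: complex^2^2 \<Rightarrow> complex^2^2. triangle_rotations l m n X Y Z"
proof -
  interpret group "bij_group :: (complex^2^2 \<Rightarrow> complex^2^2) monoid" by (rule group_bij_group)
  define z where "z = cis (pi / real l)"
  have z: "z \<noteq> 0" by (simp add: z_def)
  have "Im z > 0"
  proof -
    have "pi / real l < pi" using assms by (simp add: field_simps)
    then show ?thesis using assms by (auto simp: z_def intro!: sin_gt_zero)
  qed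
  then have nz: "z - inverse z \<noteq> 0" by (simp add: z_def cis_inverse complex_eq_iff)
  define \<beta> \<gamma> where "\<beta> = complex_of_real (2 * cos (pi / real m))"
    and "\<gamma> = complex_of_real (2 * cos (pi / real n))"
  \<comment> \<open>p and q solve p + q = \<beta> and z p + z^-1 q = \<gamma>, the trace conditions
    on Y and on XY; the system is regular since z \<noteq> z^-1. The off-diagonal entries 1 and pq -
    1 of Y then give determinant 1.\<close>
  define p where "p = (\<gamma> - \<beta> * inverse z) / (z - inverse z)"
  define q where "q = \<beta> - p"
  have det: "p * q - 1 * (p * q - 1) = 1" by simp
  have trY: "p + q = \<beta>" by (simp add: q_def)
  have "z * p + inverse z * q = p * (z - inverse z) + inverse z * \<beta>" by (simp add: q_def algebra_simps)
  also have "\<dots> = \<gamma>" using nz by (simp add: p_def)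
  finally have trXY: "z * p + inverse z * q = \<gamma>" .
  define X where "X = conj_by z 0 0 (inverse z)"
  define Y where "Y = conj_by p 1 (p * q - 1) q"
  have XY: "X \<circ> Y = conj_by (z * p) z (inverse z * (p * q - 1)) (inverse z * q)"
    by (simp add: X_def Y_def conj_by_comp)
  have detXY: "z * p * (inverse z * q) - z * (inverse z * (p * q - 1)) = 1"
    using z by (simp add: field_simps)
  note bijs = conj_by_rotation(1)[OF assms(1), folded z_def, folded X_def] bij_conj_by[OF det, folded Y_def]
  define Z where "Z = inv\<^bsub>bij_group\<^esub> (X \<circ> Y)"
  have XYc: "X \<circ> Y \<in> carrier bij_group" using bijs by (simp add: bij_comp)
  have "X \<circ> Y \<circ> Z = id" using r_inv[OF XYc] by (simp add: Z_def)
  moreover have "bij Z" using inv_closed[OF XYc] by (simp add: Z_def)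
  moreover have "Z ^^ n = inv\<^bsub>bij_group\<^esub> ((X \<circ> Y) ^^ n)"
    using nat_pow_inv[OF XYc, of n] by (simp add: Z_def bij_group_pow)
  then have "Z ^^ n = id"
    using conj_by_elliptic[OF detXY trXY[unfolded \<gamma>_def] assms(3)] inv_one by (simp add: XY)
  moreover have "Y ^^ m = id"
    unfolding Y_def by (rule conj_by_elliptic[OF det trY[unfolded \<beta>_def] assms(2)])
  ultimately show ?thesis
    using bijs conj_by_rotation(2,3)[OF assms(1), folded z_def, folded X_def]
    unfolding triangle_rotations_def by blast
qed

text \<open>B is the Weyl element, so conjugation by it inverts the diagonal rotation A and the
  commutator of A and B is A^-2. Half the angle makes A a square root of X, and the commutator
  becomes X^-1.\<close>

lemma exists_commutator_rotation:
  fixes n :: nat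
  assumes "2 \<le> n"
  obtains X A B :: "complex^2^2 \<Rightarrow> complex^2^2" where
    "bij X" "bij A" "bij B"
    "X \<circ> (inv\<^bsub>bij_group\<^esub> A \<circ> (inv\<^bsub>bij_group\<^esub> B \<circ> (A \<circ> B))) = id"
    "\<And>k. X ^^ k = id \<Longrightarrow> n dvd k" "X ^^ n = id"
proof -
  define z where "z = cis (pi / real n)"
  define w where "w = cis (pi / real n / 2)"
  have w: "w \<noteq> 0" "w * w = z" by (simp_all add: w_def z_def cis_mult)
  then have z: "z \<noteq> 0" by auto
  define X where "X = conj_by z 0 0 (inverse z)"
  define A where "A = conj_by w 0 0 (inverse w)"
  define B where "B = conj_by 0 1 (-1) 0"
  have detA: "w * inverse w - 0 * 0 = 1" using w by simp
  have detB: "(0::complex) * 0 - 1 * (-1) = 1" by simp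
  have "inv\<^bsub>bij_group\<^esub> A \<circ> (inv\<^bsub>bij_group\<^esub> B \<circ> (A \<circ> B)) =
      conj_by (inverse z) 0 0 z"
    unfolding A_def B_def inv_conj_by[OF detA] inv_conj_by[OF detB] by (simp add: conj_by_comp flip: w(2))
  then have "X \<circ> (inv\<^bsub>bij_group\<^esub> A \<circ> (inv\<^bsub>bij_group\<^esub> B \<circ> (A \<circ> B))) = id"
    using z by (simp add: X_def conj_by_comp conj_by_id)
  then show ?thesis
    using that[of X A B] bij_conj_by[OF detA] bij_conj_by[OF detB]
      conj_by_rotation[OF assms, folded z_def] by (simp add: X_def A_def B_def)
qed


lemma upt_split:
  "i < n \<Longrightarrow> k \<le> i \<Longrightarrow> [k..<n] = [k..<i] @ i # [Suc i..<n]"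
  using upt_add_eq_append[of k i "n - i"] upt_conv_Cons[of i n] by simp

lemma (in group) word_eval_append_UNIV:
  "range f \<subseteq> carrier G \<Longrightarrow> word_eval G f (u @ v) = word_eval G f u \<otimes> word_eval G f v"
  by (rule word_eval_append[of f UNIV]) (auto simp: words_def)

text \<open>Most generators are sent to the identity. The exceptions are x_i and the first handle if
  g > 0, and three elliptic generators including x_i if g = 0; the long relator then reduces to one
  commutator relation or one triangle relation.\<close>

lemma exists_fuchsian_representation:
  fixes ns :: "nat list"
  assumes ns: "\<forall>n\<in>set ns. 2 \<le> n" and i: "i < length ns" and large: "0 < g \<or> 3 \<le> length ns"
  obtains f :: "fuchsian_gen \<Rightarrow> complex^2^2 \<Rightarrow> complex^2^2" where
    "range f \<subseteq> carrier bij_group"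
    "\<And>r. r \<in> fuchsian_relators g ns \<Longrightarrow> word_eval bij_group f r = id"
    "\<And>m. f (GenX i) ^^ m = id \<Longrightarrow> ns ! i dvd m"
proof -
  interpret group "bij_group :: (complex^2^2 \<Rightarrow> complex^2^2) monoid" by (rule group_bij_group)
  have relators: "word_eval bij_group f r = id"
    if f: "range f \<subseteq> carrier bij_group" and long: "word_eval bij_group f (long_relator g ns) = id"
      and pow: "\<And>j. j < length ns \<Longrightarrow> f (GenX j) ^^ (ns ! j) = id"
      and r: "r \<in> fuchsian_relators g ns"
    for f :: "fuchsian_gen \<Rightarrow> complex^2^2 \<Rightarrow> complex^2^2" and r
  proof -
    have "f s \<in> carrier bij_group" for s using f by blast
    then show ?thesis
      using r long pow word_eval_replicate[of f] by (auto simp: fuchsian_relators_def bij_group_pow)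
  qed
  have triv: "word_eval bij_group f (map (\<lambda>j. (GenX j, True)) js) = id"
    if "\<And>j. j \<in> set js \<Longrightarrow> f (GenX j) = id"
    for js and f :: "fuchsian_gen \<Rightarrow> complex^2^2 \<Rightarrow> complex^2^2"
    using that by (induction js) auto
  have triv': "word_eval bij_group f (concat (map (\<lambda>i.
      [(GenA i, False), (GenB i, False), (GenA i, True), (GenB i, True)]) js)) = id"
    if "\<And>j. j \<in> set js \<Longrightarrow> f (GenA j) = id \<and> f (GenB j) = id"
    for js and f :: "fuchsian_gen \<Rightarrow> complex^2^2 \<Rightarrow> complex^2^2"
    using that by (induction js) (auto simp: inv_one[simplified])
  show ?thesis
  proof (cases "0 < g")
    case True
    have "2 \<le> ns ! i" using ns i by simp
    from exists_commutator_rotation[OF this] obtain X A B :: "complex^2^2 \<Rightarrow> complex^2^2" where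
      XAB: "bij X" "bij A" "bij B"
        "X \<circ> (inv\<^bsub>bij_group\<^esub> A \<circ> (inv\<^bsub>bij_group\<^esub> B \<circ> (A \<circ> B))) = id"
        "\<And>k. X ^^ k = id \<Longrightarrow> ns ! i dvd k" "X ^^ (ns ! i) = id"
      by blast
    define f where "f = (\<lambda>s. if s = GenX i then X else if s = GenA 0 then A else if s = GenB 0 then B else id)"
    have f: "range f \<subseteq> carrier bij_group" using XAB by (auto simp: f_def)
    have split: "long_relator g ns = map (\<lambda>j. (GenX j, True)) [0..<i] @ [(GenX i, True)] @
        map (\<lambda>j. (GenX j, True)) [Suc i..<length ns] @
        [(GenA 0, False), (GenB 0, False), (GenA 0, True), (GenB 0, True)] @
        concat (map (\<lambda>i. [(GenA i, False), (GenB i, False), (GenA i, True), (GenB i, True)]) [1..<g])"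
      unfolding long_relator_def using upt_split[OF i, of 0] upt_conv_Cons[OF True] by simp
    have "word_eval bij_group f (long_relator g ns) = id"
      unfolding split word_eval_append_UNIV[OF f]
      using XAB(4) by (subst triv triv', force simp: f_def)+ (simp add: f_def comp_assoc)
    moreover have "f (GenX j) ^^ (ns ! j) = id" for j
      using XAB(6) by (auto simp: f_def)
    ultimately show ?thesis
      using that[of f] f relators[OF f] XAB(5) by (simp add: f_def)
  next
    case False
    with large have "3 \<le> length ns" by simp
    have "\<exists>p q r. p < q \<and> q < r \<and> r < length ns \<and> i \<in> {p, q, r}"
    proof -
      consider "i = 0" | "i = 1" | "2 \<le> i" by linarith
      then show ?thesis
      proof cases
        case 3 then show ?thesis using i by (intro exI[of _ 0] exI[of _ 1] exI[of _ i]) simp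
      qed (use \<open>3 \<le> length ns\<close> in \<open>intro exI[of _ 0] exI[of _ 1] exI[of _ 2]; simp\<close>)+
    qed
    then obtain p q r where pqr: "p < q" "q < r" "r < length ns" "i \<in> {p, q, r}" by blast
    have tri: "\<exists>X Y Z :: complex^2^2 \<Rightarrow> complex^2^2. triangle_rotations (ns ! a) (ns ! b) (ns ! c) X Y Z"
      if "a < length ns" "b < length ns" "c < length ns" for a b c
      using ns that by (intro exists_triangle_rotations) auto
    \<comment> \<open>A product equal to 1 can be rotated cyclically; this moves the rotation of
      exact order to the position of i among p < q < r.\<close>
    have rot: "Y \<circ> Z \<circ> X = id" if "bij X" "X \<circ> Y \<circ> Z = id" for X Y Z :: "complex^2^2 \<Rightarrow> complex^2^2"
    proof -
      have "X \<circ> (Y \<circ> Z) = id" using that by (simp add: comp_assoc)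
      then have "Y \<circ> Z = inv_into UNIV X" using that(1)
        by (metis bij_is_inj comp_assoc comp_id fun.map_id0 id_comp inv_o_cancel)
      then show ?thesis using that(1) by (simp add: bij_is_inj)
    qed
    have "\<exists>P Q R :: complex^2^2 \<Rightarrow> complex^2^2. bij P \<and> bij Q \<and> bij R \<and> P \<circ> Q \<circ> R = id \<and>
      P ^^ (ns ! p) = id \<and> Q ^^ (ns ! q) = id \<and> R ^^ (ns ! r) = id \<and>
      (\<forall>k. (if i = p then P else if i = q then Q else R) ^^ k = id \<longrightarrow> ns ! i dvd k)"
    proof -
      have lt: "p < length ns" "q < length ns" using pqr by auto
      from pqr(4) consider "i = p" | "i \<noteq> p" "i = q" | "i \<noteq> p" "i \<noteq> q" "i = r" by blast
      then show ?thesis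
      proof cases
        case 1
        then show ?thesis
          using tri[OF lt pqr(3)] unfolding triangle_rotations_def by simp
      next
        case 2
        obtain X Y Z :: "complex^2^2 \<Rightarrow> complex^2^2"
          where "triangle_rotations (ns ! q) (ns ! r) (ns ! p) X Y Z" using tri[OF lt(2) pqr(3) lt(1)] by blast
        then show ?thesis
          using 2 rot[of X Y Z] rot[of Y Z X] unfolding triangle_rotations_def
          by (intro exI[of _ Z] exI[of _ X] exI[of _ Y]) simp
      next
        case 3
        obtain X Y Z :: "complex^2^2 \<Rightarrow> complex^2^2"
          where "triangle_rotations (ns ! r) (ns ! p) (ns ! q) X Y Z" using tri[OF pqr(3) lt] by blast
        then show ?thesis
          using 3 rot[of X Y Z] unfolding triangle_rotations_def
          by (intro exI[of _ Y] exI[of _ Z] exI[of _ X]) simp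
      qed
    qed
    then obtain P Q R :: "complex^2^2 \<Rightarrow> complex^2^2" where PQR: "bij P" "bij Q" "bij R" "P \<circ> Q \<circ> R = id"
      and pow: "P ^^ (ns ! p) = id" "Q ^^ (ns ! q) = id" "R ^^ (ns ! r) = id"
      and ord: "\<forall>k. (if i = p then P else if i = q then Q else R) ^^ k = id \<longrightarrow> ns ! i dvd k"
      by blast
    define f where "f = (\<lambda>s. if s = GenX p then P else if s = GenX q then Q else if s = GenX r then R else id)"
    have f: "range f \<subseteq> carrier bij_group" using PQR by (auto simp: f_def)
    have "[0..<length ns] = [0..<p] @ [p] @ [Suc p..<q] @ [q] @ [Suc q..<r] @ [r] @ [Suc r..<length ns]"
      using upt_split[of p "length ns" 0] upt_split[of q "length ns" "Suc p"]
        upt_split[of r "length ns" "Suc q"] pqr by simp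
    then have split: "long_relator g ns =
        map (\<lambda>j. (GenX j, True)) [0..<p] @ [(GenX p, True)] @
        map (\<lambda>j. (GenX j, True)) [Suc p..<q] @ [(GenX q, True)] @
        map (\<lambda>j. (GenX j, True)) [Suc q..<r] @ [(GenX r, True)] @
        map (\<lambda>j. (GenX j, True)) [Suc r..<length ns]"
      using False by (simp add: long_relator_def)
    have "word_eval bij_group f (long_relator g ns) = id"
      unfolding split word_eval_append_UNIV[OF f]
      using PQR(4) pqr(1-3) by (subst triv, force simp: f_def)+ (simp add: f_def comp_assoc)
    moreover have "f (GenX j) ^^ (ns ! j) = id" for j
      using pow by (auto simp: f_def)
    moreover have "f (GenX i) ^^ m = id \<Longrightarrow> ns ! i dvd m" for m :: nat
      using ord pqr by (auto simp: f_def)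
    ultimately show ?thesis
      using that[of f] f relators[OF f] by blast
  qed
qed

text \<open>The power relator bounds the order from above, the representation in PSL(2,C) from
  below.\<close>

lemma fuchsian_gen_order:
  assumes ns: "\<forall>n\<in>set ns. 2 \<le> n" and i: "i < length ns" and large: "0 < g \<or> 3 \<le> length ns"
  defines "S \<equiv> fuchsian_gens g ns" and "R \<equiv> fuchsian_relators g ns"
  shows "pres_gen S R (GenX i) [^]\<^bsub>presented_group S R\<^esub> m = \<one>\<^bsub>presented_group S R\<^esub> \<longleftrightarrow> ns ! i dvd m"
proof
  interpret P: group "presented_group S R" by (rule group_presented_group)
  have x: "GenX i \<in> S" using i by (simp add: S_def)
  have pow: "pres_gen S R (GenX i) [^]\<^bsub>presented_group S R\<^esub> k = pres_class S R (replicate k (GenX i, True))" for k :: nat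
  proof -
    have w: "replicate k (GenX i, True) \<in> words S" using power_relator_words[OF i] by (simp add: S_def)
    have "pres_gen S R (GenX i) \<in> carrier (presented_group S R)" using x by simp
    then have "word_eval (presented_group S R) (pres_gen S R) (replicate k (GenX i, True)) =
        pres_gen S R (GenX i) [^]\<^bsub>presented_group S R\<^esub> k"
      by (rule P.word_eval_replicate)
    then show ?thesis by (simp only: word_eval_pres_gen[OF w])
  qed
  {
    assume "ns ! i dvd m"
    then obtain k where m: "m = ns ! i * k" by blast
    have "replicate (ns ! i) (GenX i, True) \<in> R" using i by (auto simp: R_def fuchsian_relators_def)
    then have "pres_eq S R (replicate (ns ! i) (GenX i, True)) []"
      using power_relator_words[OF i] by (intro pres_eq.relator) (simp_all add: S_def)
    then have "pres_gen S R (GenX i) [^]\<^bsub>presented_group S R\<^esub> (ns ! i) = \<one>\<^bsub>presented_group S R\<^esub>"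
      unfolding pow presented_group_one
      using power_relator_words[OF i] by (subst pres_class_eq_iff) (simp_all add: S_def)
    then show "pres_gen S R (GenX i) [^]\<^bsub>presented_group S R\<^esub> m = \<one>\<^bsub>presented_group S R\<^esub>"
      using x P.nat_pow_pow[of "pres_gen S R (GenX i)" "ns ! i" k] by (simp add: m)
  next
    assume one: "pres_gen S R (GenX i) [^]\<^bsub>presented_group S R\<^esub> m = \<one>\<^bsub>presented_group S R\<^esub>"
    from exists_fuchsian_representation[OF ns i large]
    obtain f :: "fuchsian_gen \<Rightarrow> complex^2^2 \<Rightarrow> complex^2^2" where f: "range f \<subseteq> carrier bij_group"
      "\<And>r. r \<in> R \<Longrightarrow> word_eval bij_group f r = id"
      "\<And>m. f (GenX i) ^^ m = id \<Longrightarrow> ns ! i dvd m"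
      unfolding R_def by blast
    interpret H: group "bij_group :: (complex^2^2 \<Rightarrow> complex^2^2) monoid" by (rule group_bij_group)
    have fS: "f \<in> S \<rightarrow> carrier bij_group" using f(1) by auto
    have "replicate m (GenX i, True) \<in> words S" using power_relator_words[OF i] by (simp add: S_def)
    then have "pres_eq S R (replicate m (GenX i, True)) []"
      using one by (simp add: pow presented_group_one pres_class_eq_iff)
    then have "word_eval bij_group f (replicate m (GenX i, True)) = word_eval bij_group f []"
      by (rule H.word_eval_respects[OF fS, rotated]) (use f(2) in simp)
    moreover have "f (GenX i) \<in> carrier bij_group" using f(1) by blast
    ultimately have "f (GenX i) ^^ m = id" by (simp add: H.word_eval_replicate bij_group_pow)
    then show "ns ! i dvd m" by (rule f(3))
  }
qed

text \<open>With two periods the long relator makes the second generator the inverse of the first.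
  So the group is cyclic, and a power relator makes it finite.\<close>

lemma small_fuchsian_finite:
  assumes ns: "\<forall>n\<in>set ns. 2 \<le> n" and small: "length ns \<le> 2"
  shows "finite (carrier (presented_group (fuchsian_gens 0 ns) (fuchsian_relators 0 ns)))"
proof -
  define S where "S = fuchsian_gens 0 ns"
  define R where "R = fuchsian_relators 0 ns"
  interpret P: group "presented_group S R" by (rule group_presented_group)
  have S: "S = GenX ` {..<length ns}" by (auto simp: S_def fuchsian_gens_def)
  \<comment> \<open>The empty signature gives the trivial group; the identity with exponent 1 covers
    it.\<close>
  define y where "y = (if ns = [] then \<one>\<^bsub>presented_group S R\<^esub> else pres_gen S R (GenX 0))"
  define n where "n = (if ns = [] then 1 else ns ! 0)"
  have y: "y \<in> carrier (presented_group S R)"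
    using P.one_closed by (auto simp: y_def S simp del: P.one_closed)
  have n: "0 < n" using ns by (cases ns) (auto simp: n_def)
  have rel: "word_eval (presented_group S R) (pres_gen S R) r = \<one>\<^bsub>presented_group S R\<^esub>"
    if "r \<in> R" "r \<in> words S" for r
    using that pres_eq.relator[OF that] by (simp add: word_eval_pres_gen presented_group_one pres_class_eq_iff)
  have yn: "y [^]\<^bsub>presented_group S R\<^esub> n = \<one>\<^bsub>presented_group S R\<^esub>"
  proof (cases "ns = []")
    case False
    have "replicate (ns ! 0) (GenX 0, True) \<in> R" "replicate (ns ! 0) (GenX 0, True) \<in> words S"
      using False power_relator_words[of 0 ns] by (auto simp: R_def S_def fuchsian_relators_def)
    from rel[OF this] show ?thesis
      using P.word_eval_replicate[of "pres_gen S R" "GenX 0"] y False by (simp add: y_def n_def)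
  qed (simp add: y_def)
  define C where "C = range (\<lambda>k::int. y [^]\<^bsub>presented_group S R\<^esub> k)"
  have C: "subgroup C (presented_group S R)"
    unfolding C_def by (rule P.subgroup_of_powers[OF y])
  have yC: "y \<in> C" unfolding C_def by (rule range_eqI[of _ _ 1]) (use y in \<open>simp add: P.int_pow_1\<close>)
  have "pres_gen S R s \<in> C" if s: "s \<in> S" for s
  proof -
    from s small consider "ns \<noteq> []" "s = GenX 0" | "length ns = 2" "s = GenX 1" by (force simp: S)
    then show ?thesis
    proof cases
      case 1
      then show ?thesis using yC by (simp add: y_def)
    next
      case 2
      then have [simp]: "GenX 0 \<in> S" "GenX (Suc 0) \<in> S" "ns \<noteq> []" by (auto simp: S)
      have "[(GenX 0, True), (GenX 1, True)] \<in> R"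
        using 2 by (simp add: R_def fuchsian_relators_def long_relator_def numeral_2_eq_2)
      from rel[OF this] have "y \<otimes>\<^bsub>presented_group S R\<^esub> pres_gen S R s = \<one>\<^bsub>presented_group S R\<^esub>"
        using 2 by (simp add: y_def)
      then have "pres_gen S R s = inv\<^bsub>presented_group S R\<^esub> y"
        using P.inv_equality[of y "pres_gen S R s"] P.inv_comm y s
        by (metis P.inv_equality pres_class_carrier words_Cons words_Nil fst_conv)
      then show ?thesis using subgroup.m_inv_closed[OF C yC] by simp
    qed
  qed
  then have "word_eval (presented_group S R) (pres_gen S R) w \<in> C" if "w \<in> words S" for w
    using that by (intro P.word_eval_subgroup[OF C]) (force simp: words_def)
  then have "carrier (presented_group S R) \<subseteq> C"
    by (metis presented_group_carrierE word_eval_pres_gen subsetI)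
  moreover have "C \<subseteq> (\<lambda>k::nat. y [^]\<^bsub>presented_group S R\<^esub> k) ` {..<n}"
  proof
    fix c assume "c \<in> C"
    then obtain k :: int where k: "c = y [^]\<^bsub>presented_group S R\<^esub> k" by (auto simp: C_def)
    have "y [^]\<^bsub>presented_group S R\<^esub> (int n * (k div int n)) = \<one>\<^bsub>presented_group S R\<^esub>"
      using P.int_pow_pow[OF y, of "int n" "k div int n"] yn by (simp add: int_pow_int)
    then have "c = y [^]\<^bsub>presented_group S R\<^esub> (k mod int n)"
      using P.int_pow_mult[OF y, of "int n * (k div int n)" "k mod int n"] y by (simp add: k)
    also have "\<dots> = y [^]\<^bsub>presented_group S R\<^esub> (nat (k mod int n))"
      using n by (simp flip: int_pow_int)
    finally show "c \<in> (\<lambda>k::nat. y [^]\<^bsub>presented_group S R\<^esub> k) ` {..<n}"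
      by (rule image_eqI) (use n in \<open>simp add: nat_less_iff\<close>)
  qed
  ultimately have "carrier (presented_group S R) \<subseteq> (\<lambda>k::nat. y [^]\<^bsub>presented_group S R\<^esub> k) ` {..<n}"
    by (rule subset_trans)
  then have "finite (carrier (presented_group S R))" by (rule finite_subset) simp
  then show ?thesis by (simp add: S_def R_def)
qed

section \<open>Finite-index subgroups of cocompact Fuchsian groups\<close>

lemma topspace_quotient_topology [simp]: "topspace (quotient_topology X q) = q ` topspace X"
proof
  show "topspace (quotient_topology X q) \<subseteq> q ` topspace X"
    using openin_topspace[of "quotient_topology X q"] unfolding openin_quotient_topology by blast
  have "openin (quotient_topology X q) (q ` topspace X)"
    by (simp add: openin_quotient_topology Collect_conj_eq Int_absorb2 subset_iff)
  then show "q ` topspace X \<subseteq> topspace (quotient_topology X q)" by (rule openin_subset)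
qed

lemma quotient_map_quotient_topology: "quotient_map X (quotient_topology X q) q"
  by (auto simp: quotient_map_def openin_quotient_topology)

text \<open>The subgroup acts from the left on the orbit spaces considered here, so continuity of
  left translations is what makes their projections open.\<close>

locale left_translation_group = group G for G :: "('a, 'b) monoid_scheme" (structure) +
  fixes T :: "'a topology"
  assumes topspace: "topspace T = carrier G"
    and left_translation: "h \<in> carrier G \<Longrightarrow> continuous_map T T (\<lambda>x. h \<otimes> x)"
begin

abbreviation "quot \<Gamma> \<equiv> quotient_topology T (\<lambda>x. \<Gamma> #> x)"

lemma openin_translate:
  "h \<in> carrier G \<Longrightarrow> openin T V \<Longrightarrow> openin T {x \<in> carrier G. h \<otimes> x \<in> V}"
  using openin_continuous_map_preimage[OF left_translation] by (simp add: topspace)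

lemma r_coset_eq_iff:
  assumes "subgroup \<Gamma> G" "x \<in> carrier G" "y \<in> carrier G"
  shows "\<Gamma> #> x = \<Gamma> #> y \<longleftrightarrow> (\<exists>\<gamma>\<in>\<Gamma>. y = \<gamma> \<otimes> x)"
proof
  assume "\<Gamma> #> x = \<Gamma> #> y"
  then have "y \<in> \<Gamma> #> x" using rcos_self[OF assms(3,1)] by simp
  then show "\<exists>\<gamma>\<in>\<Gamma>. y = \<gamma> \<otimes> x" by (auto simp: r_coset_def)
next
  assume "\<exists>\<gamma>\<in>\<Gamma>. y = \<gamma> \<otimes> x"
  then have "y \<in> \<Gamma> #> x" by (auto simp: r_coset_def)
  then show "\<Gamma> #> x = \<Gamma> #> y" by (rule repr_independence[OF _ assms(2,1)])
qed

text \<open>The saturation of V is the union of its translates by \<Gamma>, each of them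
  open.\<close>

lemma openin_quot_image:
  assumes \<Gamma>: "subgroup \<Gamma> G" and V: "openin T V"
  shows "openin (quot \<Gamma>) ((\<lambda>x. \<Gamma> #> x) ` V)"
proof -
  have sub: "V \<subseteq> carrier G" using openin_subset[OF V] by (simp add: topspace)
  have "{x \<in> topspace T. \<Gamma> #> x \<in> (\<lambda>x. \<Gamma> #> x) ` V} = (\<Union>\<gamma>\<in>\<Gamma>. {x \<in> carrier G. \<gamma> \<otimes> x \<in> V})"
    using r_coset_eq_iff[OF \<Gamma>] sub by (fastforce simp: topspace)
  moreover have "openin T (\<Union>\<gamma>\<in>\<Gamma>. {x \<in> carrier G. \<gamma> \<otimes> x \<in> V})"
    using V subgroup.subset[OF \<Gamma>] by (intro openin_Union) (auto intro: openin_translate)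
  ultimately show ?thesis using sub by (auto simp: openin_quotient_topology topspace)
qed

text \<open>Around every x take V x so small that each translate of it by an element of F projects
  into a single member of the cover. Finitely many V x cover the quotient by \<Gamma>, and since
  \<Gamma> = K F their translates by F cover the quotient by K.\<close>

lemma compact_quot_finite_index:
  assumes \<Gamma>: "subgroup \<Gamma> G" and K: "subgroup K G" and "K \<subseteq> \<Gamma>"
    and F: "finite F" "F \<subseteq> \<Gamma>" "\<And>\<gamma>. \<gamma> \<in> \<Gamma> \<Longrightarrow> \<exists>\<kappa>\<in>K. \<exists>f\<in>F. \<gamma> = \<kappa> \<otimes> f"
    and compact: "compact_space (quot \<Gamma>)"
  shows "compact_space (quot K)"
  unfolding compact_space_alt
proof (intro allI impI)
  fix \<U> assume "(\<forall>U\<in>\<U>. openin (quot K) U) \<and> topspace (quot K) \<subseteq> \<Union>\<U>"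
  then have opn: "\<And>U. U \<in> \<U> \<Longrightarrow> openin (quot K) U"
    and cover: "\<And>x. x \<in> carrier G \<Longrightarrow> \<exists>U\<in>\<U>. K #> x \<in> U"
    by (auto simp: topspace)
  have Fc: "f \<in> carrier G" if "f \<in> F" for f using that F(2) subgroup.subset[OF \<Gamma>] by blast
  from cover obtain u where u: "\<And>x. x \<in> carrier G \<Longrightarrow> u x \<in> \<U> \<and> K #> x \<in> u x" by metis
  define V where "V x = carrier G \<inter> (\<Inter>f\<in>F. {y \<in> carrier G. K #> (f \<otimes> y) \<in> u (f \<otimes> x)})" for x
  have V_open: "openin T (V x)" if x: "x \<in> carrier G" for x
  proof -
    have "openin T {y \<in> carrier G. K #> (f \<otimes> y) \<in> u (f \<otimes> x)}" if f: "f \<in> F" for f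
    proof -
      have "openin (quot K) (u (f \<otimes> x))" using opn u Fc[OF f] x by simp
      then have "openin T {y \<in> carrier G. K #> y \<in> u (f \<otimes> x)}"
        by (simp add: openin_quotient_topology topspace)
      from openin_translate[OF Fc[OF f] this] show ?thesis
        using Fc[OF f] by (simp cong: conj_cong)
    qed
    then show ?thesis
      unfolding V_def using F(1) openin_topspace[of T] topspace
      by (cases "F = {}") (auto intro!: openin_Int openin_INT2)
  qed
  have xV: "x \<in> V x" if "x \<in> carrier G" for x using that u Fc by (auto simp: V_def)
  have "topspace (quot \<Gamma>) \<subseteq> \<Union> ((\<lambda>x. (\<lambda>y. \<Gamma> #> y) ` V x) ` carrier G)"
    using xV by (auto simp: topspace)
  moreover have "\<forall>W\<in>(\<lambda>x. (\<lambda>y. \<Gamma> #> y) ` V x) ` carrier G. openin (quot \<Gamma>) W"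
    using openin_quot_image[OF \<Gamma>] V_open by blast
  ultimately obtain \<F> where \<F>: "finite \<F>" "\<F> \<subseteq> (\<lambda>x. (\<lambda>y. \<Gamma> #> y) ` V x) ` carrier G"
      "topspace (quot \<Gamma>) \<subseteq> \<Union>\<F>"
    using compact unfolding compact_space_alt by meson
  then obtain X where X: "X \<subseteq> carrier G" "finite X" "\<F> = (\<lambda>x. (\<lambda>y. \<Gamma> #> y) ` V x) ` X"
    by (meson finite_subset_image)
  show "\<exists>\<F>. finite \<F> \<and> \<F> \<subseteq> \<U> \<and> topspace (quot K) \<subseteq> \<Union>\<F>"
  proof (intro exI conjI)
    show "finite ((\<lambda>(f, x). u (f \<otimes> x)) ` (F \<times> X))" using F(1) X(2) by simp
    show "(\<lambda>(f, x). u (f \<otimes> x)) ` (F \<times> X) \<subseteq> \<U>" using u Fc X(1) by auto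
    show "topspace (quot K) \<subseteq> \<Union> ((\<lambda>(f, x). u (f \<otimes> x)) ` (F \<times> X))"
    proof
      fix c assume "c \<in> topspace (quot K)"
      then obtain z where z: "z \<in> carrier G" "c = K #> z" by (auto simp: topspace)
      then have "\<Gamma> #> z \<in> \<Union>\<F>" using \<F>(3) by (auto simp: topspace)
      then obtain x v where x: "x \<in> X" "v \<in> V x" "\<Gamma> #> z = \<Gamma> #> v" unfolding X(3) by auto
      have v: "v \<in> carrier G" using x(2) by (simp add: V_def)
      obtain \<gamma> where "\<gamma> \<in> \<Gamma>" "z = \<gamma> \<otimes> v" using r_coset_eq_iff[OF \<Gamma> v z(1)] x(3) by auto
      with F(3) obtain \<kappa> f where \<kappa>: "\<kappa> \<in> K" "f \<in> F" "z = \<kappa> \<otimes> f \<otimes> v" by metis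
      have "\<kappa> \<in> carrier G" using \<kappa>(1) subgroup.subset[OF K] by blast
      then have "z = \<kappa> \<otimes> (f \<otimes> v)" using \<kappa> Fc v by (simp add: m_assoc)
      then have "c = K #> (f \<otimes> v)" using r_coset_eq_iff[OF K, of "f \<otimes> v" z] \<kappa> Fc v z by auto
      also have "\<dots> \<in> u (f \<otimes> x)" using x(2) \<kappa>(2) by (simp add: V_def)
      finally show "c \<in> \<Union> ((\<lambda>(f, x). u (f \<otimes> x)) ` (F \<times> X))" using \<kappa>(2) x(1) by auto
    qed
  qed
qed

end

section \<open>Topology of PSL(2,R) and of its cocompact discrete subgroups\<close>

lemma carrier_PSL2R: "carrier PSL2R = (\<lambda>A. {mat 1, - mat 1} #>\<^bsub>SL2R\<^esub> A) ` carrier SL2R"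
  by (auto simp: PSL2R_def FactGroup_def RCOSETS_def)

lemma SL2R_coset: "{mat 1, - mat 1} #>\<^bsub>SL2R\<^esub> A = {A, - A}"
proof -
  have "- (mat 1) ** A = - A" 
    by (simp add: matrix_matrix_mult_def vec_eq_iff mat_def forall_2 sum_2)
  then show ?thesis by (auto simp: r_coset_def SL2R_def)
qed

lemma topspace_PSL2R: "topspace PSL2R_topology = carrier PSL2R"
  by (simp add: PSL2R_topology_def carrier_PSL2R)

lemma left_translation_group_PSL2R: "left_translation_group PSL2R PSL2R_topology"
proof -
  interpret group PSL2R by (rule group_PSL2R)
  show ?thesis
  proof
    show "topspace PSL2R_topology = carrier PSL2R" by (rule topspace_PSL2R)
    fix h assume "h \<in> carrier PSL2R"
    then obtain B where B: "B \<in> carrier SL2R" "h = {mat 1, - mat 1} #>\<^bsub>SL2R\<^esub> B"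
      by (auto simp: carrier_PSL2R)
    let ?q = "\<lambda>A. {mat 1, - mat 1} #>\<^bsub>SL2R\<^esub> A"
    interpret n: normal "{mat 1, - mat 1}" SL2R by (rule normal_center_SL2R)
    have qm: "quotient_map (top_of_set (carrier SL2R)) PSL2R_topology ?q"
      unfolding PSL2R_topology_def by (rule quotient_map_quotient_topology)
    have "continuous_on (carrier SL2R) (\<lambda>A. B ** A)"
      unfolding matrix_matrix_mult_def by (intro continuous_intros)
    then have "continuous_map (top_of_set (carrier SL2R)) (top_of_set (carrier SL2R)) (\<lambda>A. B ** A)"
      using B by (auto simp: SL2R_def det_mul)
    from continuous_map_compose[OF this quotient_imp_continuous_map[OF qm]]
    have "continuous_map (top_of_set (carrier SL2R)) PSL2R_topology (\<lambda>A. ?q (B ** A))"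
      by (simp add: comp_def)
    moreover have "h \<otimes>\<^bsub>PSL2R\<^esub> ?q A = ?q (B ** A)" if "A \<in> carrier SL2R" for A
      using n.rcos_sum[OF B(1) that] by (simp add: PSL2R_def FactGroup_def B(2)) (simp add: SL2R_def)
    ultimately have "continuous_map (top_of_set (carrier SL2R)) PSL2R_topology ((\<lambda>x. h \<otimes>\<^bsub>PSL2R\<^esub> x) \<circ> ?q)"
      by (subst continuous_map_eq[of _ _ "\<lambda>A. ?q (B ** A)"]) auto
    then show "continuous_map PSL2R_topology PSL2R_topology (\<lambda>x. h \<otimes>\<^bsub>PSL2R\<^esub> x)"
      by (rule continuous_compose_quotient_map[OF qm])
  qed
qed

text \<open>The matrix norm is unbounded on PSL(2,R). For finite \<Gamma>, the cosets on which it
  stays below m form open sets that exhaust the quotient, so compactness would bound it.\<close>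

lemma cocompact_fuchsian_infinite:
  assumes "cocompact_fuchsian_group \<Gamma>"
  shows "infinite \<Gamma>"
proof
  assume fin: "finite \<Gamma>"
  interpret left_translation_group PSL2R PSL2R_topology by (rule left_translation_group_PSL2R)
  have \<Gamma>: "subgroup \<Gamma> PSL2R" and compact: "compact_space (quot \<Gamma>)"
    using assms by (auto simp: cocompact_fuchsian_group_def)
  define V where "V m = {x \<in> carrier PSL2R. \<forall>A\<in>x. norm A < real m}" for m
  have q: "{A, - A} \<in> carrier PSL2R" if "det A = 1" for A :: "real^2^2"
    using that unfolding carrier_PSL2R SL2R_coset by (auto simp: SL2R_def)
  have "{A \<in> carrier SL2R. {A, - A} \<in> V m} = carrier SL2R \<inter> ball 0 (real m)" for m
    using q by (auto simp: V_def SL2R_def)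
  then have V_open: "openin PSL2R_topology (V m)" for m
    unfolding PSL2R_topology_def openin_quotient_topology
    using carrier_PSL2R by (auto simp: SL2R_coset V_def openin_open_Int)
  define U where "U m = {c \<in> topspace (quot \<Gamma>). c \<subseteq> V m}" for m
  have "openin (quot \<Gamma>) (U m)" for m
  proof -
    have "{x \<in> topspace PSL2R_topology. \<Gamma> #>\<^bsub>PSL2R\<^esub> x \<in> U m} =
        (\<Inter>\<gamma>\<in>\<Gamma>. {x \<in> carrier PSL2R. \<gamma> \<otimes>\<^bsub>PSL2R\<^esub> x \<in> V m})"
      using subgroup.one_closed[OF \<Gamma>] by (auto simp: U_def topspace r_coset_def)
    moreover have "openin PSL2R_topology \<dots>"
      using fin subgroup.one_closed[OF \<Gamma>] subgroup.subset[OF \<Gamma>] V_open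
      by (intro openin_INT2) (auto intro!: openin_translate)
    ultimately show ?thesis by (auto simp: openin_quotient_topology U_def)
  qed
  moreover have "topspace (quot \<Gamma>) \<subseteq> \<Union> (range U)"
  proof
    fix c assume c: "c \<in> topspace (quot \<Gamma>)"
    then obtain x where x: "x \<in> carrier PSL2R" "c = \<Gamma> #>\<^bsub>PSL2R\<^esub> x" by (auto simp: topspace)
    have cc: "c \<subseteq> carrier PSL2R" using r_coset_subset_G[OF subgroup.subset[OF \<Gamma>] x(1)] x(2) by simp
    have "finite c" using fin by (simp add: x(2) r_coset_def)
    moreover have "finite y" if "y \<in> c" for y using that cc by (auto simp: carrier_PSL2R SL2R_coset)
    ultimately have "finite (norm ` \<Union>c)" by auto
    then obtain b where b: "\<And>A. A \<in> \<Union>c \<Longrightarrow> norm A \<le> b"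
      by (meson bdd_above_finite bdd_above.unfold image_eqI)
    obtain m where "b < real m" using reals_Archimedean2 by blast
    then have "c \<in> U m" using b c cc by (force simp: U_def V_def)
    then show "c \<in> \<Union> (range U)" by blast
  qed
  ultimately obtain \<F> where \<F>: "finite \<F>" "\<F> \<subseteq> range U" "topspace (quot \<Gamma>) \<subseteq> \<Union>\<F>"
    using compact unfolding compact_space_alt by (metis (no_types, lifting) rangeE)
  then obtain M where M: "finite M" "\<F> = U ` M" by (meson finite_subset_image)
  obtain b where b: "\<And>m. m \<in> M \<Longrightarrow> m \<le> b" using M(1) by (meson finite_nat_set_iff_bounded_le)
  \<comment> \<open>Determinant 1, with an entry larger than every m of the finite subcover.\<close>
  define D :: "real^2^2" where
    "D = vector [vector [real (Suc b), 0], vector [0, 1 / real (Suc b)]]"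
  have "det D = 1" by (simp add: det_2 D_def)
  from q[OF this] have D: "{D, - D} \<in> carrier PSL2R" .
  then have "\<Gamma> #>\<^bsub>PSL2R\<^esub> {D, - D} \<in> \<Union>\<F>" using \<F>(3) by (auto simp: topspace)
  then obtain m where m: "m \<in> M" "\<Gamma> #>\<^bsub>PSL2R\<^esub> {D, - D} \<subseteq> V m" by (auto simp: M(2) U_def)
  have "{D, - D} \<in> V m" using m(2) rcos_self[OF D \<Gamma>] by blast
  then have "norm D < real m" by (simp add: V_def)
  moreover have "norm (D $ 1 $ 1) \<le> norm D"
    by (rule order_trans[OF Finite_Cartesian_Product.norm_nth_le Finite_Cartesian_Product.norm_nth_le])
  moreover have "D $ 1 $ 1 = real (Suc b)" by (simp add: D_def)
  ultimately show False using b[OF m(1)] by simp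
qed

lemma cocompact_fuchsian_finite_index:
  assumes \<Gamma>: "cocompact_fuchsian_group \<Gamma>" and K: "subgroup K PSL2R" "K \<subseteq> \<Gamma>"
    and F: "finite F" "F \<subseteq> \<Gamma>" "\<And>\<gamma>. \<gamma> \<in> \<Gamma> \<Longrightarrow> \<exists>\<kappa>\<in>K. \<exists>f\<in>F. \<gamma> = \<kappa> \<otimes>\<^bsub>PSL2R\<^esub> f"
  shows "cocompact_fuchsian_group K"
proof -
  interpret left_translation_group PSL2R PSL2R_topology by (rule left_translation_group_PSL2R)
  have "subtopology PSL2R_topology K = subtopology (subtopology PSL2R_topology \<Gamma>) K"
    using K(2) by (simp add: subtopology_subtopology Int_absorb1)
  also have "\<dots> = discrete_topology K"
    using \<Gamma> K(2) by (simp add: cocompact_fuchsian_group_def Int_absorb1)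
  finally show ?thesis
    using compact_quot_finite_index[OF _ K F] \<Gamma> K(1) by (simp add: cocompact_fuchsian_group_def)
qed

section \<open>Counting tuples of residues\<close>

text \<open>Common form of several reductions: if every coordinate splits into two parts and the
  conditions P and Q look at different parts, the count factors. P and Q may depend on the values on
  I only, because the coordinate functions are not extensional outside I.\<close>

lemma card_PiE_product:
  assumes bij: "\<And>i. i \<in> I \<Longrightarrow> bij_betw (\<phi> i) (A i) (B i \<times> C i)"
    and P: "\<And>u w. (\<And>i. i \<in> I \<Longrightarrow> u i = w i) \<Longrightarrow> P u = P w"
    and Q: "\<And>u w. (\<And>i. i \<in> I \<Longrightarrow> u i = w i) \<Longrightarrow> Q u = Q w"
  shows "card {u \<in> PiE I A. P (\<lambda>i. fst (\<phi> i (u i))) \<and> Q (\<lambda>i. snd (\<phi> i (u i)))} =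
    card {v \<in> PiE I B. P v} * card {w \<in> PiE I C. Q w}"
proof -
  define \<psi> where "\<psi> i = inv_into (A i) (\<phi> i)" for i
  have \<psi>1: "\<psi> i (\<phi> i x) = x" if "i \<in> I" "x \<in> A i" for i x
    using bij[OF that(1)] that(2) by (simp add: \<psi>_def bij_betw_inv_into_left)
  have \<psi>2: "\<phi> i (\<psi> i z) = z" "\<psi> i z \<in> A i" if "i \<in> I" "z \<in> B i \<times> C i" for i z
    using bij_betw_inv_into_right[OF bij[OF that(1)] that(2)]
      bij_betw_apply[OF bij_betw_inv_into[OF bij[OF that(1)]] that(2)] by (simp_all add: \<psi>_def)
  have \<phi>: "fst (\<phi> i x) \<in> B i" "snd (\<phi> i x) \<in> C i" if "i \<in> I" "x \<in> A i" for i x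
    using bij_betw_apply[OF bij[OF that(1)] that(2)] by (auto simp: mem_Times_iff)
  have "bij_betw (\<lambda>u. (restrict (\<lambda>i. fst (\<phi> i (u i))) I, restrict (\<lambda>i. snd (\<phi> i (u i))) I))
    {u \<in> PiE I A. P (\<lambda>i. fst (\<phi> i (u i))) \<and> Q (\<lambda>i. snd (\<phi> i (u i)))}
    ({v \<in> PiE I B. P v} \<times> {w \<in> PiE I C. Q w})" (is "bij_betw ?f ?X ?Y")
  proof (rule bij_betw_byWitness[where f' = "\<lambda>(v, w). restrict (\<lambda>i. \<psi> i (v i, w i)) I"])
    show "\<forall>u\<in>?X. (\<lambda>(v, w). restrict (\<lambda>i. \<psi> i (v i, w i)) I) (?f u) = u"
    proof
      fix u assume "u \<in> ?X"
      then have u: "u \<in> PiE I A" by simp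
      have "restrict (\<lambda>i. \<psi> i (fst (\<phi> i (u i)), snd (\<phi> i (u i)))) I = u"
        by (rule extensionalityI[of _ I]) (use u \<psi>1 in \<open>auto simp: PiE_def\<close>)
      then show "(\<lambda>(v, w). restrict (\<lambda>i. \<psi> i (v i, w i)) I) (?f u) = u"
        by (simp cong: restrict_cong)
    qed
    show "\<forall>z\<in>?Y. ?f ((\<lambda>(v, w). restrict (\<lambda>i. \<psi> i (v i, w i)) I) z) = z"
    proof
      fix z assume "z \<in> ?Y"
      then obtain v w where z: "z = (v, w)" "v \<in> PiE I B" "w \<in> PiE I C" by auto
      have "restrict (\<lambda>i. fst (\<phi> i (\<psi> i (v i, w i)))) I = v"
        by (rule extensionalityI[of _ I]) (use z \<psi>2(1) in \<open>auto simp: PiE_def Pi_def\<close>)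
      moreover have "restrict (\<lambda>i. snd (\<phi> i (\<psi> i (v i, w i)))) I = w"
        by (rule extensionalityI[of _ I]) (use z \<psi>2(1) in \<open>auto simp: PiE_def Pi_def\<close>)
      ultimately show "?f ((\<lambda>(v, w). restrict (\<lambda>i. \<psi> i (v i, w i)) I) z) = z"
        by (simp add: z(1) cong: restrict_cong)
    qed
    show "?f ` ?X \<subseteq> ?Y"
    proof (rule image_subsetI)
      fix u assume u: "u \<in> ?X"
      then have "P (restrict (\<lambda>i. fst (\<phi> i (u i))) I)" "Q (restrict (\<lambda>i. snd (\<phi> i (u i))) I)"
        using P[of "restrict (\<lambda>i. fst (\<phi> i (u i))) I" "\<lambda>i. fst (\<phi> i (u i))"]
          Q[of "restrict (\<lambda>i. snd (\<phi> i (u i))) I" "\<lambda>i. snd (\<phi> i (u i))"] by auto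
      moreover have "u i \<in> A i" if "i \<in> I" for i using u that by (auto dest: PiE_mem)
      ultimately show "?f u \<in> ?Y" using \<phi> by auto
    qed
    show "(\<lambda>(v, w). restrict (\<lambda>i. \<psi> i (v i, w i)) I) ` ?Y \<subseteq> ?X"
    proof (rule image_subsetI)
      fix z assume "z \<in> ?Y"
      then obtain v w where z: "z = (v, w)" and v: "v \<in> PiE I B" "P v" and w: "w \<in> PiE I C" "Q w" by auto
      let ?u = "restrict (\<lambda>i. \<psi> i (v i, w i)) I"
      have vw: "(v i, w i) \<in> B i \<times> C i" if "i \<in> I" for i using v(1) w(1) that by auto
      have "P (\<lambda>i. fst (\<phi> i (?u i))) = P v" by (rule P) (use \<psi>2(1) vw in simp)
      moreover have "Q (\<lambda>i. snd (\<phi> i (?u i))) = Q w" by (rule Q) (use \<psi>2(1) vw in simp)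
      moreover have "?u \<in> PiE I A" using \<psi>2(2) vw by auto
      ultimately show "(\<lambda>(v, w). restrict (\<lambda>i. \<psi> i (v i, w i)) I) z \<in> ?X"
        using v w by (simp add: z del: restrict_apply)
    qed
  qed
  then show ?thesis by (simp add: bij_betw_same_card card_cartesian_product)
qed

lemma bij_betw_mod_div:
  fixes M K :: nat
  assumes "0 < M"
  shows "bij_betw (\<lambda>x. (x mod M, x div M)) {..<M * K} ({..<M} \<times> {..<K})"
proof (rule bij_betw_byWitness[where f' = "\<lambda>(r, q). r + M * q"])
  show "(\<lambda>(r, q). r + M * q) ` ({..<M} \<times> {..<K}) \<subseteq> {..<M * K}"
  proof (rule image_subsetI)
    fix z :: "nat \<times> nat" assume "z \<in> {..<M} \<times> {..<K}"
    then obtain r q where z: "z = (r, q)" "r < M" "q < K" by auto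
    then have "r + M * q < M * Suc q" "M * Suc q \<le> M * K" by (simp, intro mult_le_mono2) simp
    then show "(\<lambda>(r, q). r + M * q) z \<in> {..<M * K}" by (simp add: z(1))
  qed
qed (use assms in \<open>auto simp: less_mult_imp_div_less mult.commute\<close>)

lemma bij_betw_mod_mod:
  fixes a b :: nat
  assumes "coprime a b" "0 < a" "0 < b"
  shows "bij_betw (\<lambda>x. (x mod a, x mod b)) {..<a * b} ({..<a} \<times> {..<b})"
proof -
  have inj: "inj_on (\<lambda>x. (x mod a, x mod b)) {..<a * b}"
  proof (rule inj_onI)
    fix x y assume xy: "x \<in> {..<a * b}" "y \<in> {..<a * b}" "(x mod a, x mod b) = (y mod a, y mod b)"
    then have "[x = y] (mod a)" "[x = y] (mod b)" by (simp_all add: cong_def)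
    then have "[x = y] (mod a * b)" using assms(1) by (rule coprime_cong_mult_nat)
    then show "x = y" using xy by (simp add: cong_def)
  qed
  moreover have "(\<lambda>x. (x mod a, x mod b)) ` {..<a * b} = {..<a} \<times> {..<b}"
    by (rule card_subset_eq) (use assms inj in \<open>auto simp: card_image card_cartesian_product\<close>)
  ultimately show ?thesis by (simp add: bij_betw_def)
qed

section \<open>Local densities of periodic conditions\<close>

abbreviation tuples :: "'i set \<Rightarrow> nat \<Rightarrow> ('i \<Rightarrow> nat) set" where
  "tuples I N \<equiv> PiE I (\<lambda>_. {..<N})"

definition periodic :: "'i set \<Rightarrow> nat \<Rightarrow> (('i \<Rightarrow> nat) \<Rightarrow> bool) \<Rightarrow> bool" where
  "periodic I N P \<longleftrightarrow> (\<forall>u w. (\<forall>i\<in>I. u i mod N = w i mod N) \<longrightarrow> P u = P w)"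

text \<open>Normalised so that it does not change when the modulus is replaced by a multiple of a
  period, and so that it is multiplicative over coprime moduli. A global count thereby becomes a
  product over primes.\<close>

definition tuple_density :: "'i set \<Rightarrow> nat \<Rightarrow> (('i \<Rightarrow> nat) \<Rightarrow> bool) \<Rightarrow> real" where
  "tuple_density I N P = real (card {u \<in> tuples I N. P u}) / real N ^ card I"

lemma periodicD: "periodic I N P \<Longrightarrow> (\<And>i. i \<in> I \<Longrightarrow> u i mod N = w i mod N) \<Longrightarrow> P u = P w"
  by (auto simp: periodic_def)

lemma periodic_dvd:
  assumes "periodic I M P" "M dvd N"
  shows "periodic I N P"
  unfolding periodic_def
proof (intro allI impI)
  fix u w assume eq: "\<forall>i\<in>I. u i mod N = w i mod N"
  have "u i mod M = w i mod M" if "i \<in> I" for i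
    using eq that assms(2) by (metis mod_mod_cancel)
  then show "P u = P w" using periodicD[OF assms(1)] by blast
qed

lemma tuple_density_reduce:
  assumes I: "finite I" and per: "periodic I M P" and "M dvd N" "0 < N"
  shows "tuple_density I N P = tuple_density I M P"
proof -
  obtain K where N: "N = M * K" using \<open>M dvd N\<close> by blast
  have pos: "0 < M" "0 < K" using \<open>0 < N\<close> N by (auto intro: gr0I)
  have ext: "P u = P w" if "\<And>i. i \<in> I \<Longrightarrow> u i = w i" for u w
    using periodicD[OF per, of u w] that by simp
  have "{u \<in> tuples I N. P u} = {u \<in> tuples I N. P (\<lambda>i. u i mod M)}"
  proof -
    have "P u = P (\<lambda>i. u i mod M)" for u by (rule periodicD[OF per]) simp
    then show ?thesis by simp
  qed
  also have "card \<dots> = card {v \<in> tuples I M. P v} * card {w \<in> tuples I K. True}"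
  proof -
    have "card {u \<in> tuples I N. P (\<lambda>i. u i mod M) \<and> True} =
        card {v \<in> tuples I M. P v} * card {w \<in> tuples I K. True}"
      by (rule card_PiE_product[of I "\<lambda>_ x. (x mod M, x div M)" "\<lambda>_. {..<N}" "\<lambda>_. {..<M}" "\<lambda>_. {..<K}"
            P "\<lambda>_. True", unfolded fst_conv snd_conv],
          rule bij_betw_mod_div[OF pos(1), of K, folded N], rule ext, simp, rule HOL.refl)
    then show ?thesis by simp
  qed
  also have "card {w \<in> tuples I K. True} = K ^ card I" using I by (simp add: card_PiE)
  finally show ?thesis using pos by (simp add: tuple_density_def N power_mult_distrib)
qed

lemma tuple_density_coprime:
  assumes "periodic I a P" "periodic I b Q" "coprime a b" "0 < a" "0 < b"
  shows "tuple_density I (a * b) (\<lambda>u. P u \<and> Q u) = tuple_density I a P * tuple_density I b Q"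
proof -
  have ext: "(\<And>i. i \<in> I \<Longrightarrow> u i = w i) \<Longrightarrow> P u = P w" "(\<And>i. i \<in> I \<Longrightarrow> u i = w i) \<Longrightarrow> Q u = Q w" for u w
    by (rule periodicD[OF assms(1)], simp, rule periodicD[OF assms(2)], simp)
  have "{u \<in> tuples I (a * b). P u \<and> Q u} =
      {u \<in> tuples I (a * b). P (\<lambda>i. u i mod a) \<and> Q (\<lambda>i. u i mod b)}"
  proof -
    have "P u = P (\<lambda>i. u i mod a)" "Q u = Q (\<lambda>i. u i mod b)" for u
      by (rule periodicD[OF assms(1)], simp, rule periodicD[OF assms(2)], simp)
    then show ?thesis by simp
  qed
  also have "card \<dots> = card {v \<in> tuples I a. P v} * card {w \<in> tuples I b. Q w}"
    by (rule card_PiE_product[of I "\<lambda>_ x. (x mod a, x mod b)" "\<lambda>_. {..<a * b}" "\<lambda>_. {..<a}" "\<lambda>_. {..<b}"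
          P Q, unfolded fst_conv snd_conv],
        rule bij_betw_mod_mod[OF assms(3-5)], rule ext(1), simp, rule ext(2), simp)
  finally show ?thesis by (simp add: tuple_density_def power_mult_distrib)
qed

lemma tuple_density_prod_primes:
  assumes I: "finite I" and Ps: "finite Ps" "\<And>p. p \<in> Ps \<Longrightarrow> prime p"
    and per: "\<And>p. p \<in> Ps \<Longrightarrow> periodic I p (Q p)"
  shows "tuple_density I (\<Prod>Ps) (\<lambda>u. \<forall>p\<in>Ps. Q p u) = (\<Prod>p\<in>Ps. tuple_density I p (Q p))"
    and "periodic I (\<Prod>Ps) (\<lambda>u. \<forall>p\<in>Ps. Q p u)"
proof -
  have "tuple_density I (\<Prod>Ps) (\<lambda>u. \<forall>p\<in>Ps. Q p u) = (\<Prod>p\<in>Ps. tuple_density I p (Q p)) \<and>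
      periodic I (\<Prod>Ps) (\<lambda>u. \<forall>p\<in>Ps. Q p u)"
    using Ps per
  proof (induction Ps rule: finite_induct)
    case empty
    have "{u \<in> tuples I (Suc 0). True} = tuples I (Suc 0)" by simp
    then have "card {u \<in> tuples I (Suc 0). True} = 1" using I by (simp only: card_PiE) simp
    then show ?case by (simp add: tuple_density_def periodic_def)
  next
    case (insert p Ps)
    then have p: "prime p" "periodic I p (Q p)" and IH:
      "tuple_density I (\<Prod>Ps) (\<lambda>u. \<forall>p\<in>Ps. Q p u) = (\<Prod>p\<in>Ps. tuple_density I p (Q p))"
      "periodic I (\<Prod>Ps) (\<lambda>u. \<forall>p\<in>Ps. Q p u)" by auto
    have "coprime p (\<Prod>Ps)"
      by (rule prod_coprime_right) (use insert in \<open>auto intro: primes_coprime\<close>)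
    moreover have "0 < \<Prod>Ps" by (rule prod_pos) (use insert.prems(1) in \<open>auto intro: prime_gt_0_nat\<close>)
    ultimately have "tuple_density I (p * \<Prod>Ps) (\<lambda>u. Q p u \<and> (\<forall>p\<in>Ps. Q p u)) =
        tuple_density I p (Q p) * (\<Prod>p\<in>Ps. tuple_density I p (Q p))"
      using tuple_density_coprime[OF p(2) IH(2)] prime_gt_0_nat[OF p(1)] IH(1) by simp
    moreover have "periodic I (p * \<Prod>Ps) (\<lambda>u. Q p u \<and> (\<forall>p\<in>Ps. Q p u))"
      using periodic_dvd[OF p(2), of "p * \<Prod>Ps"] periodic_dvd[OF IH(2), of "p * \<Prod>Ps"]
      unfolding periodic_def by (metis dvd_triv_left dvd_triv_right)
    ultimately show ?case using insert.hyps by simp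
  qed
  then show "tuple_density I (\<Prod>Ps) (\<lambda>u. \<forall>p\<in>Ps. Q p u) = (\<Prod>p\<in>Ps. tuple_density I p (Q p))"
    and "periodic I (\<Prod>Ps) (\<lambda>u. \<forall>p\<in>Ps. Q p u)" by blast+
qed

lemma prod_primes_dvd_iff:
  fixes N :: nat
  assumes "finite Ps" "\<And>p. p \<in> Ps \<Longrightarrow> prime p"
  shows "\<Prod>Ps dvd N \<longleftrightarrow> (\<forall>p\<in>Ps. p dvd N)"
  using assms
proof (induction Ps rule: finite_induct)
  case (insert p Ps)
  have "coprime p (\<Prod>Ps)"
    by (rule prod_coprime_right) (use insert in \<open>auto intro: primes_coprime\<close>)
  then have "p * \<Prod>Ps dvd N \<longleftrightarrow> p dvd N \<and> \<Prod>Ps dvd N"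
    by (metis divides_mult dvd_mult_left dvd_mult_right)
  then show ?case using insert by simp
qed simp

text \<open>By the Chinese remainder theorem the conditions are independent modulo the product of
  the primes; this product divides N, and the density is the same for both moduli.\<close>

lemma tuple_density_primes:
  assumes I: "finite I" and Ps: "\<And>p. p \<in> Ps \<Longrightarrow> prime p \<and> p dvd N" and N: "0 < N"
    and per: "\<And>p. p \<in> Ps \<Longrightarrow> periodic I p (Q p)"
  shows "tuple_density I N (\<lambda>u. \<forall>p\<in>Ps. Q p u) = (\<Prod>p\<in>Ps. tuple_density I p (Q p))"
proof -
  have "Ps \<subseteq> {..N}" using Ps N by (auto dest: dvd_imp_le)
  then have fin: "finite Ps" by (rule finite_subset) simp
  have prime: "\<And>p. p \<in> Ps \<Longrightarrow> prime p" using Ps by blast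
  have "\<Prod>Ps dvd N" using prod_primes_dvd_iff[OF fin prime] Ps by simp
  have "tuple_density I N (\<lambda>u. \<forall>p\<in>Ps. Q p u) = tuple_density I (\<Prod>Ps) (\<lambda>u. \<forall>p\<in>Ps. Q p u)"
    by (rule tuple_density_reduce[OF I tuple_density_prod_primes(2)[OF I fin prime per] \<open>\<Prod>Ps dvd N\<close> N])
  also have "\<dots> = (\<Prod>p\<in>Ps. tuple_density I p (Q p))"
    by (rule tuple_density_prod_primes(1)[OF I fin prime per])
  finally show ?thesis .
qed

lemma card_PiE_insert:
  assumes "j \<notin> I"
  shows "card {u \<in> PiE (insert j I) A. R u} = card {(y, u). y \<in> A j \<and> u \<in> PiE I A \<and> R (u(j := y))}"
proof -
  have "{u \<in> PiE (insert j I) A. R u} =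
      (\<lambda>(y, u). u(j := y)) ` {(y, u). y \<in> A j \<and> u \<in> PiE I A \<and> R (u(j := y))}"
    unfolding PiE_insert_eq by auto
  also have "card \<dots> = card {(y, u). y \<in> A j \<and> u \<in> PiE I A \<and> R (u(j := y))}"
    by (rule card_image, rule inj_on_subset[OF inj_combinator[OF assms]]) auto
  finally show ?thesis .
qed

text \<open>The congruence has exactly one root modulo p, and this root is a unit iff p does not
  divide s.\<close>

lemma card_linear_solution:
  fixes p d s :: nat
  assumes p: "prime p" and d: "\<not> p dvd d"
  shows "card {y \<in> {1..<p}. p dvd d * y + s} = (if p dvd s then 0 else 1)"
proof (cases "p dvd s")
  case True
  have "\<not> p dvd d * y + s" if "y \<in> {1..<p}" for y
  proof -
    have "\<not> p dvd y" using that by (auto dest: dvd_imp_le)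
    then show ?thesis using True d p by (simp add: prime_dvd_mult_iff dvd_add_left_iff)
  qed
  then show ?thesis using True by auto
next
  case False
  have "coprime d p" using prime_imp_coprime[OF p d] by (simp add: coprime_commute)
  then obtain x where x: "[d * x = 1] (mod p)" using cong_solve_coprime_nat[of d p] by auto
  \<comment> \<open>The root -s/d: x inverts d, and \<open>(p - 1) * s\<close> represents -s among
    the naturals.\<close>
  define y where "y = (x * ((p - 1) * s)) mod p"
  have "[d * y + s = d * (x * ((p - 1) * s)) + s] (mod p)"
    unfolding y_def by (intro cong_add cong_mult cong_refl) (simp add: cong_def)
  also have "d * (x * ((p - 1) * s)) + s = (d * x) * ((p - 1) * s) + s" by simp
  also have "[\<dots> = 1 * ((p - 1) * s) + s] (mod p)" by (intro cong_add cong_mult x cong_refl)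
  also have "1 * ((p - 1) * s) + s = p * s" using prime_gt_0_nat[OF p] by (cases p) simp_all
  finally have y: "p dvd d * y + s" by (simp add: cong_def mod_eq_0_iff_dvd)
  have "y < p" using prime_gt_0_nat[OF p] by (simp add: y_def)
  moreover have "y \<noteq> 0" using y False by (auto intro!: gr0I)
  moreover have uniq: "z = y" if "z < p" "p dvd d * z + s" for z
  proof -
    have "[d * z + s = d * y + s] (mod p)" using that(2) y by (simp add: cong_def mod_eq_0_iff_dvd)
    then have "[d * z = d * y] (mod p)" by (simp add: cong_add_rcancel_nat)
    then have "[z = y] (mod p)" using \<open>coprime d p\<close> by (simp add: cong_mult_lcancel_nat)
    then show ?thesis using that(1) \<open>y < p\<close> by (simp add: cong_def)
  qed
  ultimately have single: "{z \<in> {1..<p}. p dvd d * z + s} = {y}"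
  proof (intro equalityI subsetI)
    fix z assume "z \<in> {z \<in> {1..<p}. p dvd d * z + s}"
    then show "z \<in> {y}" using uniq[of z] by simp
  next
    fix z assume "z \<in> {y}"
    with y \<open>y < p\<close> \<open>y \<noteq> 0\<close> show "z \<in> {z \<in> {1..<p}. p dvd d * z + s}" by simp
  qed
  show ?thesis unfolding single using False by simp
qed

text \<open>A variable whose coefficient is divisible by p is free. A unit variable with coefficient
  prime to p completes each partial tuple of nonzero sum in exactly one way and no other, so the
  count L becomes \<kappa> - L, where \<kappa> counts all partial tuples. The deviation of the
  density from 1/p is thus multiplied by -1/(p-1) each time.\<close>

lemma card_local_solutions:
  fixes d :: "'i \<Rightarrow> nat" and A :: "'i \<Rightarrow> nat set"
  assumes "finite I" and p: "prime p" and fin: "\<And>i. i \<in> I \<Longrightarrow> finite (A i)"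
    and A: "\<And>i. i \<in> I \<Longrightarrow> \<not> p dvd d i \<Longrightarrow> A i = {1..<p}"
  shows "real (card {u \<in> PiE I A. p dvd (\<Sum>i\<in>I. d i * u i)}) =
    (\<Prod>i\<in>I. real (card (A i))) * (1 + (real p - 1) * (- 1 / (real p - 1)) ^ card {i \<in> I. \<not> p dvd d i}) / real p"
  using assms(1,3,4)
proof (induction I rule: finite_induct)
  case empty
  have "{u \<in> PiE {} A. True} = {\<lambda>_. undefined}" by simp
  then show ?case using prime_gt_0_nat[OF p] by simp
next
  case (insert j I)
  define e where "e = card {i \<in> I. \<not> p dvd d i}"
  define x where "x = - 1 / (real p - 1)"
  define \<kappa> where "\<kappa> = (\<Prod>i\<in>I. real (card (A i)))"
  define L where "L = card {u \<in> PiE I A. p dvd (\<Sum>i\<in>I. d i * u i)}"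
  have p1: "1 < real p" using prime_gt_1_nat[OF p] by simp
  have IH: "real L = \<kappa> * (1 + (real p - 1) * x ^ e) / real p"
    using insert unfolding L_def \<kappa>_def e_def x_def by simp
  have finP: "finite (PiE I A)" using insert by (intro finite_PiE) auto
  have cardP: "real (card (PiE I A)) = \<kappa>" using insert.hyps by (simp add: card_PiE \<kappa>_def)
  have "(\<Sum>i\<in>insert j I. d i * (u(j := y)) i) = d j * y + (\<Sum>i\<in>I. d i * u i)" for u y
  proof -
    have "(\<Sum>i\<in>I. d i * (u(j := y)) i) = (\<Sum>i\<in>I. d i * u i)"
      by (rule sum.cong) (use insert.hyps in auto)
    then show ?thesis using insert.hyps by simp
  qed
  then have rec: "card {u \<in> PiE (insert j I) A. p dvd (\<Sum>i\<in>insert j I. d i * u i)} =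
      card {(y, u). y \<in> A j \<and> u \<in> PiE I A \<and> p dvd d j * y + (\<Sum>i\<in>I. d i * u i)}"
    by (subst card_PiE_insert[OF insert.hyps(2)]) simp
  show ?case
  proof (cases "p dvd d j")
    case True
    then have "{(y, u). y \<in> A j \<and> u \<in> PiE I A \<and> p dvd d j * y + (\<Sum>i\<in>I. d i * u i)} =
        A j \<times> {u \<in> PiE I A. p dvd (\<Sum>i\<in>I. d i * u i)}"
      by (auto simp: dvd_add_right_iff)
    then have "real (card {u \<in> PiE (insert j I) A. p dvd (\<Sum>i\<in>insert j I. d i * u i)}) =
        real (card (A j)) * real L"
      unfolding rec by (simp add: card_cartesian_product L_def)
    moreover have "{i \<in> insert j I. \<not> p dvd d i} = {i \<in> I. \<not> p dvd d i}" using True by auto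
    ultimately show ?thesis using insert.hyps IH by (simp add: e_def x_def \<kappa>_def)
  next
    case False
    then have Aj: "A j = {1..<p}" using insert.prems by simp
    have "{(y, u). y \<in> A j \<and> u \<in> PiE I A \<and> p dvd d j * y + (\<Sum>i\<in>I. d i * u i)} =
        (\<lambda>(u, y). (y, u)) ` (SIGMA u:PiE I A. {y \<in> {1..<p}. p dvd d j * y + (\<Sum>i\<in>I. d i * u i)})"
      using Aj by auto
    also have "card \<dots> = card (SIGMA u:PiE I A. {y \<in> {1..<p}. p dvd d j * y + (\<Sum>i\<in>I. d i * u i)})"
      by (rule card_image) (auto simp: inj_on_def)
    also have "\<dots> = (\<Sum>u\<in>PiE I A. card {y \<in> {1..<p}. p dvd d j * y + (\<Sum>i\<in>I. d i * u i)})"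
      using finP by (intro card_SigmaI) auto
    also have "\<dots> = (\<Sum>u\<in>PiE I A. if p dvd (\<Sum>i\<in>I. d i * u i) then 0 else 1)"
      by (intro sum.cong HOL.refl card_linear_solution[OF p False])
    also have "\<dots> = card {u \<in> PiE I A. \<not> p dvd (\<Sum>i\<in>I. d i * u i)}"
      unfolding card_eq_sum sum.inter_filter[OF finP] by (rule sum.cong) auto
    finally have "card {u \<in> PiE (insert j I) A. p dvd (\<Sum>i\<in>insert j I. d i * u i)} =
        card {u \<in> PiE I A. \<not> p dvd (\<Sum>i\<in>I. d i * u i)}" unfolding rec .
    moreover have "card {u \<in> PiE I A. \<not> p dvd (\<Sum>i\<in>I. d i * u i)} + L = card (PiE I A)"
    proof -
      have "PiE I A = {u \<in> PiE I A. \<not> p dvd (\<Sum>i\<in>I. d i * u i)} \<union> {u \<in> PiE I A. p dvd (\<Sum>i\<in>I. d i * u i)}"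
        by blast
      also have "card \<dots> = card {u \<in> PiE I A. \<not> p dvd (\<Sum>i\<in>I. d i * u i)} + L"
        unfolding L_def using finP by (intro card_Un_disjoint) auto
      finally show ?thesis ..
    qed
    ultimately have "real (card {u \<in> PiE (insert j I) A. p dvd (\<Sum>i\<in>insert j I. d i * u i)}) = \<kappa> - real L"
      using cardP by linarith
    also have "\<dots> = (real p - 1) * \<kappa> * (1 - x ^ e) / real p"
      unfolding IH using p1 by (simp add: field_simps)
    also have "1 - x ^ e = 1 + (real p - 1) * x ^ Suc e" using p1 by (simp add: x_def field_simps)
    finally have *: "real (card {u \<in> PiE (insert j I) A. p dvd (\<Sum>i\<in>insert j I. d i * u i)}) =
        (real p - 1) * \<kappa> * (1 + (real p - 1) * x ^ Suc e) / real p" .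
    have "{i \<in> insert j I. \<not> p dvd d i} = insert j {i \<in> I. \<not> p dvd d i}" using False by auto
    then have "card {i \<in> insert j I. \<not> p dvd d i} = Suc e" using insert.hyps by (simp add: e_def)
    moreover have "(\<Prod>i\<in>insert j I. real (card (A i))) = (real p - 1) * \<kappa>"
      using insert.hyps p1 by (simp add: \<kappa>_def Aj of_nat_diff)
    ultimately show ?thesis using * by (simp add: x_def)
  qed
qed

lemma bezout_Gcd_image:
  fixes d :: "'i \<Rightarrow> nat"
  assumes "finite I"
  shows "\<exists>v. (\<Sum>i\<in>I. int (d i) * v i) = int (Gcd (d ` I))"
  using assms
proof (induction I rule: finite_induct)
  case (insert j I)
  then obtain v where v: "(\<Sum>i\<in>I. int (d i) * v i) = int (Gcd (d ` I))" by blast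
  obtain x y where xy: "x * int (d j) + y * int (Gcd (d ` I)) = gcd (int (d j)) (int (Gcd (d ` I)))"
    using bezout_int by blast
  have "(\<Sum>i\<in>I. int (d i) * (if i = j then x else y * v i)) = (\<Sum>i\<in>I. y * (int (d i) * v i))"
    by (rule sum.cong) (use insert.hyps in auto)
  also have "\<dots> = y * int (Gcd (d ` I))" unfolding v[symmetric] sum_distrib_left ..
  finally have "(\<Sum>i\<in>insert j I. int (d i) * (if i = j then x else y * v i)) = int (Gcd (d ` insert j I))"
    using insert.hyps xy by (simp add: mult.commute)
  then show ?case by (rule exI[of _ "\<lambda>i. if i = j then x else y * v i"])
qed simp

text \<open>No prime of L divides all the \<open>d i\<close>, so their gcd is invertible modulo L;
  Bezout coefficients are scaled by the inverse and reduced modulo L to become natural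
  numbers.\<close>

lemma exists_unit_combination:
  fixes d :: "'i \<Rightarrow> nat"
  assumes I: "finite I" and L: "0 < L" and p: "\<And>p. prime p \<Longrightarrow> p dvd L \<Longrightarrow> \<exists>i\<in>I. \<not> p dvd d i"
  shows "\<exists>v. [(\<Sum>i\<in>I. d i * v i) = 1] (mod L)"
proof -
  have "coprime (Gcd (d ` I)) L"
  proof (rule ccontr)
    assume "\<not> coprime (Gcd (d ` I)) L"
    then have "gcd (Gcd (d ` I)) L \<noteq> 1" by (simp add: coprime_iff_gcd_eq_1)
    then obtain q where q: "prime q" "q dvd gcd (Gcd (d ` I)) L" using prime_factor_nat by blast
    then have "q dvd Gcd (d ` I)" "q dvd L" by auto
    with p[OF q(1)] show False by (meson Gcd_dvd dvd_trans imageI)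
  qed
  then obtain x where x: "[Gcd (d ` I) * x = 1] (mod L)" using cong_solve_coprime_nat by fastforce
  obtain v where v: "(\<Sum>i\<in>I. int (d i) * v i) = int (Gcd (d ` I))" using bezout_Gcd_image[OF I, of d] by blast
  define w where "w i = nat ((v i * int x) mod int L)" for i
  have "[int (\<Sum>i\<in>I. d i * w i) = (\<Sum>i\<in>I. int (d i) * (v i * int x))] (mod int L)"
    unfolding of_nat_sum of_nat_mult
    by (intro cong_sum cong_mult cong_refl) (use L in \<open>simp add: w_def cong_def\<close>)
  also have "(\<Sum>i\<in>I. int (d i) * (v i * int x)) = int (Gcd (d ` I) * x)"
    unfolding of_nat_mult v[symmetric] sum_distrib_right by (simp add: mult.assoc)
  also have "[int (Gcd (d ` I) * x) = int 1] (mod int L)" using x by (simp only: cong_int_iff)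
  finally show ?thesis unfolding cong_int_iff by blast
qed

text \<open>Translating \<open>u\<close> by \<open>r t v\<close> preserves \<open>U\<close> and changes the sum by \<open>r t\<close>, so the sums divisible
  by \<open>r\<close> are equidistributed modulo \<open>L\<close>.\<close>

lemma card_solutions_lift:
  fixes d :: "'i \<Rightarrow> nat"
  assumes I: "finite I" and L: "0 < L" "r dvd L" and U: "periodic I r U"
    and v: "[(\<Sum>i\<in>I. d i * v i) = 1] (mod L)"
  shows "(L div r) * card {u \<in> tuples I L. U u \<and> L dvd (\<Sum>i\<in>I. d i * u i)} =
    card {u \<in> tuples I L. U u \<and> r dvd (\<Sum>i\<in>I. d i * u i)}"
proof -
  define m where "m = L div r"
  have Lm: "L = m * r" using L by (simp add: m_def)
  then have pos: "0 < m" "0 < r" using L(1) by (auto intro: gr0I)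
  \<comment> \<open>The sums divisible by r fall into the m classes \<open>c * r\<close> modulo L.
    All classes have the same size, and the class of 0 is the one wanted.\<close>
  define Z where "Z c = {u \<in> tuples I L. U u \<and> [(\<Sum>i\<in>I. d i * u i) = c * r] (mod L)}" for c
  have fin: "finite (Z c)" for c 
    by (rule finite_subset[of _ "tuples I L"]) (use I in \<open>auto simp: Z_def intro: finite_PiE\<close>)
  have le: "card (Z c) \<le> card (Z c')" for c c'
  proof -
    \<comment> \<open>A natural number congruent to c' - c modulo m, so that translation by
      \<open>r * t * v\<close> takes class c to class c'.\<close>
    define t where "t = c' + (m - 1) * c"
    have ct: "c * r + r * t = c' * r + c * L"
      using pos(1) by (cases m) (simp_all add: Lm t_def algebra_simps)
    define h where "h u = restrict (\<lambda>i. (u i + r * t * v i) mod L) I" for u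
    have "inj_on h (Z c)"
    proof (rule inj_onI)
      fix u w assume uw: "u \<in> Z c" "w \<in> Z c" "h u = h w"
      show "u = w"
      proof (rule PiE_ext)
        show "u \<in> tuples I L" "w \<in> tuples I L" using uw by (auto simp: Z_def)
        fix i assume i: "i \<in> I"
        have "(u i + r * t * v i) mod L = (w i + r * t * v i) mod L"
          using fun_cong[OF uw(3), of i] i by (simp add: h_def)
        then have "[u i = w i] (mod L)" by (simp add: cong_add_rcancel_nat flip: cong_def)
        moreover have "u i < L" "w i < L" using uw(1,2) i by (auto simp: Z_def dest: PiE_mem)
        ultimately show "u i = w i" by (simp add: cong_def)
      qed
    qed
    moreover have "h ` Z c \<subseteq> Z c'"
    proof (rule image_subsetI)
      fix u assume u: "u \<in> Z c"
      have h1: "h u \<in> tuples I L" using L(1) by (simp add: h_def)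
      have h2: "U (h u) = U u"
        by (rule periodicD[OF U]) (use L(2) in \<open>simp add: h_def mod_mod_cancel mult.assoc\<close>)
      have "[(\<Sum>i\<in>I. d i * h u i) = (\<Sum>i\<in>I. d i * (u i + r * t * v i))] (mod L)"
        by (intro cong_sum cong_mult cong_refl) (simp add: h_def cong_def)
      then have "[(\<Sum>i\<in>I. d i * h u i) = (\<Sum>i\<in>I. d i * u i) + r * t * (\<Sum>i\<in>I. d i * v i)] (mod L)"
        by (simp add: sum.distrib sum_distrib_left algebra_simps)
      also have "[(\<Sum>i\<in>I. d i * u i) + r * t * (\<Sum>i\<in>I. d i * v i) = c * r + r * t * 1] (mod L)"
        using u by (intro cong_add cong_mult v cong_refl) (simp add: Z_def)
      also have "c * r + r * t * 1 = c' * r + c * L" using ct by simp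
      also have "[c' * r + c * L = c' * r] (mod L)" by (simp add: cong_def)
      finally have "[(\<Sum>i\<in>I. d i * h u i) = c' * r] (mod L)" .
      with h1 h2 show "h u \<in> Z c'" using u by (simp add: Z_def)
    qed
    ultimately show ?thesis by (rule card_inj_on_le[OF _ _ fin])
  qed
  have eq: "card (Z c) = card (Z 0)" for c using le[of c 0] le[of 0 c] by simp
  have "{u \<in> tuples I L. U u \<and> r dvd (\<Sum>i\<in>I. d i * u i)} = (\<Union>c<m. Z c)"
  proof (intro equalityI subsetI)
    fix u assume u: "u \<in> {u \<in> tuples I L. U u \<and> r dvd (\<Sum>i\<in>I. d i * u i)}"
    then have "r dvd (\<Sum>i\<in>I. d i * u i)" by simp
    then obtain b where b: "(\<Sum>i\<in>I. d i * u i) = b * r" by (metis dvdE mult.commute)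
    have "b * r mod L = (b mod m) * r" by (simp add: Lm mult_mod_left)
    then have "[(\<Sum>i\<in>I. d i * u i) = (b mod m) * r] (mod L)"
      unfolding b cong_def by (metis mod_mod_trivial)
    then have "u \<in> Z (b mod m)" using u by (simp add: Z_def)
    then show "u \<in> (\<Union>c<m. Z c)" using pos(1) by auto
  next
    fix u assume "u \<in> (\<Union>c<m. Z c)"
    then obtain c where u: "u \<in> tuples I L" "U u" "[(\<Sum>i\<in>I. d i * u i) = c * r] (mod L)"
      by (auto simp: Z_def)
    from u(3) L(2) have "[(\<Sum>i\<in>I. d i * u i) = c * r] (mod r)" by (rule cong_dvd_modulus_nat)
    then show "u \<in> {u \<in> tuples I L. U u \<and> r dvd (\<Sum>i\<in>I. d i * u i)}"
      using u by (simp add: cong_def mod_eq_0_iff_dvd)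
  qed
  also have "card (\<Union>c<m. Z c) = (\<Sum>c<m. card (Z c))"
  proof (rule card_UN_disjoint)
    show "\<forall>c\<in>{..<m}. \<forall>c'\<in>{..<m}. c \<noteq> c' \<longrightarrow> Z c \<inter> Z c' = {}"
    proof (intro ballI impI equals0I)
      fix c c' u assume c: "c \<in> {..<m}" "c' \<in> {..<m}" "c \<noteq> c'" "u \<in> Z c \<inter> Z c'"
      then have "[c * r = c' * r] (mod L)" unfolding Z_def by (auto intro: cong_trans cong_sym)
      moreover have "c * r < L" "c' * r < L" using c pos by (auto simp: Lm)
      ultimately show False using c(3) pos by (simp add: cong_def)
    qed
  qed (use fin in auto)
  also have "\<dots> = (\<Sum>c<m. card (Z 0))" by (intro sum.cong HOL.refl eq)
  also have "\<dots> = m * card (Z 0)" by simp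
  also have "Z 0 = {u \<in> tuples I L. U u \<and> L dvd (\<Sum>i\<in>I. d i * u i)}"
    by (simp add: Z_def cong_0_iff)
  finally show ?thesis by (simp add: m_def)
qed

section \<open>Global counts assembled from the local ones\<close>

lemma coprime_iff_primes:
  fixes a n :: nat
  assumes "0 < n"
  shows "coprime a n \<longleftrightarrow> (\<forall>p. prime p \<longrightarrow> p dvd n \<longrightarrow> \<not> p dvd a)"
proof
  assume "coprime a n"
  then show "\<forall>p. prime p \<longrightarrow> p dvd n \<longrightarrow> \<not> p dvd a"
    by (metis coprime_common_divisor not_prime_unit)
next
  assume *: "\<forall>p. prime p \<longrightarrow> p dvd n \<longrightarrow> \<not> p dvd a"
  show "coprime a n"
  proof (rule ccontr)
    assume "\<not> coprime a n"
    then have "gcd a n \<noteq> 1" by (simp add: coprime_iff_gcd_eq_1)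
    then obtain q where "prime q" "q dvd gcd a n" using prime_factor_nat by blast
    then show False using * by auto
  qed
qed

text \<open>At p only the zero tuple modulo p fails, a proportion of 1/p^|J|. For empty J the factor
  is 0, in agreement with the convention for g = 0.\<close>

lemma card_unimodular_tuples:
  fixes q n :: nat
  assumes J: "finite J" and n: "0 < n" and q: "q dvd n"
  shows "real (card {v \<in> tuples J n. \<forall>p\<in>{p. prime p \<and> p dvd q}. \<exists>j\<in>J. \<not> p dvd v j}) =
    real n ^ card J * (\<Prod>p | prime p \<and> p dvd q. 1 - 1 / real p ^ card J)"
proof -
  have local: "tuple_density J p (\<lambda>v. \<exists>j\<in>J. \<not> p dvd v j) = 1 - 1 / real p ^ card J" if p: "prime p" for p
  proof -
    have p0: "0 < p" using prime_gt_0_nat[OF p] .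
    let ?z = "restrict (\<lambda>_. 0::nat) J"
    have "{v \<in> tuples J p. \<exists>j\<in>J. \<not> p dvd v j} = tuples J p - {?z}"
    proof (intro equalityI subsetI)
      fix v assume v: "v \<in> tuples J p - {?z}"
      have "\<exists>j\<in>J. \<not> p dvd v j"
      proof (rule ccontr)
        assume *: "\<not> (\<exists>j\<in>J. \<not> p dvd v j)"
        have "v = ?z"
        proof (rule PiE_ext[of v J "\<lambda>_. {..<p}"])
          fix j assume j: "j \<in> J"
          then have "v j < p" "p dvd v j" using v * by (auto dest: PiE_mem)
          then show "v j = ?z j" using j by (auto dest: dvd_imp_le)
        next
          show "v \<in> tuples J p" "?z \<in> tuples J p" using v p0 by simp_all
        qed
        then show False using v by simp
      qed
      then show "v \<in> {v \<in> tuples J p. \<exists>j\<in>J. \<not> p dvd v j}" using v by simp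
    qed auto
    moreover have "?z \<in> tuples J p" using p0 by simp
    ultimately have "card {v \<in> tuples J p. \<exists>j\<in>J. \<not> p dvd v j} = p ^ card J - 1"
      using J by (simp add: card_PiE)
    then show ?thesis using p0 by (simp add: tuple_density_def of_nat_diff Suc_le_eq diff_divide_distrib)
  qed
  have "periodic J p (\<lambda>v. \<exists>j\<in>J. \<not> p dvd v j)" for p
    unfolding periodic_def by (simp add: dvd_eq_mod_eq_0)
  from tuple_density_primes[OF J _ n this, of "{p. prime p \<and> p dvd q}"]
  have "tuple_density J n (\<lambda>v. \<forall>p\<in>{p. prime p \<and> p dvd q}. \<exists>j\<in>J. \<not> p dvd v j) =
      (\<Prod>p | prime p \<and> p dvd q. tuple_density J p (\<lambda>v. \<exists>j\<in>J. \<not> p dvd v j))"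
    using q dvd_trans by blast
  also have "\<dots> = (\<Prod>p | prime p \<and> p dvd q. 1 - 1 / real p ^ card J)"
    by (rule prod.cong) (use local in auto)
  finally show ?thesis using n by (simp add: tuple_density_def field_simps)
qed

text \<open>Otherwise every \<open>n i\<close> would divide L/p, against the minimality of the lcm
  L. Consequently e_p is at least 1 for p dividing L, and the truncated subtraction in e_p - 1 is a
  true one.\<close>

lemma prime_dvd_Lcm_div:
  fixes n :: "'i \<Rightarrow> nat"
  assumes I: "finite I" and n: "\<And>i. i \<in> I \<Longrightarrow> 0 < n i" and p: "prime p" "p dvd Lcm (n ` I)"
  shows "\<exists>i\<in>I. \<not> p dvd Lcm (n ` I) div n i"
proof (rule ccontr)
  define L where "L = Lcm (n ` I)"
  assume "\<not> (\<exists>i\<in>I. \<not> p dvd Lcm (n ` I) div n i)"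
  then have *: "p dvd L div n i" if "i \<in> I" for i using that by (simp add: L_def)
  have "0 \<notin> n ` I" using n by force
  then have L: "0 < L" using I by (auto simp: L_def Lcm_0_iff intro!: gr0I)
  have "n i dvd L div p" if i: "i \<in> I" for i
  proof -
    obtain c where "L div n i = p * c" using *[OF i] by blast
    moreover have "L = (L div n i) * n i" using i by (simp add: L_def)
    ultimately have "L = p * (c * n i)" by (simp add: mult.assoc)
    then show ?thesis using prime_gt_0_nat[OF p(1)] by simp
  qed
  then have "L dvd L div p" by (auto simp: L_def intro: Lcm_least)
  moreover have "p \<le> L" using p(2) L by (simp add: L_def dvd_imp_le)
  ultimately have "L \<le> L div p"
    using prime_gt_0_nat[OF p(1)] by (intro dvd_imp_le) (simp_all add: div_greater_zero_iff)
  moreover have "L div p < L" by (rule div_less_dividend[OF prime_gt_1_nat[OF p(1)] L])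
  ultimately show False by simp
qed

text \<open>The \<open>w i\<close> are lifted to residues modulo L. The condition that L divides the
  sum is then traded for divisibility by the radical r of L, at the price of the factor L/r, and
  what remains is a conjunction of conditions at the primes of L.\<close>

lemma card_unit_solutions:
  fixes n :: "'i \<Rightarrow> nat"
  assumes I: "finite I" and n: "\<And>i. i \<in> I \<Longrightarrow> 0 < n i"
  defines "L \<equiv> Lcm (n ` I)"
  shows "real (card {w \<in> PiE I (\<lambda>i. {..<n i}). (\<forall>i\<in>I. coprime (w i) (n i)) \<and>
      L dvd (\<Sum>i\<in>I. (L div n i) * w i)}) =
    (\<Prod>i\<in>I. real (totient (n i))) / real L *
    (\<Prod>p | prime p \<and> p dvd L. 1 + (real p - 1) * (- 1 / (real p - 1)) ^ card {i \<in> I. \<not> p dvd L div n i})"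
proof -
  define d where "d i = L div n i" for i
  define Ps where "Ps = {p. prime p \<and> p dvd L}"
  define r where "r = \<Prod>Ps"
  have "0 \<notin> n ` I" using n by force
  then have L: "0 < L" using I by (auto simp: L_def Lcm_0_iff intro!: gr0I)
  have nL: "n i dvd L" if "i \<in> I" for i using that by (simp add: L_def)
  have dn: "d i * n i = L" if "i \<in> I" for i using nL[OF that] by (simp add: d_def)
  have finPs: "finite Ps" unfolding Ps_def using L by (auto intro!: finite_subset[of _ "{..L}"] dest: dvd_imp_le)
  have primes: "\<And>p. p \<in> Ps \<Longrightarrow> prime p" by (simp add: Ps_def)
  have rL: "r dvd L" unfolding r_def using prod_primes_dvd_iff[OF finPs primes] by (simp add: Ps_def)
  have r: "0 < r" using rL L by (auto intro: gr0I)
  define Co where "Co u \<longleftrightarrow> (\<forall>i\<in>I. coprime (u i) (n i))" for u :: "'i \<Rightarrow> nat"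
  define W where "W = card {w \<in> PiE I (\<lambda>i. {..<n i}). Co w \<and> L dvd (\<Sum>i\<in>I. d i * w i)}"
  define T0 where "T0 = card {u \<in> tuples I L. Co u \<and> L dvd (\<Sum>i\<in>I. d i * u i)}"
  define T1 where "T1 = card {u \<in> tuples I L. Co u \<and> r dvd (\<Sum>i\<in>I. d i * u i)}"
  \<comment> \<open>Each residue modulo \<open>n i\<close> has \<open>d i\<close> lifts modulo L,
    and both conditions see only \<open>u i\<close> modulo \<open>n i\<close>.\<close>
  have T0: "T0 = W * (\<Prod>i\<in>I. d i)"
  proof -
    have Co_mod: "Co u = Co (\<lambda>i. u i mod n i)" for u
      unfolding Co_def by (simp add: coprime_iff_gcd_eq_1 gcd.commute flip: gcd_red_nat)
    have "[(\<Sum>i\<in>I. d i * (u i mod n i)) = (\<Sum>i\<in>I. d i * u i)] (mod L)" for u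
    proof (rule cong_sum)
      fix i assume "i \<in> I"
      then show "[d i * (u i mod n i) = d i * u i] (mod L)"
        using dn by (simp add: cong_def mult_mod_right)
    qed
    then have sum_mod: "L dvd (\<Sum>i\<in>I. d i * u i) \<longleftrightarrow> L dvd (\<Sum>i\<in>I. d i * (u i mod n i))" for u
      by (metis cong_dvd_iff)
    have "{u \<in> tuples I L. Co u \<and> L dvd (\<Sum>i\<in>I. d i * u i)} =
        {u \<in> tuples I L. (Co (\<lambda>i. u i mod n i) \<and> L dvd (\<Sum>i\<in>I. d i * (u i mod n i))) \<and> True}"
      using Co_mod sum_mod by blast
    also have "card \<dots> = card {w \<in> PiE I (\<lambda>i. {..<n i}). Co w \<and> L dvd (\<Sum>i\<in>I. d i * w i)} *
        card {w \<in> PiE I (\<lambda>i. {..<d i}). True}"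
    proof (rule card_PiE_product[of I "\<lambda>i x. (x mod n i, x div n i)" "\<lambda>_. {..<L}" "\<lambda>i. {..<n i}" "\<lambda>i. {..<d i}"
          "\<lambda>w. Co w \<and> L dvd (\<Sum>i\<in>I. d i * w i)" "\<lambda>_. True", unfolded fst_conv snd_conv])
      fix i assume i: "i \<in> I"
      show "bij_betw (\<lambda>x. (x mod n i, x div n i)) {..<L} ({..<n i} \<times> {..<d i})"
        using bij_betw_mod_div[OF n[OF i], of "d i"] dn[OF i] by (simp add: mult.commute)
    next
      fix u w :: "'i \<Rightarrow> nat" assume eq: "\<And>i. i \<in> I \<Longrightarrow> u i = w i"
      have "(\<Sum>i\<in>I. d i * u i) = (\<Sum>i\<in>I. d i * w i)" by (rule sum.cong) (use eq in auto)
      then show "(Co u \<and> L dvd (\<Sum>i\<in>I. d i * u i)) = (Co w \<and> L dvd (\<Sum>i\<in>I. d i * w i))"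
        using eq by (simp add: Co_def)
    qed (rule HOL.refl)
    also have "card {w \<in> PiE I (\<lambda>i. {..<d i}). True} = (\<Prod>i\<in>I. d i)" using I by (simp add: card_PiE)
    finally show ?thesis by (simp add: T0_def W_def)
  qed
  have some: "\<exists>i\<in>I. \<not> p dvd d i" if "prime p" "p dvd L" for p
    using prime_dvd_Lcm_div[OF I n that(1)] that(2) by (simp add: L_def d_def)
  obtain v where "[(\<Sum>i\<in>I. d i * v i) = 1] (mod L)" using exists_unit_combination[OF I L some] by blast
  moreover have Co_iff: "Co u \<longleftrightarrow> (\<forall>p\<in>Ps. \<forall>i\<in>I. p dvd n i \<longrightarrow> \<not> p dvd u i)" for u
  proof -
    have "coprime (u i) (n i) \<longleftrightarrow> (\<forall>p\<in>Ps. p dvd n i \<longrightarrow> \<not> p dvd u i)" if i: "i \<in> I" for i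
      using coprime_iff_primes[OF n[OF i]] dvd_trans[OF _ nL[OF i]] by (auto simp: Ps_def)
    then show ?thesis unfolding Co_def by blast
  qed
  moreover have "periodic I r Co"
    unfolding periodic_def
  proof (intro allI impI)
    fix u w assume eq: "\<forall>i\<in>I. u i mod r = w i mod r"
    have "p dvd u i \<longleftrightarrow> p dvd w i" if "p \<in> Ps" "i \<in> I" for p i
    proof -
      have "p dvd r" unfolding r_def using that(1) finPs by (intro dvd_prodI)
      then show ?thesis using eq that(2) by (metis dvd_eq_mod_eq_0 mod_mod_cancel)
    qed
    then show "Co u = Co w" by (simp add: Co_iff)
  qed
  ultimately have T1: "(L div r) * T0 = T1"
    unfolding T0_def T1_def by (intro card_solutions_lift[OF I L rL]) 
  define e where "e p = card {i \<in> I. \<not> p dvd d i}" for p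
  define E where "E p = 1 + (real p - 1) * (- 1 / (real p - 1)) ^ e p" for p
  define Q where "Q p u \<longleftrightarrow> (\<forall>i\<in>I. p dvd n i \<longrightarrow> \<not> p dvd u i) \<and> p dvd (\<Sum>i\<in>I. d i * u i)" for p u
  have local: "tuple_density I p (Q p) = (\<Prod>i\<in>I. if p dvd n i then 1 - 1 / real p else 1) * E p / real p"
    if p: "p \<in> Ps" for p
  proof -
    have pp: "prime p" using p primes by blast
    have p0: "0 < p" using prime_gt_0_nat[OF pp] .
    define A where "A i = (if p dvd n i then {1..<p} else {..<p})" for i
    have "{u \<in> tuples I p. Q p u} = {u \<in> PiE I A. p dvd (\<Sum>i\<in>I. d i * u i)}"
    proof -
      have "u \<in> PiE I A \<longleftrightarrow> u \<in> tuples I p \<and> (\<forall>i\<in>I. p dvd n i \<longrightarrow> \<not> p dvd u i)" for u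
      proof -
        have "x \<in> A i \<longleftrightarrow> x < p \<and> (p dvd n i \<longrightarrow> \<not> p dvd x)" for x i
          using p0 by (auto simp: A_def Suc_le_eq intro: gr0I dest: dvd_imp_le)
        then show ?thesis by (auto simp: PiE_iff)
      qed
      then show ?thesis by (auto simp: Q_def)
    qed
    \<comment> \<open>Since the product of \<open>d i\<close> and \<open>n i\<close> is L, a prime
      of L that does not divide \<open>d i\<close> divides \<open>n i\<close>; so a variable that
      really enters the sum modulo p is confined to units.\<close>
    moreover have "A i = {1..<p}" if "i \<in> I" "\<not> p dvd d i" for i
    proof -
      have "p dvd d i * n i" using dn[OF that(1)] p by (simp add: Ps_def)
      then show ?thesis using that(2) pp by (simp add: A_def prime_dvd_mult_iff)
    qed
    ultimately have "real (card {u \<in> tuples I p. Q p u}) = (\<Prod>i\<in>I. real (card (A i))) * E p / real p"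
      using card_local_solutions[OF I pp, of A d] by (simp add: A_def E_def e_def)
    then have "tuple_density I p (Q p) = (\<Prod>i\<in>I. real (card (A i))) / real p ^ card I * (E p / real p)"
      by (simp add: tuple_density_def)
    also have "(\<Prod>i\<in>I. real (card (A i))) / real p ^ card I = (\<Prod>i\<in>I. real (card (A i)) / real p)"
      by (simp add: prod_dividef)
    also have "\<dots> = (\<Prod>i\<in>I. if p dvd n i then 1 - 1 / real p else 1)"
      using p0 by (intro prod.cong) (auto simp: A_def of_nat_diff field_simps)
    finally show ?thesis by simp
  qed
  have per: "periodic I p (Q p)" for p
    unfolding periodic_def
  proof (intro allI impI)
    fix u w assume eq: "\<forall>i\<in>I. u i mod p = w i mod p"
    have "[(\<Sum>i\<in>I. d i * u i) = (\<Sum>i\<in>I. d i * w i)] (mod p)"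
      by (intro cong_sum cong_mult cong_refl) (use eq in \<open>simp add: cong_def\<close>)
    then show "Q p u = Q p w" using eq by (simp add: Q_def cong_def dvd_eq_mod_eq_0)
  qed
  have "{u \<in> tuples I L. Co u \<and> r dvd (\<Sum>i\<in>I. d i * u i)} =
      {u \<in> tuples I L. \<forall>p\<in>Ps. Q p u}"
    using prod_primes_dvd_iff[OF finPs primes] by (auto simp: Co_iff Q_def r_def)
  then have "real T1 = real L ^ card I * tuple_density I L (\<lambda>u. \<forall>p\<in>Ps. Q p u)"
    using L by (simp add: T1_def tuple_density_def)
  also have "tuple_density I L (\<lambda>u. \<forall>p\<in>Ps. Q p u) = (\<Prod>p\<in>Ps. tuple_density I p (Q p))"
    by (rule tuple_density_primes[OF I _ L per]) (simp add: Ps_def)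
  also have "\<dots> = (\<Prod>p\<in>Ps. (\<Prod>i\<in>I. if p dvd n i then 1 - 1 / real p else 1) * E p / real p)"
    by (rule prod.cong) (use local in auto)
  also have "\<dots> = (\<Prod>i\<in>I. \<Prod>p\<in>Ps. if p dvd n i then 1 - 1 / real p else 1) * (\<Prod>p\<in>Ps. E p) / real r"
    by (simp add: prod_dividef prod.distrib prod.swap[of _ I Ps] r_def)
  finally have T1': "real T1 = real L ^ card I *
      ((\<Prod>i\<in>I. \<Prod>p\<in>Ps. if p dvd n i then 1 - 1 / real p else 1) * (\<Prod>p\<in>Ps. E p) / real r)" .
  \<comment> \<open>Euler's product for the totient, written over all primes of L with factor 1 at
    those not dividing \<open>n i\<close>.\<close>
  have tot: "real (n i) * (\<Prod>p\<in>Ps. if p dvd n i then 1 - 1 / real p else 1) = real (totient (n i))"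
    if i: "i \<in> I" for i
  proof -
    have "prime_factors (n i) = {p \<in> Ps. p dvd n i}"
      using n[OF i] nL[OF i] by (auto simp: Ps_def prime_factors_dvd intro: dvd_trans)
    moreover have "(\<Prod>p\<in>Ps. if p dvd n i then 1 - 1 / real p else 1) = (\<Prod>p\<in>{p \<in> Ps. p dvd n i}. 1 - 1 / real p)"
      by (rule prod.inter_filter[OF finPs, symmetric])
    ultimately show ?thesis by (simp add: totient_formula2)
  qed
  have "0 < d i" if "i \<in> I" for i using dn[OF that] L by (metis gr0I less_irrefl mult_0)
  then have D: "real (\<Prod>i\<in>I. d i) > 0" by (simp add: prod_pos)
  have LD: "real L ^ card I = real (\<Prod>i\<in>I. d i) * (\<Prod>i\<in>I. real (n i))"
  proof -
    have "(\<Prod>i\<in>I. real (d i) * real (n i)) = (\<Prod>i\<in>I. real L)"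
      by (rule prod.cong) (simp_all add: dn flip: of_nat_mult)
    then show ?thesis by (simp add: prod.distrib)
  qed
  have "real L / real r * (real W * real (\<Prod>i\<in>I. d i)) = real T1"
    using T1 T0 rL by (metis of_nat_mult real_of_nat_div)
  also have "\<dots> = real (\<Prod>i\<in>I. d i) * (\<Prod>i\<in>I. real (totient (n i))) * (\<Prod>p\<in>Ps. E p) / real r"
  proof -
    have "(\<Prod>i\<in>I. real (n i)) * (\<Prod>i\<in>I. \<Prod>p\<in>Ps. if p dvd n i then 1 - 1 / real p else 1) = (\<Prod>i\<in>I. real (totient (n i)))"
      unfolding prod.distrib[symmetric] by (rule prod.cong) (use tot in auto)
    then show ?thesis unfolding T1' LD by (metis (no_types, lifting) mult.assoc times_divide_eq_right)
  qed
  finally have "real W = (\<Prod>i\<in>I. real (totient (n i))) / real L * (\<Prod>p\<in>Ps. E p)"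
    using D r L by (simp add: field_simps)
  then show ?thesis by (simp add: W_def Co_def Ps_def E_def e_def d_def)
qed

text \<open>The elements of exact order n in the integers modulo N are the multiples of N/n by units
  modulo n. The dummy factor \<open>{()}\<close> gives the bijection the product form expected by
  \<open>card_PiE_product\<close>.\<close>

lemma bij_betw_exact_order:
  fixes n N :: nat
  assumes "n dvd N" "0 < N"
  shows "bij_betw (\<lambda>v. (v div (N div n), ())) {v. v < N \<and> (\<forall>m. N dvd m * v \<longleftrightarrow> n dvd m)}
    ({w. w < n \<and> coprime w n} \<times> {()})"
proof -
  define c where "c = N div n"
  have N: "N = c * n" using assms by (simp add: c_def)
  have pos: "0 < c" "0 < n" using assms(2) N by (auto intro: gr0I)
  have iff: "(\<forall>m. N dvd m * (c * w) \<longleftrightarrow> n dvd m) \<longleftrightarrow> coprime w n" for w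
  proof -
    have "N dvd m * (c * w) \<longleftrightarrow> n dvd m * w" for m
      using pos by (simp add: N mult.left_commute)
    moreover have "(\<forall>m. n dvd m * w \<longleftrightarrow> n dvd m) \<longleftrightarrow> coprime w n"
    proof
      assume *: "\<forall>m. n dvd m * w \<longleftrightarrow> n dvd m"
      define h where "h = gcd w n"
      obtain a b where a: "w = h * a" "n = h * b" using gcd_dvd1[of w n] gcd_dvd2[of w n] by (metis h_def dvdE)
      have "n dvd b * w" using a by (simp add: mult.left_commute)
      then have "n dvd b" using * by blast
      then have "h dvd 1" using a pos by (simp add: mult.commute)
      then show "coprime w n" by (simp add: coprime_iff_gcd_eq_1 h_def)
    qed (simp add: coprime_dvd_mult_left_iff coprime_commute)
    ultimately show ?thesis by simp
  qed
  show ?thesis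
    unfolding c_def[symmetric]
  proof (rule bij_betw_byWitness[where f' = "\<lambda>(w, _). c * w"])
    have mult: "\<exists>w. v = c * w" if "\<forall>m. N dvd m * v \<longleftrightarrow> n dvd m" for v
    proof -
      have "N dvd n * v" using that[THEN spec, of n] by simp
      then have "c dvd v" using pos by (simp add: N mult.commute)
      then show ?thesis by blast
    qed
    show "\<forall>v\<in>{v. v < N \<and> (\<forall>m. N dvd m * v \<longleftrightarrow> n dvd m)}. (\<lambda>(w, _). c * w) (v div c, ()) = v"
      using mult pos by fastforce
    show "\<forall>z\<in>{w. w < n \<and> coprime w n} \<times> {()}. (((\<lambda>(w, _). c * w) z) div c, ()) = z"
      using pos by auto
    show "(\<lambda>v. (v div c, ())) ` {v. v < N \<and> (\<forall>m. N dvd m * v \<longleftrightarrow> n dvd m)} \<subseteq> {w. w < n \<and> coprime w n} \<times> {()}"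
    proof (rule image_subsetI)
      fix v assume v: "v \<in> {v. v < N \<and> (\<forall>m. N dvd m * v \<longleftrightarrow> n dvd m)}"
      then obtain w where w: "v = c * w" using mult by blast
      have "w < n" using v pos by (simp add: w N)
      moreover have "coprime w n" using v iff[of w] by (simp add: w)
      ultimately show "(v div c, ()) \<in> {w. w < n \<and> coprime w n} \<times> {()}" using pos by (simp add: w)
    qed
    show "(\<lambda>(w, _). c * w) ` ({w. w < n \<and> coprime w n} \<times> {()}) \<subseteq> {v. v < N \<and> (\<forall>m. N dvd m * v \<longleftrightarrow> n dvd m)}"
    proof (rule image_subsetI)
      fix z assume "z \<in> {w. w < n \<and> coprime w n} \<times> {()}"
      then obtain w where w: "z = (w, ())" "w < n" "coprime w n" by auto
      have "c * w < N" using w pos by (simp add: N)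
      then show "(\<lambda>(w, _). c * w) z \<in> {v. v < N \<and> (\<forall>m. N dvd m * v \<longleftrightarrow> n dvd m)}"
        using iff[of w] w by simp
    qed
  qed
qed

text \<open>With v_i = (N/n_i) w_i = (N/L) (L/n_i) w_i the common factor N/L cancels from the
  condition on the sum.\<close>

lemma card_exact_order_tuples:
  fixes n :: "'i \<Rightarrow> nat" and N :: nat
  assumes I: "finite I" and n: "\<And>i. i \<in> I \<Longrightarrow> 0 < n i" and N: "Lcm (n ` I) dvd N" "0 < N"
  defines "L \<equiv> Lcm (n ` I)"
  shows "card {v \<in> tuples I N. (\<forall>i\<in>I. \<forall>m. N dvd m * v i \<longleftrightarrow> n i dvd m) \<and> N dvd (\<Sum>i\<in>I. v i)} =
    card {w \<in> PiE I (\<lambda>i. {..<n i}). (\<forall>i\<in>I. coprime (w i) (n i)) \<and> L dvd (\<Sum>i\<in>I. (L div n i) * w i)}"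
proof -
  define A where "A i = {v. v < N \<and> (\<forall>m. N dvd m * v \<longleftrightarrow> n i dvd m)}" for i
  define B where "B i = {w. w < n i \<and> coprime w (n i)}" for i
  have nL: "n i dvd L" if "i \<in> I" for i using that by (simp add: L_def)
  have nN: "n i dvd N" if "i \<in> I" for i using nL[OF that] N(1) by (auto simp: L_def intro: dvd_trans)
  have Lpos: "0 < L" using N by (auto simp: L_def intro: gr0I)
  have LN: "L dvd N" using N(1) by (simp add: L_def)
  have eq: "N dvd (\<Sum>i\<in>I. v i) \<longleftrightarrow> L dvd (\<Sum>i\<in>I. (L div n i) * (v i div (N div n i)))"
    if v: "v \<in> PiE I A" for v
  proof -
    have "v i = (N div L) * ((L div n i) * (v i div (N div n i)))" if i: "i \<in> I" for i
    proof -
      have "v i \<in> A i" using v i by (rule PiE_mem)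
      then have "N dvd n i * v i" by (simp add: A_def)
      then have "n i * (N div n i) dvd n i * v i" using nN[OF i] by simp
      then have "N div n i dvd v i" using n[OF i] by simp
      then have "v i = (N div n i) * (v i div (N div n i))" by simp
      moreover have "N div n i = (N div L) * (L div n i)"
        using LN nL[OF i] by (metis div_mult_swap dvd_div_mult_self)
      ultimately show ?thesis by (metis mult.assoc)
    qed
    then have "(\<Sum>i\<in>I. v i) = (\<Sum>i\<in>I. (N div L) * ((L div n i) * (v i div (N div n i))))"
      by (rule sum.cong[OF HOL.refl])
    also have "\<dots> = (N div L) * (\<Sum>i\<in>I. (L div n i) * (v i div (N div n i)))"
      by (rule sum_distrib_left[symmetric])
    finally have *: "(\<Sum>i\<in>I. v i) = (N div L) * (\<Sum>i\<in>I. (L div n i) * (v i div (N div n i)))" .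
    have pos: "0 < N div L" using LN N(2) Lpos by (simp add: div_greater_zero_iff dvd_imp_le)
    have "N dvd (N div L) * s \<longleftrightarrow> (N div L) * L dvd (N div L) * s" for s using LN by simp
    then show ?thesis unfolding * using pos by simp
  qed
  have "{v \<in> tuples I N. (\<forall>i\<in>I. \<forall>m. N dvd m * v i \<longleftrightarrow> n i dvd m) \<and> N dvd (\<Sum>i\<in>I. v i)} =
      {v \<in> PiE I A. N dvd (\<Sum>i\<in>I. v i)}"
    by (auto simp: PiE_iff A_def)
  also have "\<dots> = {v \<in> PiE I A. L dvd (\<Sum>i\<in>I. (L div n i) * (v i div (N div n i))) \<and> True}"
    using eq by auto
  also have "card \<dots> = card {w \<in> PiE I B. L dvd (\<Sum>i\<in>I. (L div n i) * w i)} * card {w \<in> PiE I (\<lambda>_. {()}). True}"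
  proof (rule card_PiE_product[of I "\<lambda>i v. (v div (N div n i), ())" A B "\<lambda>_. {()}"
        "\<lambda>w. L dvd (\<Sum>i\<in>I. (L div n i) * w i)" "\<lambda>_. True", unfolded fst_conv snd_conv])
    fix i assume "i \<in> I"
    then show "bij_betw (\<lambda>v. (v div (N div n i), ())) (A i) (B i \<times> {()})"
      unfolding A_def B_def by (intro bij_betw_exact_order nN N(2))
  next
    fix u w :: "'i \<Rightarrow> nat" assume eq: "\<And>i. i \<in> I \<Longrightarrow> u i = w i"
    have "(\<Sum>i\<in>I. (L div n i) * u i) = (\<Sum>i\<in>I. (L div n i) * w i)" by (rule sum.cong) (use eq in auto)
    then show "(L dvd (\<Sum>i\<in>I. (L div n i) * u i)) = (L dvd (\<Sum>i\<in>I. (L div n i) * w i))" by simp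
  qed (rule HOL.refl)
  also have "card {w \<in> PiE I (\<lambda>_. {()}). True} = 1" using I by (simp add: card_PiE)
  also have "{w \<in> PiE I B. L dvd (\<Sum>i\<in>I. (L div n i) * w i)} =
      {w \<in> PiE I (\<lambda>i. {..<n i}). (\<forall>i\<in>I. coprime (w i) (n i)) \<and> L dvd (\<Sum>i\<in>I. (L div n i) * w i)}"
    by (auto simp: PiE_iff B_def)
  finally show ?thesis by simp
qed

text \<open>Elements of exact orders n_i generate the subgroup of order L, which consists of the
  multiples of N/L. So the primes dividing N and all values on I are those of N/L, and only the
  values on J can remove them.\<close>

lemma generating_iff_unimodular:
  fixes n :: "'i \<Rightarrow> nat" and N :: nat
  assumes N: "Lcm (n ` I) dvd N" "0 < N"
    and ord: "\<And>i m. i \<in> I \<Longrightarrow> N dvd m * v i \<longleftrightarrow> n i dvd m"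
  shows "(\<forall>d. d dvd N \<and> (\<forall>s\<in>J \<union> I. d dvd v s) \<longrightarrow> d = 1) \<longleftrightarrow>
    (\<forall>p\<in>{p. prime p \<and> p dvd N div Lcm (n ` I)}. \<exists>j\<in>J. \<not> p dvd v j)"
proof -
  define L where "L = Lcm (n ` I)"
  have LN: "L dvd N" using N(1) by (simp add: L_def)
  have key: "p dvd N div L \<longleftrightarrow> p dvd N \<and> (\<forall>i\<in>I. p dvd v i)" if p: "prime p" for p
  proof
    assume "p dvd N div L"
    then obtain c where "N div L = p * c" by blast
    then have Nc: "N = p * (c * L)" using LN by (metis dvd_div_mult_self mult.assoc)
    have p0: "0 < p" using prime_gt_0_nat[OF p] .
    have "p dvd v i" if i: "i \<in> I" for i
    proof -
      have "n i dvd c * L" using i by (simp add: L_def)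
      then have "N dvd (c * L) * v i" using ord[OF i] by blast
      moreover have "c * L \<noteq> 0" using N(2) Nc by (metis less_irrefl mult_0_right)
      moreover have "N = (c * L) * p" by (simp add: Nc)
      ultimately show ?thesis by simp
    qed
    then show "p dvd N \<and> (\<forall>i\<in>I. p dvd v i)" using Nc by simp
  next
    assume *: "p dvd N \<and> (\<forall>i\<in>I. p dvd v i)"
    then obtain c where c: "N = p * c" by blast
    have "n i dvd c" if i: "i \<in> I" for i
    proof -
      have "p dvd v i" using * i by blast
      then have "N dvd c * v i" unfolding c by (metis mult.commute mult_dvd_mono dvd_refl)
      then show ?thesis using ord[OF i] by blast
    qed
    then have "L dvd c" by (auto simp: L_def intro: Lcm_least)
    then obtain e where "c = L * e" by blast
    then show "p dvd N div L" using c N(2) by simp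
  qed
  show ?thesis
    unfolding L_def[symmetric]
  proof
    assume *: "\<forall>d. d dvd N \<and> (\<forall>s\<in>J \<union> I. d dvd v s) \<longrightarrow> d = 1"
    show "\<forall>p\<in>{p. prime p \<and> p dvd N div L}. \<exists>j\<in>J. \<not> p dvd v j"
    proof (rule ccontr)
      assume "\<not> (\<forall>p\<in>{p. prime p \<and> p dvd N div L}. \<exists>j\<in>J. \<not> p dvd v j)"
      then obtain p where p: "prime p" "p dvd N div L" "\<forall>j\<in>J. p dvd v j" by blast
      then have "p dvd N \<and> (\<forall>s\<in>J \<union> I. p dvd v s)" using key[OF p(1)] by blast
      then have "p = 1" using * by blast
      then show False using p(1) by simp
    qed
  next
    assume *: "\<forall>p\<in>{p. prime p \<and> p dvd N div L}. \<exists>j\<in>J. \<not> p dvd v j"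
    show "\<forall>d. d dvd N \<and> (\<forall>s\<in>J \<union> I. d dvd v s) \<longrightarrow> d = 1"
    proof (intro allI impI, rule ccontr)
      fix d assume d: "d dvd N \<and> (\<forall>s\<in>J \<union> I. d dvd v s)" and "d \<noteq> 1"
      then obtain p where p: "prime p" "p dvd d" using prime_factor_nat by blast
      then have "p dvd N" "\<forall>s\<in>J \<union> I. p dvd v s" using d dvd_trans by blast+
      then have "p dvd N div L" "\<forall>j\<in>J. p dvd v j" using key[OF p(1)] by auto
      then show False using * p(1) by blast
    qed
  qed
qed

lemma card_PiE_disjoint_union:
  assumes "J \<inter> I = {}"
    and P: "\<And>u w. (\<And>j. j \<in> J \<Longrightarrow> u j = w j) \<Longrightarrow> P u = P w"
    and Q: "\<And>u w. (\<And>i. i \<in> I \<Longrightarrow> u i = w i) \<Longrightarrow> Q u = Q w"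
  shows "card {v \<in> PiE (J \<union> I) (\<lambda>_. A). P v \<and> Q v} =
    card {v \<in> PiE J (\<lambda>_. A). P v} * card {v \<in> PiE I (\<lambda>_. A). Q v}"
proof -
  let ?f = "\<lambda>v. (restrict v J, restrict v I)" and ?f' = "\<lambda>(u, w) i. if i \<in> J then u i else w i"
  let ?X = "{v \<in> PiE (J \<union> I) (\<lambda>_. A). P v \<and> Q v}"
  let ?Y = "{v \<in> PiE J (\<lambda>_. A). P v} \<times> {v \<in> PiE I (\<lambda>_. A). Q v}"
  have PQ: "P (restrict v J) = P v" "Q (restrict v I) = Q v" for v
    by (rule P, simp, rule Q, simp)
  have "bij_betw ?f ?X ?Y"
  proof (rule bij_betw_byWitness[where f' = ?f'])
    show "\<forall>v\<in>?X. ?f' (?f v) = v"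
      by (auto simp: fun_eq_iff PiE_iff extensional_def)
    show "\<forall>z\<in>?Y. ?f (?f' z) = z"
      using assms(1) by (auto simp: fun_eq_iff PiE_iff extensional_def)
    show "?f ` ?X \<subseteq> ?Y" using PQ by (auto simp: PiE_iff)
    show "?f' ` ?Y \<subseteq> ?X"
    proof (rule image_subsetI)
      fix z assume "z \<in> ?Y"
      then obtain u w where z: "z = (u, w)" "u \<in> PiE J (\<lambda>_. A)" "P u" "w \<in> PiE I (\<lambda>_. A)" "Q w" by auto
      have "P (?f' z) = P u" by (rule P) (simp add: z(1))
      moreover have "Q (?f' z) = Q w" by (rule Q) (use assms(1) in \<open>auto simp: z(1)\<close>)
      ultimately show "?f' z \<in> ?X" using z by (auto simp: PiE_iff extensional_def)
    qed
  qed
  then show ?thesis by (simp add: bij_betw_same_card card_cartesian_product)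
qed

lemma card_surface_kernel_values:
  fixes n :: "'i \<Rightarrow> nat" and N :: nat
  assumes I: "finite I" and J: "finite J" and JI: "J \<inter> I = {}"
    and n: "\<And>i. i \<in> I \<Longrightarrow> 0 < n i" and N: "Lcm (n ` I) dvd N" "0 < N"
  defines "L \<equiv> Lcm (n ` I)"
  shows "real (card {v \<in> tuples (J \<union> I) N. (\<forall>i\<in>I. \<forall>m. N dvd m * v i \<longleftrightarrow> n i dvd m) \<and>
      N dvd (\<Sum>i\<in>I. v i) \<and> (\<forall>d. d dvd N \<and> (\<forall>s\<in>J \<union> I. d dvd v s) \<longrightarrow> d = 1)}) =
    real N ^ card J / real L * (\<Prod>i\<in>I. real (totient (n i))) *
    (\<Prod>p | prime p \<and> p dvd N div L. 1 - 1 / real p ^ card J) *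
    (\<Prod>p | prime p \<and> p dvd L. 1 - (- 1) ^ (card {i \<in> I. \<not> p dvd L div n i} - 1)
      / (real p - 1) ^ (card {i \<in> I. \<not> p dvd L div n i} - 1))"
proof -
  define P where "P v \<longleftrightarrow> (\<forall>p\<in>{p. prime p \<and> p dvd N div L}. \<exists>j\<in>J. \<not> p dvd v j)" for v :: "'i \<Rightarrow> nat"
  define Q where "Q v \<longleftrightarrow> (\<forall>i\<in>I. \<forall>m. N dvd m * v i \<longleftrightarrow> n i dvd m) \<and> N dvd (\<Sum>i\<in>I. v i)" for v
  have L: "0 < L" using N by (auto simp: L_def intro: gr0I)
  have "{v \<in> tuples (J \<union> I) N. (\<forall>i\<in>I. \<forall>m. N dvd m * v i \<longleftrightarrow> n i dvd m) \<and>
      N dvd (\<Sum>i\<in>I. v i) \<and> (\<forall>d. d dvd N \<and> (\<forall>s\<in>J \<union> I. d dvd v s) \<longrightarrow> d = 1)} =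
      {v \<in> tuples (J \<union> I) N. P v \<and> Q v}"
    using generating_iff_unimodular[OF N, where J = J] unfolding P_def Q_def L_def by blast
  also have "card \<dots> = card {v \<in> tuples J N. P v} * card {v \<in> tuples I N. Q v}"
  proof (rule card_PiE_disjoint_union[OF JI])
    fix u w :: "'i \<Rightarrow> nat" assume "\<And>j. j \<in> J \<Longrightarrow> u j = w j"
    then show "P u = P w" by (simp add: P_def)
  next
    fix u w :: "'i \<Rightarrow> nat" assume eq: "\<And>i. i \<in> I \<Longrightarrow> u i = w i"
    have "(\<Sum>i\<in>I. u i) = (\<Sum>i\<in>I. w i)" by (rule sum.cong) (use eq in auto)
    then show "Q u = Q w" using eq by (simp add: Q_def)
  qed
  finally have "real (card {v \<in> tuples (J \<union> I) N. (\<forall>i\<in>I. \<forall>m. N dvd m * v i \<longleftrightarrow> n i dvd m) \<and>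
      N dvd (\<Sum>i\<in>I. v i) \<and> (\<forall>d. d dvd N \<and> (\<forall>s\<in>J \<union> I. d dvd v s) \<longrightarrow> d = 1)}) =
      real (card {v \<in> tuples J N. P v}) * real (card {v \<in> tuples I N. Q v})" by simp
  also have "real (card {v \<in> tuples J N. P v}) =
      real N ^ card J * (\<Prod>p | prime p \<and> p dvd N div L. 1 - 1 / real p ^ card J)"
    unfolding P_def by (rule card_unimodular_tuples[OF J N(2)]) (metis L_def N(1) dvd_div_mult_self dvd_triv_left)
  also have "real (card {v \<in> tuples I N. Q v}) = (\<Prod>i\<in>I. real (totient (n i))) / real L *
      (\<Prod>p | prime p \<and> p dvd L. 1 + (real p - 1) * (- 1 / (real p - 1)) ^ card {i \<in> I. \<not> p dvd L div n i})"
  proof -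
    have "card {v \<in> tuples I N. Q v} = card {w \<in> PiE I (\<lambda>i. {..<n i}).
        (\<forall>i\<in>I. coprime (w i) (n i)) \<and> L dvd (\<Sum>i\<in>I. (L div n i) * w i)}"
      unfolding Q_def L_def by (rule card_exact_order_tuples[OF I n N])
    then show ?thesis unfolding L_def using card_unit_solutions[OF I n] by simp
  qed
  also have "(\<Prod>p | prime p \<and> p dvd L. 1 + (real p - 1) * (- 1 / (real p - 1)) ^ card {i \<in> I. \<not> p dvd L div n i}) =
      (\<Prod>p | prime p \<and> p dvd L. 1 - (- 1) ^ (card {i \<in> I. \<not> p dvd L div n i} - 1)
        / (real p - 1) ^ (card {i \<in> I. \<not> p dvd L div n i} - 1))"
  proof (rule prod.cong)
    fix p assume "p \<in> {p. prime p \<and> p dvd L}"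
    then have p: "prime p" "p dvd L" by auto
    have "\<exists>i\<in>I. \<not> p dvd L div n i"
      unfolding L_def by (rule prime_dvd_Lcm_div[OF I n p(1) p(2)[unfolded L_def]])
    then have "card {i \<in> I. \<not> p dvd L div n i} \<noteq> 0" using I by auto
    then obtain e where e: "card {i \<in> I. \<not> p dvd L div n i} = Suc e" using not0_implies_Suc by blast
    have "real p - 1 \<noteq> 0" using prime_gt_1_nat[OF p(1)] by simp
    \<comment> \<open>The factor p - 1 absorbs one power, which turns the exponent e_p into e_p - 1
      and the sign into a minus.\<close>
    then have "1 + (real p - 1) * (- 1 / (real p - 1)) ^ Suc e = 1 - (- 1 / (real p - 1)) ^ e" by simp
    then show "1 + (real p - 1) * (- 1 / (real p - 1)) ^ card {i \<in> I. \<not> p dvd L div n i} =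
        1 - (- 1) ^ (card {i \<in> I. \<not> p dvd L div n i} - 1) / (real p - 1) ^ (card {i \<in> I. \<not> p dvd L div n i} - 1)"
      unfolding e by (simp only: power_divide diff_Suc_1)
  qed (rule HOL.refl)
  finally show ?thesis by simp
qed

section \<open>Surface-kernel epimorphisms onto cyclic groups\<close>

lemma word_eval_integer_mod_group:
  assumes n: "0 < n" and v: "v \<in> S \<rightarrow> carrier (integer_mod_group n)" and w: "w \<in> words S"
  shows "word_eval (integer_mod_group n) v w =
    (\<Sum>l\<leftarrow>w. if snd l then v (fst l) else - v (fst l)) mod int n"
  using w
proof (induction w)
  case (Cons l w)
  then have "v (fst l) \<in> carrier (integer_mod_group n)" using v by auto
  with Cons show ?case by (simp add: mod_add_left_eq mod_add_right_eq)
qed simp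

text \<open>The target is abelian, so the commutators contribute 0 and only the elliptic generators
  remain.\<close>

lemma word_eval_long_relator:
  assumes n: "0 < n" and v: "v \<in> fuchsian_gens g ns \<rightarrow> carrier (integer_mod_group n)"
  shows "word_eval (integer_mod_group n) v (long_relator g ns) = (\<Sum>i<length ns. v (GenX i)) mod int n"
proof -
  have "(\<Sum>l\<leftarrow>concat (map (\<lambda>i. [(GenA i, False), (GenB i, False), (GenA i, True), (GenB i, True)]) is).
      if snd l then v (fst l) else - v (fst l)) = 0" for "is"
    by (induction "is") auto
  moreover have "(\<Sum>l\<leftarrow>map (\<lambda>i. (GenX i, True)) [0..<length ns]. if snd l then v (fst l) else - v (fst l)) =
      (\<Sum>i<length ns. v (GenX i))"
    by (simp add: comp_def interv_sum_list_conv_sum_set_nat atLeast0LessThan)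
  ultimately show ?thesis
    unfolding word_eval_integer_mod_group[OF n v long_relator_words] by (simp add: long_relator_def)
qed

section \<open>Homomorphisms out of a Fuchsian presentation\<close>

context fuchsian_presentation
begin

lemma f_carrier: "s \<in> gens \<Longrightarrow> f s \<in> carrier G"
  using f_closed by auto

lemma hom_eqI:
  assumes "group H" "\<phi> \<in> hom G H" "\<psi> \<in> hom G H"
    and eq: "\<And>s. s \<in> gens \<Longrightarrow> \<phi> (f s) = \<psi> (f s)" and \<gamma>: "\<gamma> \<in> carrier G"
  shows "\<phi> \<gamma> = \<psi> \<gamma>"
proof -
  obtain w where w: "w \<in> words gens" "\<gamma> = word_eval G f w" using generated[OF \<gamma>] by blast
  have "word_eval H (\<lambda>s. \<phi> (f s)) w = word_eval H (\<lambda>s. \<psi> (f s)) w"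
    using w(1)
  proof (induction w)
    case (Cons l w)
    then have "\<phi> (f (fst l)) = \<psi> (f (fst l))" by (intro eq) simp
    with Cons show ?case by simp
  qed simp
  then show ?thesis
    using word_eval_hom[OF is_group assms(1,2) f_closed w(1)] word_eval_hom[OF is_group assms(1,3) f_closed w(1)]
    by (simp add: w(2))
qed

text \<open>The universal property of the presentation. The value is computed from a chosen word,
  and \<open>presented\<close> makes it independent of the choice.\<close>

lemma hom_exists:
  assumes H: "group H" and v: "v \<in> gens \<rightarrow> carrier H"
    and rel: "\<And>r. r \<in> fuchsian_relators g ns \<Longrightarrow> word_eval H v r = \<one>\<^bsub>H\<^esub>"
  obtains \<phi> where "\<phi> \<in> hom G H" "\<And>s. s \<in> gens \<Longrightarrow> \<phi> (f s) = v s"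
proof -
  interpret H: group H by fact
  define W where "W \<gamma> = (SOME w. w \<in> words gens \<and> \<gamma> = word_eval G f w)" for \<gamma>
  have W: "W \<gamma> \<in> words gens \<and> \<gamma> = word_eval G f (W \<gamma>)" if "\<gamma> \<in> carrier G" for \<gamma>
    unfolding W_def by (rule someI_ex) (use generated[OF that] in blast)
  define \<phi> where "\<phi> \<gamma> = word_eval H v (W \<gamma>)" for \<gamma>
  have \<phi>: "\<phi> (word_eval G f w) = word_eval H v w" if w: "w \<in> words gens" for w
  proof -
    have c: "word_eval G f w \<in> carrier G" using word_eval_closed[OF f_closed w] .
    have "pres_eq gens (fuchsian_relators g ns) (W (word_eval G f w)) w"
      by (rule presented) (use W[OF c] w in auto)
    note * = H.word_eval_respects[OF v _ this]
    show ?thesis unfolding \<phi>_def by (rule *) (rule rel)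
  qed
  have "\<phi> \<in> hom G H"
  proof (rule homI)
    fix \<gamma> assume "\<gamma> \<in> carrier G"
    then show "\<phi> \<gamma> \<in> carrier H" unfolding \<phi>_def using W H.word_eval_closed[OF v] by blast
  next
    fix \<gamma> \<delta> assume "\<gamma> \<in> carrier G" "\<delta> \<in> carrier G"
    then obtain u w where uw: "u \<in> words gens" "\<gamma> = word_eval G f u"
      "w \<in> words gens" "\<delta> = word_eval G f w" using generated by meson
    have "\<gamma> \<otimes> \<delta> = word_eval G f (u @ w)" using uw by (simp add: word_eval_append[OF f_closed])
    then show "\<phi> (\<gamma> \<otimes> \<delta>) = \<phi> \<gamma> \<otimes>\<^bsub>H\<^esub> \<phi> \<delta>" using uw by (simp add: \<phi> H.word_eval_append[OF v])
  qed
  moreover have "\<phi> (f s) = v s" if s: "s \<in> gens" for s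
  proof -
    have "v s \<in> carrier H" using v s by auto
    then show ?thesis using \<phi>[of "[(s, True)]"] f_carrier[OF s] s by simp
  qed
  ultimately show ?thesis using that by blast
qed

text \<open>The image consists of the multiples of the gcd of n and the generator values, taken as
  natural representatives.\<close>

lemma cyclic_hom_surjective_iff:
  assumes n: "0 < n" and \<phi>: "\<phi> \<in> hom G (integer_mod_group n)"
  shows "\<phi> ` carrier G = carrier (integer_mod_group n) \<longleftrightarrow>
    (\<forall>d. d dvd n \<and> (\<forall>s\<in>gens. d dvd nat (\<phi> (f s))) \<longrightarrow> d = 1)"
proof -
  let ?S = "gens"
  let ?v = "\<lambda>s. nat (\<phi> (f s))"
  interpret \<phi>: group_hom G "integer_mod_group n" \<phi>
    using \<phi> by (simp add: group_hom_def group_hom_axioms_def is_group)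
  have range: "0 \<le> \<phi> \<gamma> \<and> \<phi> \<gamma> < int n" if "\<gamma> \<in> carrier G" for \<gamma>
    using \<phi>.hom_closed[OF that] n by (simp add: carrier_integer_mod_group)
  have vS: "(\<lambda>s. \<phi> (f s)) \<in> ?S \<rightarrow> carrier (integer_mod_group n)"
    using f_carrier \<phi>.hom_closed by auto
  have finS: "finite ?S" by (simp add: fuchsian_gens_def)
  show ?thesis
  proof
    assume surj: "\<phi> ` carrier G = carrier (integer_mod_group n)"
    show "\<forall>d. d dvd n \<and> (\<forall>s\<in>?S. d dvd ?v s) \<longrightarrow> d = 1"
    proof (intro allI impI)
      fix d assume d: "d dvd n \<and> (\<forall>s\<in>?S. d dvd ?v s)"
      \<comment> \<open>For n = 1 the number 1 is not an element of the carrier, which is {0}; there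
        the claim follows from d dividing n.\<close>
      show "d = 1"
      proof (cases "n = 1")
        case False
        then have "1 \<in> \<phi> ` carrier G" using surj by simp
        then obtain \<gamma> where \<gamma>: "\<gamma> \<in> carrier G" "\<phi> \<gamma> = 1" by auto
        obtain w where w: "w \<in> words ?S" "\<gamma> = word_eval G f w" using generated[OF \<gamma>(1)] by blast
        have dv: "int d dvd \<phi> (f s)" if "s \<in> ?S" for s
          using d that range[OF f_carrier[OF that]] by (metis int_dvd_int_iff int_nat_eq)
        have "int d dvd (\<Sum>l\<leftarrow>w. if snd l then \<phi> (f (fst l)) else - \<phi> (f (fst l)))"
          using w(1) by (induction w) (auto simp: dv)
        moreover have "\<phi> \<gamma> = (\<Sum>l\<leftarrow>w. if snd l then \<phi> (f (fst l)) else - \<phi> (f (fst l))) mod int n"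
          unfolding w(2) word_eval_hom[OF is_group group_integer_mod_group \<phi> f_closed w(1)]
          by (rule word_eval_integer_mod_group[OF n vS w(1)])
        ultimately have "int d dvd 1" using d \<gamma>(2) by (metis dvd_mod int_dvd_int_iff)
        then show ?thesis by simp
      qed (use d in simp)
    qed
  next
    assume gen: "\<forall>d. d dvd n \<and> (\<forall>s\<in>?S. d dvd ?v s) \<longrightarrow> d = 1"
    have "\<exists>s\<in>?S. \<not> p dvd ?v s" if "prime p" "p dvd n" for p
    proof (rule ccontr)
      assume "\<not> (\<exists>s\<in>?S. \<not> p dvd ?v s)"
      then have "p = 1" using gen that(2) by blast
      then show False using that(1) by simp
    qed
    from exists_unit_combination[OF finS n this]
    obtain c where c: "[(\<Sum>s\<in>?S. ?v s * c s) = 1] (mod n)" by blast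
    \<comment> \<open>The naturals whose residue lies in the image. They are closed under addition,
      so the combination congruent to 1 shows that all naturals belong to A.\<close>
    define A where "A = {x::nat. int x mod int n \<in> \<phi> ` carrier G}"
    have A0: "0 \<in> A" using \<phi>.hom_one one_closed by (force simp: A_def)
    have Aadd: "x + y \<in> A" if xy: "x \<in> A" "y \<in> A" for x y
    proof -
      obtain \<gamma> \<delta> where gd: "\<gamma> \<in> carrier G" "int x mod int n = \<phi> \<gamma>" "\<delta> \<in> carrier G" "int y mod int n = \<phi> \<delta>"
        using xy by (auto simp: A_def)
      then have "int (x + y) mod int n = \<phi> (\<gamma> \<otimes> \<delta>)"
        by (simp add: \<phi>.hom_mult mod_add_eq flip: gd(2) gd(4))
      moreover have "\<gamma> \<otimes> \<delta> \<in> carrier G" using gd by simp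
      ultimately show ?thesis unfolding A_def mem_Collect_eq by (rule image_eqI)
    qed
    have Amult: "x * k \<in> A" if "x \<in> A" for x k
      by (induction k) (use A0 Aadd that in auto)
    have vA: "?v s \<in> A" if s: "s \<in> ?S" for s
      using range[OF f_carrier[OF s]] f_carrier[OF s] by (simp add: A_def)
    have "(\<Sum>s\<in>T. ?v s * c s) \<in> A" if "T \<subseteq> ?S" for T
      using finite_subset[OF that finS] that
      by (induction T rule: finite_induct) (auto simp: A0 Aadd Amult vA)
    from this[of ?S] have "(\<Sum>s\<in>?S. ?v s * c s) \<in> A" by simp
    moreover have "int (\<Sum>s\<in>?S. ?v s * c s) mod int n = int 1 mod int n"
      using c by (simp only: cong_def zmod_int[symmetric])
    ultimately have "1 \<in> A" unfolding A_def by simp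
    then have all: "k \<in> A" for k using Amult[of 1 k] by simp
    have "carrier (integer_mod_group n) \<subseteq> \<phi> ` carrier G"
    proof
      fix y assume "y \<in> carrier (integer_mod_group n)"
      then have "0 \<le> y" "y < int n" using n by (simp_all add: carrier_integer_mod_group)
      then show "y \<in> \<phi> ` carrier G" using all[of "nat y"] by (simp add: A_def)
    qed
    then show "\<phi> ` carrier G = carrier (integer_mod_group n)" using \<phi>.hom_closed by blast
  qed
qed

text \<open>If the kernel is torsion-free, a power of x_i in it is trivial, so the image of x_i
  keeps the full order. Conversely, if a power of a torsion element t of the kernel fixes a coset of
  <x_i>, it is conjugate to a power of x_i in the kernel, which is trivial by the order condition;
  hence <t> acts freely on the complex.\<close>

lemma harvey_torsion_free_iff:
  assumes inf: "infinite (carrier G)" and H: "group H"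
    and \<phi>: "\<phi> \<in> hom G H"
  shows "(\<forall>t\<in>kernel G H \<phi>. \<forall>m::nat. 0 < m \<and> t [^]\<^bsub>G\<^esub> m = \<one>\<^bsub>G\<^esub> \<longrightarrow> t = \<one>\<^bsub>G\<^esub>) \<longleftrightarrow>
    (\<forall>i<length ns. \<forall>m::nat. \<phi> (f (GenX i)) [^]\<^bsub>H\<^esub> m = \<one>\<^bsub>H\<^esub> \<longleftrightarrow> ns ! i dvd m)"
proof -
  interpret \<phi>: group_hom G H \<phi> using H \<phi> by (simp add: group_hom_def group_hom_axioms_def is_group)
  show ?thesis
  proof (rule iffI, intro allI impI)
    fix i and m :: nat
    assume tf: "\<forall>t\<in>kernel G H \<phi>. \<forall>m::nat. 0 < m \<and> t [^] m = \<one> \<longrightarrow> t = \<one>" and i: "i < length ns"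
    show "\<phi> (x i) [^]\<^bsub>H\<^esub> m = \<one>\<^bsub>H\<^esub> \<longleftrightarrow> ns ! i dvd m"
    proof
      assume "\<phi> (x i) [^]\<^bsub>H\<^esub> m = \<one>\<^bsub>H\<^esub>"
      then have "x i [^] m \<in> kernel G H \<phi>" using i by (simp add: kernel_def \<phi>.hom_nat_pow)
      moreover have "(x i [^] m) [^] (ns ! i) = \<one>" using i by (simp add: nat_pow_pow order_x)
      ultimately have "x i [^] m = \<one>" using tf periods_pos[OF i] by blast
      then show "ns ! i dvd m" using order_x[OF i] by simp
    next
      assume "ns ! i dvd m"
      then have "x i [^] m = \<one>" using order_x[OF i] by simp
      then show "\<phi> (x i) [^]\<^bsub>H\<^esub> m = \<one>\<^bsub>H\<^esub>" using i by (metis \<phi>.hom_nat_pow \<phi>.hom_one x_closed)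
    qed
  next
    assume ord: "\<forall>i<length ns. \<forall>m::nat. \<phi> (x i) [^]\<^bsub>H\<^esub> m = \<one>\<^bsub>H\<^esub> \<longleftrightarrow> ns ! i dvd m"
    show "\<forall>t\<in>kernel G H \<phi>. \<forall>m::nat. 0 < m \<and> t [^] m = \<one> \<longrightarrow> t = \<one>"
    proof (intro ballI allI impI)
      fix t and m' :: nat assume t: "t \<in> kernel G H \<phi>" and m': "0 < m' \<and> t [^] m' = \<one>"
      then have tc: "t \<in> carrier G" and t1: "\<phi> t = \<one>\<^bsub>H\<^esub>" by (auto simp: kernel_def)
      \<comment> \<open>The least exponent makes m the exact order of t, as freeness
        requires.\<close>
      define m where "m = (LEAST m. 0 < m \<and> t [^] (m::nat) = \<one>)"
      have m: "0 < m" "t [^] m = \<one>" using LeastI[of "\<lambda>m. 0 < m \<and> t [^] (m::nat) = \<one>", OF m'] by (simp_all add: m_def)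
      have least: "t [^] j \<noteq> \<one>" if "0 < j" "j < m" for j :: nat
        using not_less_Least[of j "\<lambda>m. 0 < m \<and> t [^] (m::nat) = \<one>"] that by (simp add: m_def)
      have "m = 1"
      proof (rule no_torsion_avoiding_x_conjugates[OF inf tc m least])
        fix j i l :: nat and \<gamma> assume j: "0 < j" "j < m" and i: "i < length ns" and \<gamma>: "\<gamma> \<in> carrier G"
        show "t [^] j \<otimes> \<gamma> \<noteq> \<gamma> \<otimes> x i [^] l"
        proof
          assume eq: "t [^] j \<otimes> \<gamma> = \<gamma> \<otimes> x i [^] l"
          have "\<phi> (t [^] j \<otimes> \<gamma>) = \<phi> \<gamma>" using tc \<gamma> by (simp add: \<phi>.hom_nat_pow t1)
          moreover have "\<phi> (\<gamma> \<otimes> x i [^] l) = \<phi> \<gamma> \<otimes>\<^bsub>H\<^esub> \<phi> (x i) [^]\<^bsub>H\<^esub> l"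
            using i \<gamma> by (simp add: \<phi>.hom_nat_pow)
          ultimately have "\<phi> \<gamma> \<otimes>\<^bsub>H\<^esub> \<phi> (x i) [^]\<^bsub>H\<^esub> l = \<phi> \<gamma>" using eq by simp
          then have "\<phi> (x i) [^]\<^bsub>H\<^esub> l = \<one>\<^bsub>H\<^esub>" using i \<gamma> by simp
          then have "x i [^] l = \<one>" using ord order_x i by blast
          then have "t [^] j \<otimes> \<gamma> = \<gamma>" using eq \<gamma> by simp
          then have "t [^] j = \<one>" using tc \<gamma> by simp
          then show False using least[OF j] by simp
        qed
      qed
      then show "t = \<one>" using m(2) tc by simp
    qed
  qed
qed

end

text \<open>The generators are transported along the isomorphism. Infinitude of the group rules out
  g = 0 with at most two periods, where the x_i need not have the prescribed orders.\<close>

lemma cocompact_fuchsian_presentation: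
  assumes cc: "cocompact_fuchsian_group \<Gamma>" and sig: "has_signature \<Gamma> g ns"
  obtains f where "fuchsian_presentation (PSL2R\<lparr>carrier := \<Gamma>\<rparr>) f g ns"
proof -
  define S where "S = fuchsian_gens g ns"
  define R where "R = fuchsian_relators g ns"
  define P where "P = presented_group S R"
  define \<Gamma>' where "\<Gamma>' = PSL2R\<lparr>carrier := \<Gamma>\<rparr>"
  have ns: "\<forall>m\<in>set ns. 2 \<le> m" and iso: "\<Gamma>' \<cong> P"
    using sig by (simp_all add: has_signature_def S_def R_def P_def \<Gamma>'_def)
  have "subgroup \<Gamma> PSL2R" using cc by (simp add: cocompact_fuchsian_group_def)
  then have G: "group \<Gamma>'"
    unfolding \<Gamma>'_def by (rule subgroup.subgroup_is_group[OF _ group_PSL2R])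
  have P: "group P" unfolding P_def by (rule group_presented_group)
  interpret P: group P by (rule P)
  interpret G: group \<Gamma>' by (rule G)
  have inf: "infinite (carrier \<Gamma>')" using cocompact_fuchsian_infinite[OF cc] by (simp add: \<Gamma>'_def)
  obtain k where k: "k \<in> iso P \<Gamma>'" using G.iso_sym[OF iso] by (auto simp: is_iso_def)
  then have khom: "k \<in> hom P \<Gamma>'" and kbij: "bij_betw k (carrier P) (carrier \<Gamma>')" by (auto simp: iso_def)
  have large: "0 < g \<or> 3 \<le> length ns"
  proof (rule ccontr)
    assume "\<not> (0 < g \<or> 3 \<le> length ns)"
    then have "finite (carrier P)" using small_fuchsian_finite[OF ns] by (simp add: P_def S_def R_def)
    then show False using bij_betw_finite[OF kbij] inf by simp
  qed
  interpret k: group_hom P \<Gamma>' k using khom by (simp add: group_hom_def group_hom_axioms_def P G)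
  define f where "f s = k (pres_gen S R s)" for s
  have kf: "word_eval \<Gamma>' f w = k (pres_class S R w)" if "w \<in> words S" for w
    using hom_pres_class[OF G, of k S R w] khom that unfolding f_def P_def by simp
  have "fuchsian_presentation \<Gamma>' f g ns"
  proof
    show "f \<in> fuchsian_gens g ns \<rightarrow> carrier \<Gamma>'" by (auto simp: f_def S_def P_def)
  next
    fix r assume r: "r \<in> fuchsian_relators g ns"
    then have rw: "r \<in> words S"
      unfolding S_def fuchsian_relators_def using long_relator_words power_relator_words by auto
    then have "pres_class S R r = \<one>\<^bsub>P\<^esub>"
      using pres_eq.relator[of r R S] r by (simp add: P_def presented_group_one pres_class_eq_iff R_def)
    then show "word_eval \<Gamma>' f r = \<one>\<^bsub>\<Gamma>'\<^esub>" by (simp add: kf[OF rw])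
  next
    fix \<gamma> assume "\<gamma> \<in> carrier \<Gamma>'"
    then obtain U where U: "U \<in> carrier P" "\<gamma> = k U" using kbij by (auto simp: bij_betw_def)
    then obtain w where w: "w \<in> words S" "U = pres_class S R w" unfolding P_def by (auto elim: presented_group_carrierE)
    then show "\<exists>w\<in>words (fuchsian_gens g ns). \<gamma> = word_eval \<Gamma>' f w"
      using kf[OF w(1)] U(2) by (auto simp: S_def)
  next
    fix u v assume uv: "u \<in> words (fuchsian_gens g ns)" "v \<in> words (fuchsian_gens g ns)"
      "word_eval \<Gamma>' f u = word_eval \<Gamma>' f v"
    then have "k (pres_class S R u) = k (pres_class S R v)" using kf by (simp add: S_def)
    then have "pres_class S R u = pres_class S R v"
      using uv by (intro inj_onD[OF bij_betw_imp_inj_on[OF kbij]]) (auto simp: P_def S_def)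
    then show "pres_eq (fuchsian_gens g ns) (fuchsian_relators g ns) u v"
      using uv by (simp add: pres_class_eq_iff S_def R_def)
  next
    fix i and m :: nat assume i: "i < length ns"
    then have x: "pres_gen S R (GenX i) \<in> carrier P" by (simp add: P_def S_def)
    have "f (GenX i) [^]\<^bsub>\<Gamma>'\<^esub> m = k (pres_gen S R (GenX i) [^]\<^bsub>P\<^esub> m)"
      using k.hom_nat_pow[OF x, of m] by (simp add: f_def)
    also have "\<dots> = \<one>\<^bsub>\<Gamma>'\<^esub> \<longleftrightarrow> pres_gen S R (GenX i) [^]\<^bsub>P\<^esub> m = \<one>\<^bsub>P\<^esub>"
      using x inj_on_eq_iff[OF bij_betw_imp_inj_on[OF kbij], of "pres_gen S R (GenX i) [^]\<^bsub>P\<^esub> m" "\<one>\<^bsub>P\<^esub>"] by simp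
    also have "\<dots> \<longleftrightarrow> ns ! i dvd m"
      using fuchsian_gen_order[OF ns i large] by (simp add: P_def S_def R_def)
    finally show "f (GenX i) [^]\<^bsub>\<Gamma>'\<^esub> m = \<one>\<^bsub>\<Gamma>'\<^esub> \<longleftrightarrow> ns ! i dvd m" .
  next
    fix i assume "i < length ns"
    then have "2 \<le> ns ! i" using ns by simp
    then show "0 < ns ! i" by simp
  qed
  then show ?thesis using that by (simp add: \<Gamma>'_def)
qed

text \<open>The kernel has finite index, so it is again discrete and cocompact; only the absence of
  torsion is left to check.\<close>

lemma kernel_fuchsian_surface_group_iff:
  assumes cc: "cocompact_fuchsian_group \<Gamma>" and H: "group H" "finite (carrier H)"
    and \<phi>: "\<phi> \<in> hom (PSL2R\<lparr>carrier := \<Gamma>\<rparr>) H"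
  shows "fuchsian_surface_group (kernel (PSL2R\<lparr>carrier := \<Gamma>\<rparr>) H \<phi>) \<longleftrightarrow>
    (\<forall>t\<in>kernel (PSL2R\<lparr>carrier := \<Gamma>\<rparr>) H \<phi>. \<forall>m::nat.
      0 < m \<and> t [^]\<^bsub>PSL2R\<lparr>carrier := \<Gamma>\<rparr>\<^esub> m = \<one>\<^bsub>PSL2R\<lparr>carrier := \<Gamma>\<rparr>\<^esub> \<longrightarrow> t = \<one>\<^bsub>PSL2R\<lparr>carrier := \<Gamma>\<rparr>\<^esub>)"
proof -
  interpret PSL: group PSL2R by (rule group_PSL2R)
  define \<Gamma>' where "\<Gamma>' = PSL2R\<lparr>carrier := \<Gamma>\<rparr>"
  define K where "K = kernel \<Gamma>' H \<phi>"
  have \<Gamma>: "subgroup \<Gamma> PSL2R" using cc by (simp add: cocompact_fuchsian_group_def)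
  then have G: "group \<Gamma>'" unfolding \<Gamma>'_def by (rule subgroup.subgroup_is_group[OF _ group_PSL2R])
  interpret G: group \<Gamma>' by (rule G)
  interpret \<phi>: group_hom \<Gamma>' H \<phi> using \<phi> G H by (simp add: group_hom_def group_hom_axioms_def \<Gamma>'_def)
  have car: "carrier \<Gamma>' = \<Gamma>" by (simp add: \<Gamma>'_def)
  have "subgroup K \<Gamma>'" unfolding K_def by (rule \<phi>.subgroup_kernel)
  then have K: "subgroup K PSL2R" using PSL.incl_subgroup[OF \<Gamma>] by (simp add: \<Gamma>'_def)
  have K\<Gamma>: "K \<subseteq> \<Gamma>" by (auto simp: K_def kernel_def car)
  \<comment> \<open>One preimage for each value of \<phi>: these are coset representatives of the
    kernel, finite in number because H is finite.\<close>
  define rep where "rep y = (SOME \<gamma>. \<gamma> \<in> \<Gamma> \<and> \<phi> \<gamma> = y)" for y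
  have rep: "rep (\<phi> \<gamma>) \<in> \<Gamma> \<and> \<phi> (rep (\<phi> \<gamma>)) = \<phi> \<gamma>" if "\<gamma> \<in> \<Gamma>" for \<gamma>
    unfolding rep_def by (rule someI_ex) (use that in blast)
  have "\<phi> ` \<Gamma> \<subseteq> carrier H" using \<phi>.hom_closed by (auto simp: car)
  then have fin: "finite (rep ` \<phi> ` \<Gamma>)" using H(2) by (simp add: finite_subset)
  have "\<exists>\<kappa>\<in>K. \<exists>r\<in>rep ` \<phi> ` \<Gamma>. \<gamma> = \<kappa> \<otimes>\<^bsub>PSL2R\<^esub> r" if \<gamma>: "\<gamma> \<in> \<Gamma>" for \<gamma>
  proof -
    define r where "r = rep (\<phi> \<gamma>)"
    have r: "r \<in> carrier \<Gamma>'" "\<phi> r = \<phi> \<gamma>" using rep[OF \<gamma>] by (simp_all add: r_def car)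
    have \<gamma>': "\<gamma> \<in> carrier \<Gamma>'" using \<gamma> by (simp add: car)
    have "\<gamma> \<otimes>\<^bsub>\<Gamma>'\<^esub> inv\<^bsub>\<Gamma>'\<^esub> r \<in> K" using r \<gamma>' by (simp add: K_def kernel_def)
    moreover have "\<gamma> = (\<gamma> \<otimes>\<^bsub>\<Gamma>'\<^esub> inv\<^bsub>\<Gamma>'\<^esub> r) \<otimes>\<^bsub>\<Gamma>'\<^esub> r" using r \<gamma>' by (simp add: G.m_assoc)
    ultimately show ?thesis using \<gamma> by (auto simp: r_def \<Gamma>'_def)
  qed
  then have "cocompact_fuchsian_group K"
    using rep by (intro cocompact_fuchsian_finite_index[OF cc K K\<Gamma> fin]) auto
  moreover have "t [^]\<^bsub>PSL2R\<^esub> m = t [^]\<^bsub>\<Gamma>'\<^esub> m" for t and m :: nat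
    unfolding \<Gamma>'_def by (rule PSL.nat_pow_consistent)
  ultimately show ?thesis
    unfolding fuchsian_surface_group_def \<Gamma>'_def[symmetric] K_def[symmetric] by (simp add: \<Gamma>'_def)
qed

theorem theorem4p3:
  fixes \<Gamma> :: "(real^2^2) set set" and g n :: nat and ns :: "nat list"
  assumes "cocompact_fuchsian_group \<Gamma>"
    and "has_signature \<Gamma> g ns"
    and "n \<ge> 1"
  shows "(\<not> period_lcm ns dvd n \<longrightarrow> Epi_S \<Gamma> (integer_mod_group n) = {}) \<and>
    (period_lcm ns dvd n \<longrightarrow>
      finite (Epi_S \<Gamma> (integer_mod_group n)) \<and>
      real (card (Epi_S \<Gamma> (integer_mod_group n))) =
        real n ^ (2 * g) / real (period_lcm ns)
        * (\<Prod>i<length ns. real (totient (ns ! i)))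
        * (\<Prod>p | prime p \<and> p dvd n div period_lcm ns. 1 - 1 / real p ^ (2 * g))
        * (\<Prod>p | prime p \<and> p dvd period_lcm ns.
             1 - (- 1) ^ (e_exponent ns p - 1) / (real p - 1) ^ (e_exponent ns p - 1)))"
proof -
  define \<Gamma>' where "\<Gamma>' = PSL2R\<lparr>carrier := \<Gamma>\<rparr>"
  obtain f where "fuchsian_presentation (PSL2R\<lparr>carrier := \<Gamma>\<rparr>) f g ns"
    using cocompact_fuchsian_presentation[OF assms(1,2)] .
  then interpret fuchsian_presentation \<Gamma>' f g ns by (simp add: \<Gamma>'_def)
  let ?Z = "integer_mod_group n"
  let ?S = "fuchsian_gens g ns"
  have n: "0 < n" using assms(3) by simp
  have car: "carrier \<Gamma>' = \<Gamma>" by (simp add: \<Gamma>'_def)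
  have inf: "infinite (carrier \<Gamma>')" using cocompact_fuchsian_infinite[OF assms(1)] by (simp add: car)
  have finZ: "finite (carrier ?Z)" using n by (simp add: carrier_integer_mod_group)
  have inZ: "y \<in> carrier ?Z \<longleftrightarrow> 0 \<le> y \<and> y < int n" for y using n by (simp add: carrier_integer_mod_group)
  \<comment> \<open>The conditions on generator values: exact orders, the long relator,
    surjectivity. Exactness at the multiplier \<open>ns ! i\<close> includes the power
    relators.\<close>
  define V where "V = {v \<in> tuples ?S n.
      (\<forall>i<length ns. \<forall>m. n dvd m * v (GenX i) \<longleftrightarrow> ns ! i dvd m) \<and>
      n dvd (\<Sum>i<length ns. v (GenX i)) \<and> (\<forall>d. d dvd n \<and> (\<forall>s\<in>?S. d dvd v s) \<longrightarrow> d = 1)}"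
  define val where "val \<phi> = restrict (\<lambda>s. nat (\<phi> (f s))) ?S" for \<phi> :: "(real^2^2) set \<Rightarrow> int"
  have Epi: "\<phi> \<in> Epi_S \<Gamma> ?Z \<longleftrightarrow> \<phi> \<in> extensional \<Gamma> \<and> \<phi> \<in> hom \<Gamma>' ?Z \<and>
      (\<forall>d. d dvd n \<and> (\<forall>s\<in>?S. d dvd nat (\<phi> (f s))) \<longrightarrow> d = 1) \<and>
      (\<forall>i<length ns. \<forall>m. n dvd m * nat (\<phi> (f (GenX i))) \<longleftrightarrow> ns ! i dvd m)" for \<phi>
  proof (cases "\<phi> \<in> hom \<Gamma>' ?Z")
    case True
    have "\<phi> (f (GenX i)) [^]\<^bsub>?Z\<^esub> m = \<one>\<^bsub>?Z\<^esub> \<longleftrightarrow> n dvd m * nat (\<phi> (f (GenX i)))"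
      if "i < length ns" for i and m :: nat
    proof -
      have "0 \<le> \<phi> (f (GenX i))"
        using hom_in_carrier[OF True f_carrier, of "GenX i"] that by (simp add: inZ)
      then have "int m * \<phi> (f (GenX i)) = int (m * nat (\<phi> (f (GenX i))))" by simp
      then show ?thesis
        by (simp only: pow_integer_mod_group one_integer_mod_group int_dvd_int_iff flip: dvd_eq_mod_eq_0)
    qed
    moreover have "fuchsian_surface_group (kernel \<Gamma>' ?Z \<phi>) \<longleftrightarrow>
        (\<forall>i<length ns. \<forall>m::nat. \<phi> (f (GenX i)) [^]\<^bsub>?Z\<^esub> m = \<one>\<^bsub>?Z\<^esub> \<longleftrightarrow> ns ! i dvd m)"
      using kernel_fuchsian_surface_group_iff[OF assms(1) group_integer_mod_group finZ, of \<phi>] True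
        harvey_torsion_free_iff[OF inf group_integer_mod_group True] by (simp add: \<Gamma>'_def)
    ultimately show ?thesis
      using True cyclic_hom_surjective_iff[OF n True] by (auto simp: Epi_S_def epi_def \<Gamma>'_def)
  qed (simp add: Epi_S_def epi_def \<Gamma>'_def)
  have vrange: "\<phi> (f s) = int (val \<phi> s)" "val \<phi> s < n" if "\<phi> \<in> hom \<Gamma>' ?Z" "s \<in> ?S" for \<phi> s
  proof -
    have "\<phi> (f s) \<in> carrier ?Z" by (rule hom_in_carrier[OF that(1) f_carrier[OF that(2)]])
    then show "\<phi> (f s) = int (val \<phi> s)" "val \<phi> s < n" using that(2) by (auto simp: inZ val_def)
  qed
  have "inj_on val (Epi_S \<Gamma> ?Z)"
  proof (rule inj_onI)
    fix \<phi> \<psi> assume e: "\<phi> \<in> Epi_S \<Gamma> ?Z" "\<psi> \<in> Epi_S \<Gamma> ?Z" "val \<phi> = val \<psi>"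
    then have h: "\<phi> \<in> hom \<Gamma>' ?Z" "\<psi> \<in> hom \<Gamma>' ?Z" "\<phi> \<in> extensional \<Gamma>" "\<psi> \<in> extensional \<Gamma>"
      by (simp_all add: Epi)
    have "\<phi> \<gamma> = \<psi> \<gamma>" if "\<gamma> \<in> \<Gamma>" for \<gamma>
      by (rule hom_eqI[OF group_integer_mod_group h(1,2)])
        (use that vrange(1)[OF h(1)] vrange(1)[OF h(2)] e(3) in \<open>simp_all add: car\<close>)
    then show "\<phi> = \<psi>" using h(3,4) by (intro extensionalityI)
  qed
  moreover have "val ` Epi_S \<Gamma> ?Z = V"
  proof (intro equalityI subsetI)
    fix v assume "v \<in> val ` Epi_S \<Gamma> ?Z"
    then obtain \<phi> where \<phi>: "v = val \<phi>" "\<phi> \<in> Epi_S \<Gamma> ?Z" by blast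
    then have h: "\<phi> \<in> hom \<Gamma>' ?Z" by (simp add: Epi)
    have vS: "(\<lambda>s. \<phi> (f s)) \<in> ?S \<rightarrow> carrier ?Z" using hom_in_carrier[OF h f_carrier] by blast
    have "(\<Sum>i<length ns. \<phi> (f (GenX i))) mod int n = word_eval ?Z (\<lambda>s. \<phi> (f s)) (long_relator g ns)"
      by (rule word_eval_long_relator[OF n vS, symmetric])
    also have "\<dots> = \<phi> \<one>\<^bsub>\<Gamma>'\<^esub>"
      using word_eval_hom[OF is_group group_integer_mod_group h f_closed long_relator_words] long_relator by simp
    also have "\<dots> = 0" using hom_one[OF h is_group group_integer_mod_group] by simp
    also have "(\<Sum>i<length ns. \<phi> (f (GenX i))) = int (\<Sum>i<length ns. v (GenX i))"
      unfolding of_nat_sum \<phi>(1) by (rule sum.cong) (use vrange(1)[OF h] in simp_all)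
    finally have "n dvd (\<Sum>i<length ns. v (GenX i))" by (metis int_dvd_int_iff mod_0_imp_dvd)
    then show "v \<in> V" using \<phi> vrange(2)[OF h] by (auto simp: V_def Epi val_def)
  next
    fix v assume v: "v \<in> V"
    define w where "w s = int (v s)" for s
    have vS: "v s < n" if "s \<in> ?S" for s using v that by (auto simp: V_def)
    then have wS: "w \<in> ?S \<rightarrow> carrier ?Z" by (auto simp: w_def inZ)
    have "word_eval ?Z w r = \<one>\<^bsub>?Z\<^esub>" if "r \<in> fuchsian_relators g ns" for r
    proof -
      from that consider "r = long_relator g ns" | i where "i < length ns" "r = replicate (ns ! i) (GenX i, True)"
        by (auto simp: fuchsian_relators_def)
      then show ?thesis
      proof cases
        case 1
        have "n dvd (\<Sum>i<length ns. v (GenX i))" using v by (simp add: V_def)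
        then have "int n dvd (\<Sum>i<length ns. w (GenX i))"
          unfolding w_def of_nat_sum[symmetric] int_dvd_int_iff .
        then show ?thesis using 1 by (simp add: word_eval_long_relator[OF n wS])
      next
        case 2
        have "n dvd ns ! i * v (GenX i)" using v 2 by (simp add: V_def)
        then have "int n dvd int (ns ! i) * w (GenX i)" by (simp add: w_def flip: of_nat_mult)
        moreover have "w (GenX i) \<in> carrier ?Z" using wS 2 by auto
        ultimately show ?thesis
          using 2 group.word_eval_replicate[OF group_integer_mod_group, of w "GenX i"] by simp
      qed
    qed
    from hom_exists[OF group_integer_mod_group wS this]
    obtain \<phi>0 where \<phi>0: "\<phi>0 \<in> hom \<Gamma>' ?Z" "\<And>s. s \<in> ?S \<Longrightarrow> \<phi>0 (f s) = w s" by blast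
    \<comment> \<open>Restriction makes the homomorphism extensional, as membership in
      \<open>Epi_S\<close> demands.\<close>
    define \<phi> where "\<phi> = restrict \<phi>0 \<Gamma>"
    have \<phi>f: "\<phi> (f s) = int (v s)" if "s \<in> ?S" for s
      using \<phi>0(2)[OF that] f_carrier[OF that] by (simp add: \<phi>_def car w_def)
    have "\<phi> \<in> hom \<Gamma>' ?Z"
      using \<phi>0(1) m_closed by (simp add: \<phi>_def hom_def car Pi_iff)
    moreover have "\<phi> \<in> extensional \<Gamma>" by (simp add: \<phi>_def)
    ultimately have "\<phi> \<in> Epi_S \<Gamma> ?Z" using v by (simp add: Epi \<phi>f V_def)
    moreover have "v = val \<phi>"
      by (rule PiE_ext[of v ?S "\<lambda>_. {..<n}"]) (use v vS in \<open>auto simp: V_def val_def \<phi>f\<close>)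
    ultimately show "v \<in> val ` Epi_S \<Gamma> ?Z" by blast
  qed
  ultimately have bij: "bij_betw val (Epi_S \<Gamma> ?Z) V" by (simp add: bij_betw_def)
  have finS: "finite ?S" by (simp add: fuchsian_gens_def)
  have "finite V"
    by (rule finite_subset[of _ "tuples ?S n"]) (use finS in \<open>auto simp: V_def intro: finite_PiE\<close>)
  then have fin: "finite (Epi_S \<Gamma> ?Z)" using bij_betw_finite[OF bij] by simp
  have empty: "Epi_S \<Gamma> ?Z = {}" if nd: "\<not> period_lcm ns dvd n"
  proof -
    have "period_lcm ns dvd n" if "v \<in> V" for v
      unfolding period_lcm_def
    proof (rule Lcm_least)
      fix m assume "m \<in> set ns"
      then obtain i where i: "i < length ns" "m = ns ! i" by (auto simp: in_set_conv_nth)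
      \<comment> \<open>Exactness of the order, tested at the multiplier n: the left side holds
        trivially, so the period divides n.\<close>
      then have "n dvd n * v (GenX i) \<longleftrightarrow> m dvd n" using that unfolding V_def by blast
      then show "m dvd n" by simp
    qed
    then have "V = {}" using nd by blast
    then show ?thesis using bij by (simp add: bij_betw_def)
  qed
  have count: "real (card V) = real n ^ (2 * g) / real (period_lcm ns)
        * (\<Prod>i<length ns. real (totient (ns ! i)))
        * (\<Prod>p | prime p \<and> p dvd n div period_lcm ns. 1 - 1 / real p ^ (2 * g))
        * (\<Prod>p | prime p \<and> p dvd period_lcm ns.
             1 - (- 1) ^ (e_exponent ns p - 1) / (real p - 1) ^ (e_exponent ns p - 1))"
    if d: "period_lcm ns dvd n"
  proof -
    define I where "I = GenX ` {..<length ns}"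
    define J where "J = GenA ` {..<g} \<union> GenB ` {..<g}"
    \<comment> \<open>The index sets are sets of generators. The value 1 off the x_i is a
      placeholder, as \<open>per\<close> is evaluated on I only.\<close>
    define per where "per s = (case s of GenX i \<Rightarrow> ns ! i | _ \<Rightarrow> 1)" for s
    have injX: "inj_on GenX A" for A by (auto simp: inj_on_def)
    have "card J = 2 * g"
      unfolding J_def by (subst card_Un_disjoint) (auto simp: card_image inj_on_def)
    have lcm: "Lcm (per ` I) = period_lcm ns"
      by (simp add: I_def image_image per_def period_lcm_def set_conv_nth) (metis lessThan_def setcompr_eq_image)
    have e: "card {s \<in> I. \<not> p dvd period_lcm ns div per s} = e_exponent ns p" for p
    proof -
      have "{s \<in> I. \<not> p dvd period_lcm ns div per s} =
          GenX ` {i. i < length ns \<and> \<not> p dvd period_lcm ns div (ns ! i)}"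
        by (auto simp: I_def per_def)
      then show ?thesis by (simp add: card_image injX e_exponent_def)
    qed
    have tot: "(\<Prod>s\<in>I. real (totient (per s))) = (\<Prod>i<length ns. real (totient (ns ! i)))"
      unfolding I_def by (subst prod.reindex[OF injX]) (simp add: per_def)
    have sum: "(\<Sum>s\<in>I. v s) = (\<Sum>i<length ns. v (GenX i))" for v :: "fuchsian_gen \<Rightarrow> nat"
      unfolding I_def by (subst sum.reindex[OF injX]) simp
    have ball: "(\<forall>s\<in>I. \<forall>m. n dvd m * v s \<longleftrightarrow> per s dvd m) \<longleftrightarrow>
        (\<forall>i<length ns. \<forall>m. n dvd m * v (GenX i) \<longleftrightarrow> ns ! i dvd m)" for v :: "fuchsian_gen \<Rightarrow> nat"
      by (auto simp: I_def per_def)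
    have JI: "J \<union> I = ?S" by (simp add: I_def J_def fuchsian_gens_def)
    have "V = {v \<in> tuples (J \<union> I) n. (\<forall>s\<in>I. \<forall>m. n dvd m * v s \<longleftrightarrow> per s dvd m) \<and>
        n dvd (\<Sum>s\<in>I. v s) \<and> (\<forall>d. d dvd n \<and> (\<forall>s\<in>J \<union> I. d dvd v s) \<longrightarrow> d = 1)}"
      unfolding V_def sum ball JI ..
    moreover have "real (card \<dots>) = real n ^ card J / real (Lcm (per ` I)) * (\<Prod>s\<in>I. real (totient (per s))) *
        (\<Prod>p | prime p \<and> p dvd n div Lcm (per ` I). 1 - 1 / real p ^ card J) *
        (\<Prod>p | prime p \<and> p dvd Lcm (per ` I). 1 - (- 1) ^ (card {s \<in> I. \<not> p dvd Lcm (per ` I) div per s} - 1)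
          / (real p - 1) ^ (card {s \<in> I. \<not> p dvd Lcm (per ` I) div per s} - 1))"
    proof (rule card_surface_kernel_values)
      show "finite I" "finite J" "J \<inter> I = {}" by (auto simp: I_def J_def)
      show "0 < per s" if "s \<in> I" for s using that periods_pos by (auto simp: I_def per_def)
      show "Lcm (per ` I) dvd n" using d lcm by simp
    qed (rule n)
    ultimately show ?thesis by (simp add: lcm e tot \<open>card J = 2 * g\<close>)
  qed
  show ?thesis using empty count fin bij_betw_same_card[OF bij] by simp
qed

end
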